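(* Let $0<\beta<1$, $0<\alpha<n$ with $0<\alpha+\beta<n$, and let $b$ be a locally integrable function on $\mathbb{R}^n$. Then the following statements are equivalent: (1) $b\in\dot{\Lambda}_{\beta}(\mathbb{R}^n)$ and $b\ge 0$. (2) $[b,M_{\alpha}]$ is bounded from $L^{p(\cdot)}(\mathbb{R}^n)$ to $L^{q(\cdot)}(\mathbb{R}^n)$ for some pair $(p(\cdot),q(\cdot))\in\mathscr{B}^{\alpha+\beta}(\mathbb{R}^n)$. (3) $[b,M_{\alpha}]$ is bounded from $L^{p(\cdot)}(\mathbb{R}^n)$ to $L^{q(\cdot)}(\mathbb{R}^n)$ for all pairs $(p(\cdot),q(\cdot))\in\mathscr{B}^{\alpha+\beta}(\mathbb{R}^n)$. (4) There exists $s(\cdot)\in\mathscr{B}(\mathbb{R}^n)$ such that $$\sup_{Q}\frac{1}{|Q|^{\beta/n}}\frac{\big\|\big(b-|Q|^{-\alpha/n}M_{\alpha,Q}(b)\big)\chi_Q\big\|_{L^{s(\cdot)}(\mathbb{R}^n)}}{\|\chi_Q\|_{L^{s(\cdot)}(\mathbb{R}^n)}}<\infty,$$ where the supremum is over all cubes $Q\subset\mathbb{R}^n$. (5) The condition in (4) holds for every $s(\cdot)\in\mathscr{B}(\mathbb{R}^n)$.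
   Context: Cubes $Q\subset\mathbb{R}^n$ have sides parallel to the coordinate axes; $|Q|$ is Lebesgue measure and $\chi_Q$ the characteristic function. For $0\le\gamma<n$ and locally integrable $f$, the fractional maximal function is $M_\gamma(f)(x)=\sup_{Q\ni x}|Q|^{\gamma/n-1}\int_Q|f(y)|\,dy$ (supremum over cubes containing $x$); $M=M_0$ is the Hardy–Littlewood maximal function. For a fixed cube $Q_0$ and $\gamma\ge0$, $M_{\gamma,Q_0}(f)(x)=\sup\{|Q|^{\gamma/n-1}\int_Q|f(y)|\,dy : x\in Q\subseteq Q_0\}$ for $x\in Q_0$. The nonlinear commutator is $[b,M_\alpha](f)(x)=b(x)M_\alpha(f)(x)-M_\alpha(bf)(x)$. For $0<\beta<1$, $\dot{\Lambda}_\beta(\mathbb{R}^n)$ is the set of functions $b$ with $|b(x)-b(y)|\le C|x-y|^\beta$ for all $x,y$. For measurable $p(\cdot):\mathbb{R}^n\to[1,\infty)$, $L^{p(\cdot)}(\mathbb{R}^n)$ is the space of measurable $f$ with $\int(|f(x)|/\lambda)^{p(x)}dx<\infty$ for some $\lambda>0$, normed by $\|f\|_{L^{p(\cdot)}}=\inf\{\lambda>0:\int(|f(x)|/\lambda)^{p(x)}dx\le1\}$. $\mathscr{P}(\mathbb{R}^n)$ is the set of measurable $p(\cdot):\mathbb{R}^n\to[1,\infty)$ with $1<p_-:=\operatorname{ess\,inf}p$ and $p_+:=\operatorname{ess\,sup}p<\infty$; $\mathscr{B}(\mathbb{R}^n)$ is the set of $p(\cdot)\in\mathscr{P}(\mathbb{R}^n)$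 such that $M$ is bounded on $L^{p(\cdot)}(\mathbb{R}^n)$. For $0<\gamma<n$, $(p(\cdot),q(\cdot))\in\mathscr{B}^\gamma(\mathbb{R}^n)$ means $p(\cdot)\in\mathscr{P}(\mathbb{R}^n)$ with $p_+<n/\gamma$, $1/q(\cdot)=1/p(\cdot)-\gamma/n$, and $q(\cdot)(n-\gamma)/n\in\mathscr{B}(\mathbb{R}^n)$. An operator $T$ is bounded from $L^{p(\cdot)}$ to $L^{q(\cdot)}$ if $\|T(f)\|_{L^{q(\cdot)}}\le C\|f\|_{L^{p(\cdot)}}$ for all $f\in L^{p(\cdot)}$.
   Formalization: Condition (1) is read up to null sets: b agrees almost everywhere with a function satisfying the Hölder inequality for all x, y, and b ≥ 0 almost everywhere; read pointwise, (2)⇒(1) fails for b the indicator of a point. *)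

theory Defs
  imports "HOL-Analysis.Analysis"
begin

definition cube :: "'a::euclidean_space set \<Rightarrow> bool" where
  "cube Q \<longleftrightarrow> (\<exists>a l. 0 < l \<and> Q = cbox a (a + l *\<^sub>R One))"

definition locally_integrable :: "('a::euclidean_space \<Rightarrow> real) \<Rightarrow> bool" where
  "locally_integrable f \<longleftrightarrow> f \<in> borel_measurable lebesgue \<and>
     (\<forall>K. compact K \<longrightarrow> set_integrable lebesgue K f)"

definition frac_max :: "real \<Rightarrow> ('a::euclidean_space \<Rightarrow> real) \<Rightarrow> 'a \<Rightarrow> ennreal" where
  "frac_max \<gamma> f x = (SUP Q \<in> {Q. cube Q \<and> x \<in> Q}.
      ennreal (measure lebesgue Q powr (\<gamma> / real DIM('a) - 1)) *
      (\<integral>\<^sup>+ y \<in> Q. ennreal \<bar>f y\<bar> \<partial>lebesgue))"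

definition frac_max_loc :: "real \<Rightarrow> 'a::euclidean_space set \<Rightarrow> ('a \<Rightarrow> real) \<Rightarrow> 'a \<Rightarrow> ennreal" where
  "frac_max_loc \<gamma> Q0 f x = (SUP Q \<in> {Q. cube Q \<and> x \<in> Q \<and> Q \<subseteq> Q0}.
      ennreal (measure lebesgue Q powr (\<gamma> / real DIM('a) - 1)) *
      (\<integral>\<^sup>+ y \<in> Q. ennreal \<bar>f y\<bar> \<partial>lebesgue))"

definition commutator_frac_max :: "('a::euclidean_space \<Rightarrow> real) \<Rightarrow> real \<Rightarrow> ('a \<Rightarrow> real) \<Rightarrow> 'a \<Rightarrow> real" where
  "commutator_frac_max b \<alpha> f x =
     b x * enn2real (frac_max \<alpha> f x) - enn2real (frac_max \<alpha> (\<lambda>y. b y * f y) x)"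

definition modular :: "('a::euclidean_space \<Rightarrow> real) \<Rightarrow> ('a \<Rightarrow> real) \<Rightarrow> real \<Rightarrow> ennreal" where
  "modular p f lam = (\<integral>\<^sup>+ x. ennreal ((\<bar>f x\<bar> / lam) powr p x) \<partial>lebesgue)"

definition Lvar :: "('a::euclidean_space \<Rightarrow> real) \<Rightarrow> ('a \<Rightarrow> real) set" where
  "Lvar p = {f. f \<in> borel_measurable lebesgue \<and> (\<exists>lam>0. modular p f lam < \<infinity>)}"

text \<open>Luxemburg norm (value \<infinity> if no admissible lambda exists).\<close>
definition Lvar_norm :: "('a::euclidean_space \<Rightarrow> real) \<Rightarrow> ('a \<Rightarrow> real) \<Rightarrow> ennreal" where
  "Lvar_norm p f = Inf {ennreal lam | lam. 0 < lam \<and> modular p f lam \<le> 1}"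

definition ess_inf :: "('a::euclidean_space \<Rightarrow> real) \<Rightarrow> ereal" where
  "ess_inf p = Sup {z. AE x in lebesgue. z \<le> ereal (p x)}"

definition ess_sup :: "('a::euclidean_space \<Rightarrow> real) \<Rightarrow> ereal" where
  "ess_sup p = Inf {z. AE x in lebesgue. ereal (p x) \<le> z}"

definition exps_P :: "('a::euclidean_space \<Rightarrow> real) set" where
  "exps_P = {p. p \<in> borel_measurable lebesgue \<and> (\<forall>x. 1 \<le> p x) \<and>
                1 < ess_inf p \<and> ess_sup p < \<infinity>}"

definition max_op_bounded :: "(('a::euclidean_space \<Rightarrow> real) \<Rightarrow> 'a \<Rightarrow> ennreal) \<Rightarrow>
    ('a \<Rightarrow> real) \<Rightarrow> ('a \<Rightarrow> real) \<Rightarrow> bool" where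
  "max_op_bounded T p q \<longleftrightarrow> (\<exists>C. \<forall>f \<in> Lvar p.
      (AE x in lebesgue. T f x < \<infinity>) \<and>
      (\<lambda>x. enn2real (T f x)) \<in> Lvar q \<and>
      Lvar_norm q (\<lambda>x. enn2real (T f x)) \<le> ennreal C * Lvar_norm p f)"

definition exps_B :: "('a::euclidean_space \<Rightarrow> real) set" where
  "exps_B = {p. p \<in> exps_P \<and> max_op_bounded (frac_max 0) p p}"

definition exps_Bgamma :: "real \<Rightarrow> (('a::euclidean_space \<Rightarrow> real) \<times> ('a \<Rightarrow> real)) set" where
  "exps_Bgamma \<gamma> = {(p, q). p \<in> exps_P \<and> ess_sup p < ereal (real DIM('a) / \<gamma>) \<and>
      (\<forall>x. 1 / q x = 1 / p x - \<gamma> / real DIM('a)) \<and>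
      (\<lambda>x. q x * (real DIM('a) - \<gamma>) / real DIM('a)) \<in> exps_B}"

text \<open>Boundedness of the commutator [b, M_alpha] from L^p to L^q: for every f in L^p,
  M_alpha f and M_alpha (b f) are finite a.e. (so the commutator is a well-defined
  a.e. finite function), it lies in L^q, and the norm estimate holds.\<close>
definition commutator_bounded :: "('a::euclidean_space \<Rightarrow> real) \<Rightarrow> real \<Rightarrow>
    ('a \<Rightarrow> real) \<Rightarrow> ('a \<Rightarrow> real) \<Rightarrow> bool" where
  "commutator_bounded b \<alpha> p q \<longleftrightarrow> (\<exists>C. \<forall>f \<in> Lvar p.
      (AE x in lebesgue. frac_max \<alpha> f x < \<infinity> \<and> frac_max \<alpha> (\<lambda>y. b y * f y) x < \<infinity>) \<and>
      commutator_frac_max b \<alpha> f \<in> Lvar q \<and>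
      Lvar_norm q (commutator_frac_max b \<alpha> f) \<le> ennreal C * Lvar_norm p f)"

definition lipschitz_beta :: "real \<Rightarrow> ('a::euclidean_space \<Rightarrow> real) \<Rightarrow> bool" where
  "lipschitz_beta \<beta> b \<longleftrightarrow> (\<exists>g C. (\<forall>x y. \<bar>g x - g y\<bar> \<le> C * norm (x - y) powr \<beta>) \<and>
      (AE x in lebesgue. b x = g x))"

definition osc_sup :: "real \<Rightarrow> real \<Rightarrow> ('a::euclidean_space \<Rightarrow> real) \<Rightarrow> ('a \<Rightarrow> real) \<Rightarrow> ennreal" where
  "osc_sup \<alpha> \<beta> b s = (SUP Q \<in> {Q. cube Q}.
      ennreal (measure lebesgue Q powr (- \<beta> / real DIM('a))) *
      Lvar_norm s (\<lambda>x. (b x - measure lebesgue Q powr (- \<alpha> / real DIM('a)) *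
                              enn2real (frac_max_loc \<alpha> Q b x)) * indicator Q x)
      / Lvar_norm s (indicator Q))"

end

theory Submission
  imports Defs
begin

text \<open>
  If \<open>b\<close> is nonnegative and Hoelder continuous of order \<open>\<beta>\<close>, then \<open>b\<close> varies by at most a multiple of
  \<open>|Q|^(\<beta>/n)\<close> on a cube \<open>Q\<close>, so the commutator is dominated pointwise by the fractional maximal function
  of order \<open>\<gamma> = \<alpha> + \<beta>\<close>. The latter is bounded from \<open>L^p\<close> to \<open>L^q\<close> because, when the modular of \<open>f\<close> is at
  most 1, it is at most \<open>2 * M(|f|^(p/s))^(1 - \<gamma>/n)\<close> with \<open>s = q * (1 - \<gamma>/n)\<close>, and \<open>M\<close> is bounded on \<open>L^s\<close>.
  The classes of exponents are not empty by the Hardy-Littlewood theorem on \<open>L^2\<close>.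

  Conversely, testing the commutator on the indicator of \<open>Q\<close> turns its boundedness into a bound for the
  oscillation \<open>b - |Q|^(-\<alpha>/n) * M_{\<alpha>,Q}(b)\<close> in the norm of \<open>L^q\<close>, and the boundedness of \<open>M\<close> passes
  from norms to averages over \<open>Q\<close>. Since \<open>|Q|^(-\<alpha>/n) * M_{\<alpha>,Q}(b)\<close> is at least the average of \<open>|b|\<close>, the
  averages over \<open>Q\<close> of \<open>|b - b_Q|\<close> and of \<open>|b| - b\<close> are both of order \<open>|Q|^(\<beta>/n)\<close>. The first estimate gives
  the Hoelder continuous representative by Campanato's argument, the second one gives \<open>b \<ge> 0\<close>.
\<close>

subsection \<open>Cubes and fractional averages\<close>

text \<open>The order \<gamma> enters through one identity: with \<theta> = 1 - \<gamma>/n and s = q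
  * \<theta>, the relation 1/q = 1/p - \<gamma>/n becomes (p/s) * \<theta> + p * (1 - \<theta>) = 1.
  It splits |f| into (|f|^(p/s))^\<theta> * (|f|^p)^(1 - \<theta>); the first factor is fed to M,
  the second is absorbed by the modular. Norms pass to averages because M k is at least the average
  of k at every point of Q, so this average times the norm of the indicator of Q is at most a
  constant times the norm of k. Both converse implications thereby reduce to the same bound on the
  integral of |\<open>osc_fun\<close>|. Two features of the formal notions shape the arguments. The
  Luxemburg norm is an infimum, so estimates are made on modulars at a fixed scale and translated
  back. And \<open>enn2real\<close> sends infinity to 0, so a real-valued lower bound by a maximal
  function needs its finiteness almost everywhere, which comes from the weak type (1,1) estimate or
  from the boundedness of M.\<close>

lemma cubeE:
  fixes Q :: "'a::euclidean_space set"
  assumes "cube Q"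
  obtains a l where "0 < l" "Q = cbox a (a + l *\<^sub>R One)"
  using assms unfolding cube_def by blast

lemma cubeI: "0 < l \<Longrightarrow> cube (cbox a (a + l *\<^sub>R One))"
  unfolding cube_def by blast

lemma mem_cube_cbox:
  "x \<in> cbox a (a + l *\<^sub>R One) \<longleftrightarrow> (\<forall>i\<in>Basis. a \<bullet> i \<le> x \<bullet> i \<and> x \<bullet> i \<le> a \<bullet> i + l)"
  by (auto simp: mem_box inner_simps)

lemma measure_cube_cbox:
  fixes a :: "'a::euclidean_space"
  assumes "0 \<le> l"
  shows "measure lebesgue (cbox a (a + l *\<^sub>R One)) = l ^ DIM('a)"
proof -
  have "measure lebesgue (cbox a (a + l *\<^sub>R One)) = Henstock_Kurzweil_Integration.content (cbox a (a + l *\<^sub>R One))"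
    by simp
  also have "\<dots> = l ^ DIM('a)"
    using assms by (subst content_cbox) (auto simp: inner_simps)
  finally show ?thesis .
qed

lemma emeasure_cube_eq:
  fixes Q :: "'a::euclidean_space set"
  shows "cube Q \<Longrightarrow> emeasure lebesgue Q = ennreal (measure lebesgue Q)"
  by (elim cubeE) (simp add: emeasure_eq_ennreal_measure emeasure_lborel_cbox_eq)

lemma measure_cube_pos:
  fixes Q :: "'a::euclidean_space set"
  shows "cube Q \<Longrightarrow> 0 < measure lebesgue Q"
  by (elim cubeE) (metis measure_cube_cbox less_imp_le zero_less_power)

lemma cube_sets: "cube Q \<Longrightarrow> Q \<in> sets lebesgue"
  by (elim cubeE) auto

lemma compact_cube: "cube Q \<Longrightarrow> compact Q"
  by (elim cubeE) auto

lemma cube_side_powr: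
  fixes a :: "'a::euclidean_space"
  assumes "0 < l"
  shows "measure lebesgue (cbox a (a + l *\<^sub>R One)) powr (c / real DIM('a)) = l powr c"
  using assms by (simp add: measure_cube_cbox powr_powr flip: powr_realpow del: measure_completion)

lemma cube_diameter:
  fixes x y :: "'a::euclidean_space"
  assumes "x \<in> cbox a (a + l *\<^sub>R One)" "y \<in> cbox a (a + l *\<^sub>R One)"
  shows "norm (x - y) \<le> real DIM('a) * l"
proof -
  have "norm (x - y) \<le> (\<Sum>i\<in>Basis. \<bar>(x - y) \<bullet> i\<bar>)"
    by (rule norm_le_l1)
  also have "\<dots> \<le> (\<Sum>i\<in>(Basis::'a set). l)"
  proof (rule sum_mono)
    fix i :: 'a assume i: "i \<in> Basis"
    have "a \<bullet> i \<le> x \<bullet> i \<and> x \<bullet> i \<le> a \<bullet> i + l" "a \<bullet> i \<le> y \<bullet> i \<and> y \<bullet> i \<le> a \<bullet> i + l"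
      using assms i unfolding mem_cube_cbox by blast+
    then show "\<bar>(x - y) \<bullet> i\<bar> \<le> l" unfolding inner_diff_left by arith
  qed
  finally show ?thesis by simp
qed

lemma cube_diameter_powr:
  fixes Q :: "'a::euclidean_space set"
  assumes "cube Q" "x \<in> Q" "y \<in> Q" "0 \<le> \<beta>"
  shows "norm (x - y) powr \<beta> \<le> real DIM('a) powr \<beta> * measure lebesgue Q powr (\<beta> / real DIM('a))"
proof -
  obtain a l where l: "0 < l" "Q = cbox a (a + l *\<^sub>R One)" by (rule cubeE[OF assms(1)])
  have "norm (x - y) \<le> real DIM('a) * l" using assms l cube_diameter by blast
  then have "norm (x - y) powr \<beta> \<le> (real DIM('a) * l) powr \<beta>"
    using assms by (intro powr_mono2) auto
  also have "\<dots> = real DIM('a) powr \<beta> * measure lebesgue Q powr (\<beta> / real DIM('a))"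
    unfolding l(2) cube_side_powr[OF l(1)] using l by (simp add: powr_mult)
  finally show ?thesis .
qed

text \<open>The term under the suprema of \<open>frac_max\<close> and \<open>frac_max_loc\<close>;
  an estimate for a single cube then serves both.\<close>

definition frac_avg :: "real \<Rightarrow> ('a::euclidean_space \<Rightarrow> real) \<Rightarrow> 'a set \<Rightarrow> ennreal" where
  "frac_avg \<gamma> f Q = ennreal (measure lebesgue Q powr (\<gamma> / real DIM('a) - 1)) *
      (\<integral>\<^sup>+ y \<in> Q. ennreal \<bar>f y\<bar> \<partial>lebesgue)"

lemma frac_max_eq: "frac_max \<gamma> f x = (SUP Q \<in> {Q. cube Q \<and> x \<in> Q}. frac_avg \<gamma> f Q)"
  unfolding frac_max_def frac_avg_def ..

lemma frac_max_loc_eq: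
  "frac_max_loc \<gamma> Q0 f x = (SUP Q \<in> {Q. cube Q \<and> x \<in> Q \<and> Q \<subseteq> Q0}. frac_avg \<gamma> f Q)"
  unfolding frac_max_loc_def frac_avg_def ..

lemma frac_avg_le_frac_max: "cube Q \<Longrightarrow> x \<in> Q \<Longrightarrow> frac_avg \<gamma> f Q \<le> frac_max \<gamma> f x"
  unfolding frac_max_eq by (rule SUP_upper) simp

lemma frac_avg_le_frac_max_loc:
  "cube Q \<Longrightarrow> x \<in> Q \<Longrightarrow> Q \<subseteq> Q0 \<Longrightarrow> frac_avg \<gamma> f Q \<le> frac_max_loc \<gamma> Q0 f x"
  unfolding frac_max_loc_eq by (rule SUP_upper) simp

lemma frac_max_leI: "(\<And>Q. cube Q \<Longrightarrow> x \<in> Q \<Longrightarrow> frac_avg \<gamma> f Q \<le> c) \<Longrightarrow> frac_max \<gamma> f x \<le> c"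
  unfolding frac_max_eq by (rule SUP_least) simp

lemma frac_max_loc_leI:
  "(\<And>Q. cube Q \<Longrightarrow> x \<in> Q \<Longrightarrow> Q \<subseteq> Q0 \<Longrightarrow> frac_avg \<gamma> f Q \<le> c) \<Longrightarrow> frac_max_loc \<gamma> Q0 f x \<le> c"
  unfolding frac_max_loc_eq by (rule SUP_least) simp

lemma frac_avg_mono_AE:
  assumes "AE x in lebesgue. \<bar>f x\<bar> \<le> \<bar>g x\<bar>"
  shows "frac_avg \<gamma> f Q \<le> frac_avg \<gamma> g Q"
  unfolding frac_avg_def using assms
  by (intro mult_left_mono nn_integral_mono_AE) (auto simp: indicator_def elim!: eventually_mono)

lemma frac_max_mono_AE:
  assumes "AE x in lebesgue. \<bar>f x\<bar> \<le> \<bar>g x\<bar>"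
  shows "frac_max \<gamma> f x \<le> frac_max \<gamma> g x"
  unfolding frac_max_eq by (intro SUP_mono) (use frac_avg_mono_AE[OF assms] in blast)

lemma frac_max_cong_AE:
  assumes "AE x in lebesgue. \<bar>f x\<bar> = \<bar>g x\<bar>"
  shows "frac_max \<gamma> f x = frac_max \<gamma> g x"
proof (rule antisym)
  show "frac_max \<gamma> f x \<le> frac_max \<gamma> g x"
    using assms by (intro frac_max_mono_AE) (auto elim!: eventually_mono)
  show "frac_max \<gamma> g x \<le> frac_max \<gamma> f x"
    using assms by (intro frac_max_mono_AE) (auto elim!: eventually_mono)
qed

lemma frac_avg_scale:
  assumes "f \<in> borel_measurable lebesgue"
    and "cube Q"
  shows "frac_avg \<gamma> (\<lambda>x. c * f x) Q = ennreal \<bar>c\<bar> * frac_avg \<gamma> f Q"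
proof -
  note [measurable] = assms(1) cube_sets[OF assms(2)]
  have "(\<integral>\<^sup>+ y \<in> Q. ennreal \<bar>c * f y\<bar> \<partial>lebesgue) = (\<integral>\<^sup>+ y. ennreal \<bar>c\<bar> * (ennreal \<bar>f y\<bar> * indicator Q y) \<partial>lebesgue)"
    by (intro nn_integral_cong) (simp add: abs_mult ennreal_mult mult.assoc)
  also have "\<dots> = ennreal \<bar>c\<bar> * (\<integral>\<^sup>+ y \<in> Q. ennreal \<bar>f y\<bar> \<partial>lebesgue)"
    by (rule nn_integral_cmult) measurable
  finally show ?thesis unfolding frac_avg_def by (simp add: mult_ac)
qed

lemma frac_max_scale:
  assumes "f \<in> borel_measurable lebesgue"
  shows "frac_max \<gamma> (\<lambda>x. c * f x) x = ennreal \<bar>c\<bar> * frac_max \<gamma> f x"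
  unfolding frac_max_eq SUP_mult_left_ennreal
  by (intro SUP_cong refl) (simp add: frac_avg_scale[OF assms])

text \<open>Slide \<open>Q\<close> into \<open>Q0\<close> one coordinate at a time; if
  \<open>Q\<close> has the larger side, \<open>Q0\<close> itself serves. This makes localisation to
  \<open>Q0\<close> the same as truncation by its indicator.\<close>

lemma cube_Int_subcube:
  fixes Q Q0 :: "'a::euclidean_space set"
  assumes "cube Q" "cube Q0" "x \<in> Q" "x \<in> Q0"
  shows "\<exists>P. cube P \<and> x \<in> P \<and> P \<subseteq> Q0 \<and> Q \<inter> Q0 \<subseteq> P \<and> measure lebesgue P \<le> measure lebesgue Q"
proof -
  obtain a l where l: "0 < l" "Q = cbox a (a + l *\<^sub>R One)" by (rule cubeE[OF assms(1)])
  obtain c L where L: "0 < L" "Q0 = cbox c (c + L *\<^sub>R One)" by (rule cubeE[OF assms(2)])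
  show ?thesis
  proof (cases "L \<le> l")
    case True
    then show ?thesis using assms l L
      by (intro exI[of _ Q0]) (auto simp: measure_cube_cbox power_mono simp del: measure_completion)
  next
    case False
    \<comment> \<open>Each coordinate of the corner is clamped to the range in which a cube of side
      \<open>l\<close> fits inside \<open>Q0\<close>.\<close>
    define a' where "a' = (\<Sum>i\<in>Basis. max (c \<bullet> i) (min (a \<bullet> i) (c \<bullet> i + L - l)) *\<^sub>R i)"
    have a': "a' \<bullet> i = max (c \<bullet> i) (min (a \<bullet> i) (c \<bullet> i + L - l))" if "i \<in> Basis" for i
      using that by (simp add: a'_def inner_sum_left inner_Basis if_distrib sum.delta cong: if_cong)
    let ?P = "cbox a' (a' + l *\<^sub>R One)"
    have 1: "Q \<inter> Q0 \<subseteq> ?P"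
      unfolding l(2) L(2) subset_iff Int_iff mem_cube_cbox
    proof (intro allI impI ballI)
      fix y i :: 'a
      assume y: "(\<forall>i\<in>Basis. a \<bullet> i \<le> y \<bullet> i \<and> y \<bullet> i \<le> a \<bullet> i + l) \<and> (\<forall>i\<in>Basis. c \<bullet> i \<le> y \<bullet> i \<and> y \<bullet> i \<le> c \<bullet> i + L)"
        and i: "i \<in> Basis"
      then have "a \<bullet> i \<le> y \<bullet> i \<and> y \<bullet> i \<le> a \<bullet> i + l" "c \<bullet> i \<le> y \<bullet> i \<and> y \<bullet> i \<le> c \<bullet> i + L" by blast+
      then show "a' \<bullet> i \<le> y \<bullet> i \<and> y \<bullet> i \<le> a' \<bullet> i + l" unfolding a'[OF i] using False l(1) by linarith
    qed
    have 2: "?P \<subseteq> Q0"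
      unfolding L(2) subset_iff mem_cube_cbox
    proof (intro allI impI ballI)
      fix y i :: 'a
      assume "\<forall>i\<in>Basis. a' \<bullet> i \<le> y \<bullet> i \<and> y \<bullet> i \<le> a' \<bullet> i + l" and i: "i \<in> Basis"
      then have "a' \<bullet> i \<le> y \<bullet> i \<and> y \<bullet> i \<le> a' \<bullet> i + l" by blast
      then show "c \<bullet> i \<le> y \<bullet> i \<and> y \<bullet> i \<le> c \<bullet> i + L" unfolding a'[OF i] using False l(1) by linarith
    qed
    show ?thesis using 1 2 assms l
      by (intro exI[of _ ?P]) (auto simp: measure_cube_cbox cubeI simp del: measure_completion)
  qed
qed

text \<open>The cube from \<open>cube_Int_subcube\<close> keeps all of the part of \<open>Q\<close>
  inside \<open>Q0\<close> and has no larger measure. As the exponent \<gamma>/n - 1 is not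
  positive, its weight is at least that of \<open>Q\<close>. The local maximal function inherits
  measurability and finiteness through this identity.\<close>

lemma frac_max_loc_eq_frac_max:
  fixes Q0 :: "'a::euclidean_space set"
  assumes "cube Q0" "x \<in> Q0" "\<gamma> \<le> real DIM('a)"
  shows "frac_max_loc \<gamma> Q0 f x = frac_max \<gamma> (\<lambda>y. f y * indicator Q0 y) x"
proof (rule antisym)
  show "frac_max_loc \<gamma> Q0 f x \<le> frac_max \<gamma> (\<lambda>y. f y * indicator Q0 y) x"
  proof (rule frac_max_loc_leI)
    fix Q assume Q: "cube Q" "x \<in> Q" "Q \<subseteq> Q0"
    have "(\<integral>\<^sup>+ y \<in> Q. ennreal \<bar>f y\<bar> \<partial>lebesgue) = (\<integral>\<^sup>+ y \<in> Q. ennreal \<bar>f y * indicator Q0 y\<bar> \<partial>lebesgue)"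
      using Q(3) by (intro nn_integral_cong) (auto simp: indicator_def)
    then have "frac_avg \<gamma> f Q = frac_avg \<gamma> (\<lambda>y. f y * indicator Q0 y) Q"
      unfolding frac_avg_def by simp
    also have "\<dots> \<le> frac_max \<gamma> (\<lambda>y. f y * indicator Q0 y) x"
      using Q by (intro frac_avg_le_frac_max)
    finally show "frac_avg \<gamma> f Q \<le> frac_max \<gamma> (\<lambda>y. f y * indicator Q0 y) x" .
  qed
  show "frac_max \<gamma> (\<lambda>y. f y * indicator Q0 y) x \<le> frac_max_loc \<gamma> Q0 f x"
  proof (rule frac_max_leI)
    fix Q assume Q: "cube Q" "x \<in> Q"
    obtain P where P: "cube P" "x \<in> P" "P \<subseteq> Q0" "Q \<inter> Q0 \<subseteq> P" "measure lebesgue P \<le> measure lebesgue Q"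
      using cube_Int_subcube[OF Q(1) assms(1) Q(2) assms(2)] by blast
    have "ennreal \<bar>f y * indicator Q0 y\<bar> * indicator Q y \<le> ennreal \<bar>f y\<bar> * indicator P y" for y
      using P(4) by (cases "y \<in> Q"; cases "y \<in> Q0") auto
    then have "(\<integral>\<^sup>+ y \<in> Q. ennreal \<bar>f y * indicator Q0 y\<bar> \<partial>lebesgue) \<le> (\<integral>\<^sup>+ y \<in> P. ennreal \<bar>f y\<bar> \<partial>lebesgue)"
      by (rule nn_integral_mono)
    moreover have "measure lebesgue Q powr (\<gamma> / real DIM('a) - 1) \<le> measure lebesgue P powr (\<gamma> / real DIM('a) - 1)"
      using assms P measure_cube_pos by (intro powr_mono2') (auto simp: divide_simps)
    ultimately have "frac_avg \<gamma> (\<lambda>y. f y * indicator Q0 y) Q \<le> frac_avg \<gamma> f P"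
      unfolding frac_avg_def by (intro mult_mono) (simp_all add: ennreal_leI)
    also have "\<dots> \<le> frac_max_loc \<gamma> Q0 f x"
      using P by (intro frac_avg_le_frac_max_loc)
    finally show "frac_avg \<gamma> (\<lambda>y. f y * indicator Q0 y) Q \<le> frac_max_loc \<gamma> Q0 f x" .
  qed
qed

text \<open>A point near \<open>x\<close> may lie outside the closed cube \<open>Q\<close>. A
  slightly larger cube contains a neighbourhood of \<open>x\<close>; its weight is close to that of
  \<open>Q\<close> by continuity, and the integral does not decrease.\<close>

lemma open_frac_max_greater:
  fixes f :: "'a::euclidean_space \<Rightarrow> real"
  shows "open {x. t < frac_max \<gamma> f x}"
proof (subst open_subopen, clarify)
  fix x assume "t < frac_max \<gamma> f x"
  then obtain Q where Q: "cube Q" "x \<in> Q" "t < frac_avg \<gamma> f Q"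
    unfolding frac_max_eq less_SUP_iff by blast
  obtain a l where l: "0 < l" "Q = cbox a (a + l *\<^sub>R One)" by (rule cubeE[OF Q(1)])
  define P where "P e = cbox (a - e *\<^sub>R One) ((a - e *\<^sub>R One) + (l + 2 * e) *\<^sub>R One)" for e :: real
  define I where "I = (\<integral>\<^sup>+ y \<in> Q. ennreal \<bar>f y\<bar> \<partial>lebesgue)"
  have PQ: "Q \<subseteq> P e" if "0 \<le> e" for e
  proof
    fix y assume "y \<in> Q"
    then have *: "\<forall>i\<in>Basis. a \<bullet> i \<le> y \<bullet> i \<and> y \<bullet> i \<le> a \<bullet> i + l" unfolding l(2) mem_cube_cbox .
    have "(a - e *\<^sub>R One) \<bullet> i = a \<bullet> i - e" if "i \<in> Basis" for i using that by (simp add: inner_simps)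
    then show "y \<in> P e" unfolding P_def mem_cube_cbox using * \<open>0 \<le> e\<close> by fastforce
  qed
  have cP: "cube (P e)" if "0 \<le> e" for e unfolding P_def using that l by (intro cubeI) auto
  have "((\<lambda>e. ennreal (measure lebesgue (P e) powr (\<gamma> / real DIM('a) - 1)) * I) \<longlongrightarrow> frac_avg \<gamma> f Q) (at_right 0)"
  proof -
    have m: "measure lebesgue (P e) = (l + 2 * e) ^ DIM('a)" if "0 \<le> e" for e
      unfolding P_def using that l by (intro measure_cube_cbox) auto
    have "((\<lambda>e. ((l + 2 * e) ^ DIM('a)) powr (\<gamma> / real DIM('a) - 1)) \<longlongrightarrow> ((l + 2 * 0) ^ DIM('a)) powr (\<gamma> / real DIM('a) - 1)) (at_right 0)"
      using l by (intro tendsto_intros) auto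
    then have T: "((\<lambda>e. measure lebesgue (P e) powr (\<gamma> / real DIM('a) - 1)) \<longlongrightarrow> measure lebesgue Q powr (\<gamma> / real DIM('a) - 1)) (at_right 0)"
      using l by (subst Lim_cong_within[OF refl refl refl, where g="\<lambda>e. ((l + 2 * e) ^ DIM('a)) powr (\<gamma> / real DIM('a) - 1)"])
        (auto simp: m measure_cube_cbox simp del: measure_completion)
    \<comment> \<open>\<open>I\<close> may be infinite, and multiplication in ennreal is not
      continuous at 0 * infinity; a positive finite weight excludes that case.\<close>
    have "0 < measure lebesgue Q powr (\<gamma> / real DIM('a) - 1)" using measure_cube_pos[OF Q(1)] by simp
    then have *: "0 < ennreal (measure lebesgue Q powr (\<gamma> / real DIM('a) - 1))" by (simp add: ennreal_less_zero_iff)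
    show ?thesis unfolding frac_avg_def I_def[symmetric]
    proof (rule tendsto_mult_ennreal)
      show "((\<lambda>e. ennreal (measure lebesgue (P e) powr (\<gamma> / real DIM('a) - 1))) \<longlongrightarrow>
        ennreal (measure lebesgue Q powr (\<gamma> / real DIM('a) - 1))) (at_right 0)"
        using T by (rule tendsto_ennrealI)
      show "\<not> (ennreal (measure lebesgue Q powr (\<gamma> / real DIM('a) - 1)) = 0 \<and> I = \<infinity> \<or>
        ennreal (measure lebesgue Q powr (\<gamma> / real DIM('a) - 1)) = \<infinity> \<and> I = 0)"
        using * unfolding infinity_ennreal_def by (metis ennreal_neq_top less_irrefl)
    qed (rule tendsto_const)
  qed
  from eventually_happens'[OF trivial_limit_at_right_real[of 0] eventually_conj[OF order_tendstoD(1)[OF this Q(3)] eventually_at_right_less]]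
  obtain e where e: "t < ennreal (measure lebesgue (P e) powr (\<gamma> / real DIM('a) - 1)) * I" "0 < e"
    by blast
  have "ennreal \<bar>f y\<bar> * indicator Q y \<le> ennreal \<bar>f y\<bar> * indicator (P e) y" for y
    using PQ[of e] e by (cases "y \<in> Q") auto
  then have "I \<le> (\<integral>\<^sup>+ y \<in> P e. ennreal \<bar>f y\<bar> \<partial>lebesgue)"
    unfolding I_def by (rule nn_integral_mono)
  then have "ennreal (measure lebesgue (P e) powr (\<gamma> / real DIM('a) - 1)) * I \<le> frac_avg \<gamma> f (P e)"
    unfolding frac_avg_def by (rule mult_left_mono) simp
  with e(1) have tP: "t < frac_avg \<gamma> f (P e)" by simp
  show "\<exists>T. open T \<and> x \<in> T \<and> T \<subseteq> {x. t < frac_max \<gamma> f x}"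
  proof (intro exI conjI)
    let ?T = "box (a - e *\<^sub>R One) ((a - e *\<^sub>R One) + (l + 2 * e) *\<^sub>R One)"
    show "open ?T" by (rule open_box)
    show "x \<in> ?T" unfolding mem_box
    proof
      fix i :: 'a assume i: "i \<in> Basis"
      then have "a \<bullet> i \<le> x \<bullet> i \<and> x \<bullet> i \<le> a \<bullet> i + l" using Q(2) unfolding l(2) mem_cube_cbox by blast
      then show "(a - e *\<^sub>R One) \<bullet> i < x \<bullet> i \<and> x \<bullet> i < (a - e *\<^sub>R One + (l + 2 * e) *\<^sub>R One) \<bullet> i"
        using e(2) i by (simp add: inner_simps)
    qed
    show "?T \<subseteq> {x. t < frac_max \<gamma> f x}"
    proof clarify
      fix y assume "y \<in> ?T"
      then have "y \<in> P e" unfolding P_def using box_subset_cbox by blast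
      with cP[of e] e have "frac_avg \<gamma> f (P e) \<le> frac_max \<gamma> f y" by (intro frac_avg_le_frac_max) auto
      with tP show "t < frac_max \<gamma> f y" by order
    qed
  qed
qed

lemma frac_max_borel[measurable]: "frac_max \<gamma> f \<in> borel_measurable borel"
  by (rule borel_measurableI_greater) (simp add: open_frac_max_greater)

lemma frac_max_lebesgue[measurable]: "frac_max \<gamma> f \<in> borel_measurable lebesgue"
  by (simp add: frac_max_borel measurable_completion)

subsection \<open>The Hardy-Littlewood maximal theorem\<close>

text \<open>Subadditivity for covers indexed by a countable set rather than by the naturals: below
  the index set is a set of centres or the family of cubes itself. The form matches
  \<open>emeasure_UN_countable\<close> for disjoint families.\<close>

lemma emeasure_UN_countable_le:
  assumes [measurable]: "\<And>i. i \<in> I \<Longrightarrow> X i \<in> sets M" and I: "countable I"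
  shows "emeasure M (\<Union>(X ` I)) \<le> (\<integral>\<^sup>+i. emeasure M (X i) \<partial>count_space I)"
proof -
  have U[measurable]: "\<Union>(X ` I) \<in> sets M" using I by (intro sets.countable_UN') auto
  have "emeasure M (\<Union>(X ` I)) = (\<integral>\<^sup>+x. indicator (\<Union>(X ` I)) x \<partial>M)"
    by (rule nn_integral_indicator[symmetric]) fact
  also have "\<dots> \<le> (\<integral>\<^sup>+x. \<integral>\<^sup>+i. indicator (X i) x \<partial>count_space I \<partial>M)"
  proof (rule nn_integral_mono)
    fix x
    show "indicator (\<Union>(X ` I)) x \<le> (\<integral>\<^sup>+i. indicator (X i) x \<partial>count_space I)"
    proof (cases "x \<in> \<Union>(X ` I)")
      case True
      then obtain j where j: "j \<in> I" "x \<in> X j" by blast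
      have "(1::ennreal) = (\<integral>\<^sup>+i. indicator {j} i \<partial>count_space I)" using j by simp
      also have "\<dots> \<le> (\<integral>\<^sup>+i. indicator (X i) x \<partial>count_space I)"
        using j by (intro nn_integral_mono) (auto simp: indicator_def)
      finally show ?thesis using True by simp
    qed simp
  qed
  also have "\<dots> = (\<integral>\<^sup>+i. \<integral>\<^sup>+x. indicator (X i) x \<partial>M \<partial>count_space I)"
    by (rule nn_integral_count_space_nn_integral[OF I]) measurable
  also have "\<dots> = (\<integral>\<^sup>+i. emeasure M (X i) \<partial>count_space I)"
    by (intro nn_integral_cong) simp
  finally show ?thesis .
qed

lemma nn_integral_cube_ge_of_frac_avg_ge:
  fixes Q :: "'a::euclidean_space set"
  assumes "cube Q" "0 < t"
    and "ennreal t \<le> frac_avg 0 f Q"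
  shows "ennreal (t * measure lebesgue Q) \<le> (\<integral>\<^sup>+ y \<in> Q. ennreal \<bar>f y\<bar> \<partial>lebesgue)"
proof -
  let ?v = "measure lebesgue Q"
  have v: "0 < ?v" using assms(1) by (rule measure_cube_pos)
  have "ennreal (t * ?v) = ennreal ?v * ennreal t" using v assms by (simp add: ennreal_mult mult.commute)
  also have "\<dots> \<le> ennreal ?v * (ennreal (?v powr (0 / real DIM('a) - 1)) * (\<integral>\<^sup>+ y \<in> Q. ennreal \<bar>f y\<bar> \<partial>lebesgue))"
    using assms(3) unfolding frac_avg_def by (rule mult_left_mono) simp
  also have "\<dots> = (\<integral>\<^sup>+ y \<in> Q. ennreal \<bar>f y\<bar> \<partial>lebesgue)"
    using v by (simp add: powr_minus mult.assoc[symmetric] ennreal_mult[symmetric])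
  finally show ?thesis .
qed

text \<open>A point of the level set lies in a cube of side \<open>l\<close> over which |f| has
  integral at least t * l^n. The ball of radius n * l about the point contains that cube. Vitali's
  lemma selects disjoint balls whose fivefold enlargements cover the level set, and the integrals
  over disjoint balls add up to at most the integral of |f|.\<close>

lemma frac_max_weak_type:
  "\<exists>A>0. \<forall>f\<in>borel_measurable lebesgue. \<forall>t>0.
     emeasure lebesgue {x::'a::euclidean_space. ennreal t < frac_max 0 f x} \<le> ennreal (A / t) * (\<integral>\<^sup>+x. ennreal \<bar>f x\<bar> \<partial>lebesgue)"
proof -
  define n where "n = real DIM('a)"
  have n: "1 \<le> n" unfolding n_def using DIM_positive[where 'a='a] by linarith
  \<comment> \<open>The volume of a ball of radius 5 * n: a cube of side 1 lies in the ball of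
    radius n about each of its points, and Vitali's lemma costs a factor 5.\<close>
  define A where "A = unit_ball_vol n * (5 * n) ^ DIM('a)"
  have A: "0 < A" unfolding A_def using n by simp
  show ?thesis
  proof (intro exI conjI ballI allI impI)
    show "0 < A" by fact
  next
    fix f :: "'a \<Rightarrow> real" and t :: real
    assume f[measurable]: "f \<in> borel_measurable lebesgue" and t: "0 < t"
    define F where "F = (\<integral>\<^sup>+x. ennreal \<bar>f x\<bar> \<partial>lebesgue)"
    let ?E = "{x. ennreal t < frac_max 0 f x}"
    show "emeasure lebesgue ?E \<le> ennreal (A / t) * (\<integral>\<^sup>+x. ennreal \<bar>f x\<bar> \<partial>lebesgue)"
    proof (cases "F = \<infinity>")
      case True
      then show ?thesis using A t unfolding F_def[symmetric] by (simp add: ennreal_mult_top)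
    next
      case False
      then obtain F' where F': "F = ennreal F'" "0 \<le> F'" by (cases F) auto
      have "\<forall>x\<in>?E. \<exists>l>0. ennreal (t * l ^ DIM('a)) \<le> (\<integral>\<^sup>+ y \<in> cball x (n * l). ennreal \<bar>f y\<bar> \<partial>lebesgue)"
      proof
        fix x assume "x \<in> ?E"
        then obtain Q where Q: "cube Q" "x \<in> Q" "ennreal t < frac_avg 0 f Q"
          unfolding frac_max_eq less_SUP_iff mem_Collect_eq by blast
        obtain a l where l: "0 < l" "Q = cbox a (a + l *\<^sub>R One)" by (rule cubeE[OF Q(1)])
        have "Q \<subseteq> cball x (n * l)"
          using cube_diameter[of x a l] Q(2) unfolding l(2) n_def by (auto simp: dist_norm)
        then have *: "ennreal \<bar>f y\<bar> * indicator Q y \<le> ennreal \<bar>f y\<bar> * indicator (cball x (n * l)) y" for y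
          by (cases "y \<in> Q") (auto simp del: mem_cball)
        have "ennreal (t * l ^ DIM('a)) \<le> (\<integral>\<^sup>+ y \<in> Q. ennreal \<bar>f y\<bar> \<partial>lebesgue)"
          using nn_integral_cube_ge_of_frac_avg_ge[OF Q(1) t less_imp_le[OF Q(3)]] l
          by (simp add: measure_cube_cbox del: measure_completion)
        also have "\<dots> \<le> (\<integral>\<^sup>+ y \<in> cball x (n * l). ennreal \<bar>f y\<bar> \<partial>lebesgue)"
          using * by (rule nn_integral_mono)
        finally show "\<exists>l>0. ennreal (t * l ^ DIM('a)) \<le> (\<integral>\<^sup>+ y \<in> cball x (n * l). ennreal \<bar>f y\<bar> \<partial>lebesgue)"
          using l(1) by blast
      qed
      then obtain l where l: "\<And>x. x \<in> ?E \<Longrightarrow> 0 < l x"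
        "\<And>x. x \<in> ?E \<Longrightarrow> ennreal (t * l x ^ DIM('a)) \<le> (\<integral>\<^sup>+ y \<in> cball x (n * l x). ennreal \<bar>f y\<bar> \<partial>lebesgue)"
        by metis
      \<comment> \<open>Vitali's lemma asks for bounded radii. If l > 1 then l is at most l^n, which
        is at most F' / t.\<close>
      have bd: "l x \<le> max 1 (F' / t)" if x: "x \<in> ?E" for x
      proof (cases "l x \<le> 1")
        case False
        have "(\<integral>\<^sup>+ y \<in> cball x (n * l x). ennreal \<bar>f y\<bar> \<partial>lebesgue) \<le> F"
          unfolding F_def by (intro nn_integral_mono) (auto simp: indicator_def)
        with l(2)[OF x] have "ennreal (t * l x ^ DIM('a)) \<le> ennreal F'" unfolding F' by order
        then have "t * l x ^ DIM('a) \<le> F'" using F' by (simp add: ennreal_le_iff)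
        moreover have "l x ^ 1 \<le> l x ^ DIM('a)"
          using False by (intro power_increasing) (auto simp: Suc_le_eq)
        ultimately have "t * l x \<le> F'" using t by (smt (verit) mult_left_mono power_one_right)
        then show ?thesis using t by (simp add: field_simps le_max_iff_disj)
      qed simp
      obtain C where C: "countable C" "C \<subseteq> ?E"
        "pairwise (\<lambda>i j. disjnt (cball i (n * l i)) (cball j (n * l j))) C"
        "?E \<subseteq> (\<Union>i\<in>C. cball i (5 * (n * l i)))"
      proof (rule Vitali_covering_lemma_cballs[where K="?E" and a="\<lambda>x. x" and r="\<lambda>x. n * l x" and S="?E" and B="n * max 1 (F' / t)"])
        show "?E \<subseteq> (\<Union>i\<in>?E. cball i (n * l i))"
        proof
          fix x assume x: "x \<in> ?E"
          then have "0 \<le> n * l x" using l(1)[OF x] n by simp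
          then have "x \<in> cball x (n * l x)" by simp
          with x show "x \<in> (\<Union>i\<in>?E. cball i (n * l i))" by (rule UN_I)
        qed
        show "0 < n * l i \<and> n * l i \<le> n * max 1 (F' / t)" if "i \<in> ?E" for i
          using l(1)[OF that] mult_left_mono[OF bd[OF that], of n] n by simp
      qed auto
      \<comment> \<open>As a measure, |f| is additive over the disjoint balls.\<close>
      define N where "N = density lebesgue (\<lambda>y. ennreal \<bar>f y\<bar>)"
      have N: "emeasure N S = (\<integral>\<^sup>+ y \<in> S. ennreal \<bar>f y\<bar> \<partial>lebesgue)" if "S \<in> sets lebesgue" for S
        unfolding N_def by (rule emeasure_density) (use that in measurable)
      have "emeasure lebesgue ?E \<le> emeasure lebesgue (\<Union>i\<in>C. cball i (5 * (n * l i)))"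
        using C by (intro emeasure_mono sets.countable_UN') auto
      also have "\<dots> \<le> (\<integral>\<^sup>+i. emeasure lebesgue (cball i (5 * (n * l i))) \<partial>count_space C)"
        using C(1) by (intro emeasure_UN_countable_le) auto
      also have "\<dots> \<le> (\<integral>\<^sup>+i. ennreal (A / t) * emeasure N (cball i (n * l i)) \<partial>count_space C)"
      proof (rule nn_integral_mono)
        fix i assume "i \<in> space (count_space C)"
        then have i: "i \<in> ?E" using C(2) by auto
        have li: "0 < l i" using l(1)[OF i] .
        have "emeasure lebesgue (cball i (5 * (n * l i))) = ennreal (unit_ball_vol n * (5 * (n * l i)) ^ DIM('a))"
          using li n by (simp add: emeasure_cball n_def)
        also have "unit_ball_vol n * (5 * (n * l i)) ^ DIM('a) = A / t * (t * l i ^ DIM('a))"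
          using t unfolding A_def by (simp add: power_mult_distrib)
        also have "ennreal \<dots> = ennreal (A / t) * ennreal (t * l i ^ DIM('a))"
          using A t li by (intro ennreal_mult) auto
        also have "\<dots> \<le> ennreal (A / t) * emeasure N (cball i (n * l i))"
          using l(2)[OF i] by (intro mult_left_mono) (auto simp: N)
        finally show "emeasure lebesgue (cball i (5 * (n * l i))) \<le> ennreal (A / t) * emeasure N (cball i (n * l i))" .
      qed
      also have "\<dots> = ennreal (A / t) * (\<integral>\<^sup>+i. emeasure N (cball i (n * l i)) \<partial>count_space C)"
        by (rule nn_integral_cmult) simp
      also have "(\<integral>\<^sup>+i. emeasure N (cball i (n * l i)) \<partial>count_space C) = emeasure N (\<Union>i\<in>C. cball i (n * l i))"
        using C(1,3) by (intro emeasure_UN_countable[symmetric])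
          (auto simp: N_def disjoint_family_on_def pairwise_def disjnt_def)
      also have "\<dots> \<le> emeasure N (space N)"
        by (rule emeasure_space)
      also have "\<dots> = F"
        unfolding F_def by (subst N) (auto simp: N_def)
      finally show ?thesis unfolding F_def by (simp add: mult_left_mono)
    qed
  qed
qed

text \<open>One half of the layer-cake formula. For finite \<open>u\<close> it is approached from
  below, because c < u puts all of [0, c] under the strict inequality, up to the point 0, where the
  integrand vanishes; u = infinity is reached along the naturals.\<close>

lemma ennreal_power2_le_nn_integral:
  fixes u :: ennreal
  shows "u\<^sup>2 \<le> (\<integral>\<^sup>+t. ennreal (2 * t) * indicator {t. 0 < t \<and> ennreal t < u} t \<partial>lborel)"
proof -
  let ?R = "(\<integral>\<^sup>+t. ennreal (2 * t) * indicator {t. 0 < t \<and> ennreal t < u} t \<partial>lborel)"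
  have *: "ennreal (c\<^sup>2) \<le> ?R" if c: "0 \<le> c" "ennreal c < u" for c
  proof -
    have "(\<integral>\<^sup>+t. ennreal (2 * t) * indicator {0 .. c} t \<partial>lborel) = ennreal (c\<^sup>2 - 0\<^sup>2)"
      using c by (intro nn_integral_FTC_Icc) (auto intro!: derivative_eq_intros)
    moreover have "(\<integral>\<^sup>+t. ennreal (2 * t) * indicator {0 .. c} t \<partial>lborel) \<le> ?R"
    proof (rule nn_integral_mono)
      fix t
      show "ennreal (2 * t) * indicator {0 .. c} t \<le> ennreal (2 * t) * indicator {t. 0 < t \<and> ennreal t < u} t"
      proof (cases "t \<in> {0..c} \<and> t \<noteq> 0")
        case True
        then have "ennreal t \<le> ennreal c" by (auto intro: ennreal_leI)
        with c(2) have "ennreal t < u" by order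
        with True show ?thesis by auto
      qed (auto simp: indicator_def)
    qed
    ultimately show ?thesis by simp
  qed
  show ?thesis
  proof (cases u)
    case (real r)
    show ?thesis
    proof (cases "r = 0")
      case False
      have "((\<lambda>c. ennreal (c\<^sup>2)) \<longlongrightarrow> ennreal (r\<^sup>2)) (at_left r)"
        by (intro tendsto_intros)
      moreover have "\<forall>\<^sub>F c in at_left r. ennreal (c\<^sup>2) \<le> ?R"
        unfolding eventually_at_left_field
      proof (intro exI conjI allI impI)
        show "0 < r" using False real by simp
        fix c assume "0 < c" "c < r"
        then show "ennreal (c\<^sup>2) \<le> ?R" by (intro *) (auto simp: real ennreal_less_iff)
      qed
      ultimately have "ennreal (r\<^sup>2) \<le> ?R"
        by (rule tendsto_upperbound) simp
      then show ?thesis using real by (simp add: ennreal_power)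
    qed (use real in simp)
  next
    case top
    have "ennreal (real k) \<le> ?R" for k
    proof -
      have "ennreal (real k) \<le> ennreal ((real k)\<^sup>2)"
        by (intro ennreal_leI) (metis of_nat_le_iff of_nat_power power2_nat_le_imp_le le_refl power2_nat_le_eq_le self_le_power order.trans le_square power2_eq_square)
      also have "\<dots> \<le> ?R" by (intro *) (auto simp: top)
      finally show ?thesis .
    qed
    then have "?R = top"
      by (metis ennreal_Ex_less_of_nat ennreal_of_nat_eq_real_of_nat leD top.not_eq_extremum)
    then show ?thesis by simp
  qed
qed

text \<open>Marcinkiewicz interpolation between weak type (1,1) and the trivial bound for bounded
  functions. The weak type bound at height t/2 gives 2 * A / t, the weight 2 * t makes this 4 * A,
  and integrating over 0 < t < 2 * |f| gives another factor 2.\<close>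

lemma frac_max_strong_type_2:
  "\<exists>A>0. \<forall>f\<in>borel_measurable (lebesgue :: 'a::euclidean_space measure).
     (\<integral>\<^sup>+x. (frac_max 0 f x)\<^sup>2 \<partial>lebesgue) \<le> ennreal A * (\<integral>\<^sup>+x. ennreal ((f x)\<^sup>2) \<partial>lebesgue)"
proof -
  obtain A where A: "0 < A" and weak: "\<And>f t. f\<in>borel_measurable lebesgue \<Longrightarrow> 0 < t \<Longrightarrow>
     emeasure lebesgue {x::'a. ennreal t < frac_max 0 f x} \<le> ennreal (A / t) * (\<integral>\<^sup>+x. ennreal \<bar>f x\<bar> \<partial>lebesgue)"
    using frac_max_weak_type[where 'a='a] by blast
  \<comment> \<open>Tonelli's theorem is applied on lborel to a Borel function. A general
    \<open>f\<close> is then exchanged for a Borel representative, which changes neither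
    side.\<close>
  have main: "(\<integral>\<^sup>+x. (frac_max 0 f x)\<^sup>2 \<partial>lborel) \<le> ennreal (8 * A) * (\<integral>\<^sup>+x. ennreal ((f x)\<^sup>2) \<partial>lborel)"
    if f[measurable]: "f \<in> borel_measurable borel" for f :: "'a \<Rightarrow> real"
  proof -
    have level: "emeasure lborel {x. ennreal t < frac_max 0 f x} \<le>
        ennreal (2 * A / t) * (\<integral>\<^sup>+x. ennreal \<bar>f x\<bar> * indicator {x. t < 2 * \<bar>f x\<bar>} x \<partial>lborel)" if t: "0 < t" for t
    proof -
      \<comment> \<open>The part of \<open>f\<close> above height t/2. What is cut off adds at most
        t/2 to any average, so M f > t forces M g > t/2.\<close>
      define g where "g x = f x * indicator {x. t < 2 * \<bar>f x\<bar>} x" for x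
      have g[measurable]: "g \<in> borel_measurable borel" unfolding g_def by measurable
      have le: "\<bar>f x\<bar> \<le> \<bar>g x\<bar> + t / 2" for x unfolding g_def using t by (auto simp: indicator_def)
      have "{x. ennreal t < frac_max 0 f x} \<subseteq> {x. ennreal (t / 2) < frac_max 0 g x}"
      proof clarify
        fix x assume "ennreal t < frac_max 0 f x"
        then obtain Q where Q: "cube Q" "x \<in> Q" "ennreal t < frac_avg 0 f Q"
          unfolding frac_max_eq less_SUP_iff by blast
        let ?v = "measure lebesgue Q"
        have v: "0 < ?v" using Q(1) by (rule measure_cube_pos)
        have gl: "g \<in> borel_measurable lebesgue" using g by (simp add: measurable_completion)
        note [measurable] = cube_sets[OF Q(1)] gl
        have "(\<integral>\<^sup>+ y \<in> Q. ennreal \<bar>f y\<bar> \<partial>lebesgue) \<le> (\<integral>\<^sup>+ y. ennreal \<bar>g y\<bar> * indicator Q y + ennreal (t / 2) * indicator Q y \<partial>lebesgue)"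
        proof (rule nn_integral_mono)
          fix y
          have "ennreal \<bar>f y\<bar> \<le> ennreal \<bar>g y\<bar> + ennreal (t / 2)"
            using ennreal_leI[OF le[of y]] t by (simp add: ennreal_plus)
          then show "ennreal \<bar>f y\<bar> * indicator Q y \<le> ennreal \<bar>g y\<bar> * indicator Q y + ennreal (t / 2) * indicator Q y"
            by (cases "y \<in> Q") auto
        qed
        also have "\<dots> = (\<integral>\<^sup>+ y \<in> Q. ennreal \<bar>g y\<bar> \<partial>lebesgue) + (\<integral>\<^sup>+ y. ennreal (t / 2) * indicator Q y \<partial>lebesgue)"
          by (rule nn_integral_add) measurable
        also have "(\<integral>\<^sup>+ y. ennreal (t / 2) * indicator Q y \<partial>lebesgue) = ennreal (t / 2) * ennreal ?v"
          by (subst nn_integral_cmult_indicator) (auto simp: emeasure_cube_eq[OF Q(1)])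
        finally have "frac_avg 0 f Q \<le> ennreal (?v powr (0 / real DIM('a) - 1)) * ((\<integral>\<^sup>+ y \<in> Q. ennreal \<bar>g y\<bar> \<partial>lebesgue) + ennreal (t / 2) * ennreal ?v)"
          unfolding frac_avg_def by (rule mult_left_mono) simp
        also have "\<dots> = frac_avg 0 g Q + ennreal (t / 2)"
          using v t unfolding frac_avg_def by (simp add: distrib_left powr_minus ennreal_mult[symmetric])
        also have "\<dots> \<le> frac_max 0 g x + ennreal (t / 2)"
          using Q by (intro add_right_mono frac_avg_le_frac_max)
        finally have "ennreal (t / 2) + ennreal (t / 2) < frac_max 0 g x + ennreal (t / 2)"
          using Q(3) t by (simp add: ennreal_plus[symmetric] del: ennreal_plus)
        then show "ennreal (t / 2) < frac_max 0 g x"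
          by (meson add_right_mono not_le)
      qed
      then have "emeasure lborel {x. ennreal t < frac_max 0 f x} \<le> emeasure lborel {x. ennreal (t / 2) < frac_max 0 g x}"
        by (rule emeasure_mono) (simp add: open_frac_max_greater borel_open)
      also have "\<dots> = emeasure lebesgue {x. ennreal (t / 2) < frac_max 0 g x}"
        by (simp add: open_frac_max_greater borel_open)
      also have "\<dots> \<le> ennreal (A / (t / 2)) * (\<integral>\<^sup>+x. ennreal \<bar>g x\<bar> \<partial>lebesgue)"
        using t g by (intro weak) (auto simp: measurable_completion)
      also have "(\<integral>\<^sup>+x. ennreal \<bar>g x\<bar> \<partial>lebesgue) = (\<integral>\<^sup>+x. ennreal \<bar>f x\<bar> * indicator {x. t < 2 * \<bar>f x\<bar>} x \<partial>lborel)"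
        unfolding nn_integral_completion by (intro nn_integral_cong) (auto simp: g_def indicator_def)
      finally show ?thesis by (simp add: mult.commute)
    qed
    have "(\<integral>\<^sup>+x. (frac_max 0 f x)\<^sup>2 \<partial>lborel) \<le>
      (\<integral>\<^sup>+x. (\<integral>\<^sup>+t. ennreal (2 * t) * indicator {t. 0 < t \<and> ennreal t < frac_max 0 f x} t \<partial>lborel) \<partial>lborel)"
      by (intro nn_integral_mono ennreal_power2_le_nn_integral)
    also have "\<dots> = (\<integral>\<^sup>+x. (\<integral>\<^sup>+t. ennreal (2 * t) * indicator {(t, x). 0 < t \<and> ennreal t < frac_max 0 f x} (t, x) \<partial>lborel) \<partial>lborel)"
      by (simp add: indicator_def)
    also have "\<dots> = (\<integral>\<^sup>+t. (\<integral>\<^sup>+x. ennreal (2 * t) * indicator {(t, x). 0 < t \<and> ennreal t < frac_max 0 f x} (t, x) \<partial>lborel) \<partial>lborel)"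
      by (rule lborel_pair.Fubini') measurable
    also have "\<dots> \<le> (\<integral>\<^sup>+t. ennreal (4 * A) * (\<integral>\<^sup>+x. ennreal \<bar>f x\<bar> * indicator {(t, x). 0 < t \<and> t < 2 * \<bar>f x\<bar>} (t, x) \<partial>lborel) \<partial>lborel)"
    proof (rule nn_integral_mono)
      fix t :: real
      show "(\<integral>\<^sup>+x. ennreal (2 * t) * indicator {(t, x). 0 < t \<and> ennreal t < frac_max 0 f x} (t, x) \<partial>lborel) \<le>
        ennreal (4 * A) * (\<integral>\<^sup>+x. ennreal \<bar>f x\<bar> * indicator {(t, x). 0 < t \<and> t < 2 * \<bar>f x\<bar>} (t, x) \<partial>lborel)"
      proof (cases "0 < t")
        case True
        have "(\<integral>\<^sup>+x. ennreal (2 * t) * indicator {(t, x). 0 < t \<and> ennreal t < frac_max 0 f x} (t, x) \<partial>lborel)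
          = (\<integral>\<^sup>+x. ennreal (2 * t) * indicator {x. ennreal t < frac_max 0 f x} x \<partial>lborel)"
          using True by (simp add: indicator_def)
        also have "\<dots> = ennreal (2 * t) * emeasure lborel {x. ennreal t < frac_max 0 f x}"
          by (subst nn_integral_cmult_indicator) (auto simp: open_frac_max_greater borel_open)
        also have "\<dots> \<le> ennreal (2 * t) * (ennreal (2 * A / t) * (\<integral>\<^sup>+x. ennreal \<bar>f x\<bar> * indicator {x. t < 2 * \<bar>f x\<bar>} x \<partial>lborel))"
          by (rule mult_left_mono[OF level[OF True]]) simp
        also have "\<dots> = ennreal (4 * A) * (\<integral>\<^sup>+x. ennreal \<bar>f x\<bar> * indicator {x. t < 2 * \<bar>f x\<bar>} x \<partial>lborel)"
          using True A by (simp add: mult.assoc[symmetric] ennreal_mult[symmetric])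
        also have "\<dots> = ennreal (4 * A) * (\<integral>\<^sup>+x. ennreal \<bar>f x\<bar> * indicator {(t, x). 0 < t \<and> t < 2 * \<bar>f x\<bar>} (t, x) \<partial>lborel)"
          using True by (simp add: indicator_def)
        finally show ?thesis .
      qed (simp add: indicator_def)
    qed
    also have "\<dots> = ennreal (4 * A) * (\<integral>\<^sup>+t. (\<integral>\<^sup>+x. ennreal \<bar>f x\<bar> * indicator {(t, x). 0 < t \<and> t < 2 * \<bar>f x\<bar>} (t, x) \<partial>lborel) \<partial>lborel)"
      by (rule nn_integral_cmult) measurable
    also have "(\<integral>\<^sup>+t. (\<integral>\<^sup>+x. ennreal \<bar>f x\<bar> * indicator {(t, x). 0 < t \<and> t < 2 * \<bar>f x\<bar>} (t, x) \<partial>lborel) \<partial>lborel)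
      = (\<integral>\<^sup>+x. (\<integral>\<^sup>+t. ennreal \<bar>f x\<bar> * indicator {(t, x). 0 < t \<and> t < 2 * \<bar>f x\<bar>} (t, x) \<partial>lborel) \<partial>lborel)"
      by (rule lborel_pair.Fubini'[symmetric]) measurable
    also have "\<dots> = (\<integral>\<^sup>+x. ennreal 2 * ennreal ((f x)\<^sup>2) \<partial>lborel)"
    proof (rule nn_integral_cong)
      fix x
      have "(\<integral>\<^sup>+t. ennreal \<bar>f x\<bar> * indicator {(t, x). 0 < t \<and> t < 2 * \<bar>f x\<bar>} (t, x) \<partial>lborel)
        = (\<integral>\<^sup>+t. ennreal \<bar>f x\<bar> * indicator {0<..<2 * \<bar>f x\<bar>} t \<partial>lborel)"
        by (intro nn_integral_cong) (auto simp: indicator_def)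
      also have "\<dots> = ennreal \<bar>f x\<bar> * ennreal (2 * \<bar>f x\<bar>)"
        by (subst nn_integral_cmult_indicator) auto
      also have "\<dots> = ennreal 2 * ennreal ((f x)\<^sup>2)"
        by (simp add: ennreal_mult[symmetric] power2_eq_square del: ennreal_numeral)
      finally show "(\<integral>\<^sup>+t. ennreal \<bar>f x\<bar> * indicator {(t, x). 0 < t \<and> t < 2 * \<bar>f x\<bar>} (t, x) \<partial>lborel) = ennreal 2 * ennreal ((f x)\<^sup>2)" .
    qed
    also have "\<dots> = ennreal 2 * (\<integral>\<^sup>+x. ennreal ((f x)\<^sup>2) \<partial>lborel)"
      by (rule nn_integral_cmult) measurable
    also have "ennreal (4 * A) * \<dots> = ennreal (8 * A) * (\<integral>\<^sup>+x. ennreal ((f x)\<^sup>2) \<partial>lborel)"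
      using A by (simp add: mult.assoc[symmetric] ennreal_mult[symmetric] del: ennreal_numeral)
    finally show ?thesis .
  qed
  show ?thesis
  proof (intro exI conjI ballI)
    show "0 < 8 * A" using A by simp
    fix f :: "'a \<Rightarrow> real" assume "f \<in> borel_measurable lebesgue"
    then obtain g where g: "g \<in> borel_measurable lborel" "AE x in lborel. f x = g x"
      using completion_ex_borel_measurable_real by blast
    then have ae: "AE x in lebesgue. f x = g x" by (simp add: AE_completion)
    have "frac_max 0 f = frac_max 0 g" using ae by (intro ext frac_max_cong_AE) (auto elim!: eventually_mono)
    moreover have "(\<integral>\<^sup>+x. ennreal ((f x)\<^sup>2) \<partial>lebesgue) = (\<integral>\<^sup>+x. ennreal ((g x)\<^sup>2) \<partial>lebesgue)"
      using ae by (intro nn_integral_cong_AE) (auto elim!: eventually_mono)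
    ultimately show "(\<integral>\<^sup>+x. (frac_max 0 f x)\<^sup>2 \<partial>lebesgue) \<le> ennreal (8 * A) * (\<integral>\<^sup>+x. ennreal ((f x)\<^sup>2) \<partial>lebesgue)"
      using main[of g] g(1) by (simp add: nn_integral_completion)
  qed
qed

subsection \<open>Variable exponent spaces\<close>

lemma modular_antimono:
  assumes "0 < a" "a \<le> b" "\<And>x. 0 \<le> p x"
  shows "modular p f b \<le> modular p f a"
  unfolding modular_def using assms
  by (intro nn_integral_mono ennreal_leI powr_mono2 divide_left_mono) auto

lemma modular_mono_AE:
  assumes "AE x in lebesgue. \<bar>f x\<bar> \<le> \<bar>g x\<bar>" "0 < l" "\<And>x. 0 \<le> p x"
  shows "modular p f l \<le> modular p g l"
  unfolding modular_def using assms
  by (intro nn_integral_mono_AE) (auto intro!: ennreal_leI powr_mono2 divide_right_mono elim!: eventually_mono)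

lemma modular_cmult:
  assumes "0 < c" "0 < l"
  shows "modular p (\<lambda>x. c * f x) (c * l) = modular p f l"
  unfolding modular_def using assms by (simp add: abs_mult)

lemma Lvar_norm_leI: "0 < l \<Longrightarrow> modular p f l \<le> 1 \<Longrightarrow> Lvar_norm p f \<le> ennreal l"
  unfolding Lvar_norm_def by (rule Inf_lower) blast

lemma Lvar_norm_geI:
  "(\<And>l. 0 < l \<Longrightarrow> modular p f l \<le> 1 \<Longrightarrow> c \<le> ennreal l) \<Longrightarrow> c \<le> Lvar_norm p f"
  unfolding Lvar_norm_def by (rule Inf_greatest) blast

text \<open>The inequality is strict because the infimum is not shown to be attained; constants
  below are therefore enlarged a little before a norm bound is turned into a modular bound.\<close>

lemma modular_le_1_of_Lvar_norm_less:
  assumes "Lvar_norm p f < ennreal l" "\<And>x. 0 \<le> p x"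
  shows "0 < l" "modular p f l \<le> 1"
proof -
  obtain k where k: "0 < k" "modular p f k \<le> 1" "ennreal k < ennreal l"
    using assms(1) unfolding Lvar_norm_def Inf_less_iff by blast
  then have kl: "k < l" by (simp add: ennreal_less_iff)
  with k show "0 < l" by simp
  have "modular p f l \<le> modular p f k" using k kl assms(2) by (intro modular_antimono) auto
  with k show "modular p f l \<le> 1" by simp
qed

text \<open>The route to the norm inequalities: treat one admissible scale \<open>l\<close> at a
  time and take the infimum only here.\<close>

lemma Lvar_norm_le_cmult:
  assumes "0 < C" "\<And>l. 0 < l \<Longrightarrow> modular p f l \<le> 1 \<Longrightarrow> Lvar_norm q g \<le> ennreal (C * l)"
  shows "Lvar_norm q g \<le> ennreal C * Lvar_norm p f"
proof -
  have "Lvar_norm q g / ennreal C \<le> Lvar_norm p f"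
  proof (rule Lvar_norm_geI)
    fix l :: real assume l: "0 < l" "modular p f l \<le> 1"
    show "Lvar_norm q g / ennreal C \<le> ennreal l"
      using assms(2)[OF l] assms(1) l by (intro divide_le_posI_ennreal) (auto simp: ennreal_mult)
  qed
  then have "ennreal C * (Lvar_norm q g / ennreal C) \<le> ennreal C * Lvar_norm p f"
    by (rule mult_left_mono) simp
  then show ?thesis
    using assms(1) by (simp add: ennreal_times_divide ennreal_mult_divide_eq mult.commute[of "ennreal C"])
qed

text \<open>As p is at least 1, enlarging the scale by a factor c \<ge> 1 divides the modular by at
  least c, so a finite modular can be brought below 1.\<close>

lemma LvarD_modular_le_1:
  assumes "f \<in> Lvar p" "\<And>x. 1 \<le> p x" "p \<in> borel_measurable lebesgue"
  obtains l where "0 < l" "modular p f l \<le> 1"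
proof -
  have [measurable]: "f \<in> borel_measurable lebesgue" "p \<in> borel_measurable lebesgue"
    using assms unfolding Lvar_def by auto
  obtain k where k: "0 < k" "modular p f k < \<infinity>" using assms(1) unfolding Lvar_def by blast
  then obtain m where m: "modular p f k = ennreal m" "0 \<le> m" by (cases "modular p f k") auto
  define c where "c = max 1 m"
  have c: "1 \<le> c" "m \<le> c" unfolding c_def by auto
  have "modular p f (c * k) \<le> (\<integral>\<^sup>+x. ennreal (1 / c) * ennreal ((\<bar>f x\<bar> / k) powr p x) \<partial>lebesgue)"
    unfolding modular_def
  proof (rule nn_integral_mono)
    fix x
    have "(\<bar>f x\<bar> / (c * k)) powr p x = (1 / c) powr p x * (\<bar>f x\<bar> / k) powr p x"
      using c k by (subst powr_mult[symmetric]) auto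
    also have "\<dots> \<le> (1 / c) powr 1 * (\<bar>f x\<bar> / k) powr p x"
      using c assms(2)[of x] by (intro mult_right_mono powr_mono') auto
    finally have "(\<bar>f x\<bar> / (c * k)) powr p x \<le> 1 / c * (\<bar>f x\<bar> / k) powr p x" using c by simp
    then show "ennreal ((\<bar>f x\<bar> / (c * k)) powr p x) \<le> ennreal (1 / c) * ennreal ((\<bar>f x\<bar> / k) powr p x)"
      using c by (simp add: ennreal_mult[symmetric] ennreal_leI del: times_divide_eq_left)
  qed
  also have "\<dots> = ennreal (1 / c) * modular p f k"
    unfolding modular_def by (rule nn_integral_cmult) measurable
  also have "\<dots> \<le> 1" using c m by (simp add: ennreal_mult[symmetric])
  finally have "modular p f (c * k) \<le> 1" .
  then show ?thesis using c k by (intro that[of "c * k"]) auto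
qed

section \<open>Norms of indicators of cubes\<close>

lemma modular_indicator:
  fixes Q :: "'a::euclidean_space set"
  assumes "0 < l"
  shows "modular p (indicator Q) l = (\<integral>\<^sup>+x. ennreal ((1 / l) powr p x) * indicator Q x \<partial>lebesgue)"
  unfolding modular_def by (intro nn_integral_cong) (auto simp: indicator_def)

text \<open>Crude bounds suffice: the norm lies between the minimum and the maximum of 1 and |Q|.
  With the two lemmas that follow, it becomes a positive finite number by which one may
  divide.\<close>

lemma cube_indicator_norm_pos:
  fixes Q :: "'a::euclidean_space set"
  assumes Q: "cube Q" and p: "\<And>x. 1 \<le> p x"
  shows "0 < Lvar_norm p (indicator Q)"
proof -
  note [measurable] = cube_sets[OF Q]
  let ?v = "measure lebesgue Q"
  have v: "0 < ?v" by (rule measure_cube_pos[OF Q])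
  have "ennreal (min 1 ?v) \<le> Lvar_norm p (indicator Q)"
  proof (rule Lvar_norm_geI)
    fix l :: real assume l: "0 < l" "modular p (indicator Q) l \<le> 1"
    show "ennreal (min 1 ?v) \<le> ennreal l"
    proof (cases "1 \<le> l")
      case False
      have "ennreal (?v / l) = (\<integral>\<^sup>+x. ennreal (1 / l) * indicator Q x \<partial>lebesgue)"
        using l(1) by (subst nn_integral_cmult_indicator) (auto simp: emeasure_cube_eq[OF Q] ennreal_mult[symmetric])
      also have "\<dots> \<le> modular p (indicator Q) l"
        unfolding modular_indicator[OF l(1)]
      proof (rule nn_integral_mono)
        fix x
        have "(1 / l) powr 1 \<le> (1 / l) powr p x" using False l p[of x] by (intro powr_mono) auto
        then show "ennreal (1 / l) * indicator Q x \<le> ennreal ((1 / l) powr p x) * indicator Q x"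
          using l by (intro mult_right_mono ennreal_leI) auto
      qed
      also note l(2)
      finally have "?v / l \<le> 1" by (simp only: ennreal_le_1)
      then have "?v \<le> l" using l by (simp add: field_simps)
      then show ?thesis by (intro ennreal_leI) simp
    qed (auto intro!: ennreal_leI)
  qed
  moreover have "0 < ennreal (min 1 ?v)" using v by simp
  ultimately show ?thesis by order
qed

lemma cube_indicator_modular_le_1:
  fixes Q :: "'a::euclidean_space set"
  assumes Q: "cube Q" and p: "\<And>x. 1 \<le> p x"
  shows "modular p (indicator Q) (max 1 (measure lebesgue Q)) \<le> 1"
proof -
  note [measurable] = cube_sets[OF Q]
  let ?v = "measure lebesgue Q"
  let ?l = "max 1 ?v"
  have v: "0 < ?v" by (rule measure_cube_pos[OF Q])
  have l: "0 < ?l" by simp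
  have "modular p (indicator Q) ?l \<le> (\<integral>\<^sup>+x. ennreal (1 / ?l) * indicator Q x \<partial>lebesgue)"
    unfolding modular_indicator[OF l]
  proof (rule nn_integral_mono)
    fix x
    have "(1 / ?l) powr p x \<le> (1 / ?l) powr 1" using p[of x] by (intro powr_mono') auto
    then show "ennreal ((1 / ?l) powr p x) * indicator Q x \<le> ennreal (1 / ?l) * indicator Q x"
      by (intro mult_right_mono ennreal_leI) auto
  qed
  also have "\<dots> = ennreal (?v / ?l)"
    by (subst nn_integral_cmult_indicator) (auto simp: emeasure_cube_eq[OF Q] ennreal_mult[symmetric])
  also have "\<dots> \<le> 1" by simp
  finally show ?thesis .
qed

lemma cube_indicator_norm_finite:
  fixes Q :: "'a::euclidean_space set"
  assumes Q: "cube Q" and p: "\<And>x. 1 \<le> p x"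
  shows "Lvar_norm p (indicator Q) < \<infinity>"
proof -
  have "Lvar_norm p (indicator Q) \<le> ennreal (max 1 (measure lebesgue Q))"
    using cube_indicator_modular_le_1[OF assms] by (intro Lvar_norm_leI) auto
  also have "\<dots> < \<infinity>" by simp
  finally show ?thesis .
qed

lemma cube_indicator_Lvar:
  fixes Q :: "'a::euclidean_space set"
  assumes Q: "cube Q" and p: "\<And>x. 1 \<le> p x"
  shows "indicator Q \<in> Lvar p"
proof -
  note [measurable] = cube_sets[OF Q]
  have "modular p (indicator Q) (max 1 (measure lebesgue Q)) < \<infinity>"
    using cube_indicator_modular_le_1[OF assms] by (rule order.strict_trans1) simp
  then show ?thesis unfolding Lvar_def
    by (auto intro!: exI[of _ "max 1 (measure lebesgue Q)"] simp del: less_max_iff_disj)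
qed

section \<open>The classes of exponents\<close>

lemma exps_PD:
  assumes "p \<in> exps_P"
  shows "p \<in> borel_measurable lebesgue" "\<And>x. 1 \<le> p x" "\<And>x. 0 \<le> p x"
proof -
  show "p \<in> borel_measurable lebesgue" and 1: "\<And>x. 1 \<le> p x" using assms unfolding exps_P_def by auto
  show "0 \<le> p x" for x using 1[of x] by simp
qed

lemma ess_sup_const_le: "ess_sup (\<lambda>_. c) \<le> ereal c"
  unfolding ess_sup_def by (rule Inf_lower) simp

lemma ess_inf_const_ge: "ereal c \<le> ess_inf (\<lambda>_. c)"
  unfolding ess_inf_def by (rule Sup_upper) simp

lemma exps_P_const:
  assumes "1 < c"
  shows "(\<lambda>_. c) \<in> exps_P"
proof -
  have "ereal 1 < ereal c" "ereal c < \<infinity>" using assms by auto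
  then have "ereal 1 < ess_inf (\<lambda>_::'a. c)" "ess_sup (\<lambda>_::'a. c) < \<infinity>"
    using ess_inf_const_ge[of c, where 'a='a] ess_sup_const_le[of c, where 'a='a] by order+
  then show ?thesis unfolding exps_P_def using assms by (simp add: one_ereal_def)
qed

lemma exps_B_const_2: "(\<lambda>_::'a::euclidean_space. 2) \<in> exps_B"
proof -
  let ?p = "\<lambda>_::'a. 2 :: real"
  obtain A where A: "0 < A" and strong: "\<And>f. f \<in> borel_measurable (lebesgue :: 'a measure) \<Longrightarrow>
     (\<integral>\<^sup>+x. (frac_max 0 f x)\<^sup>2 \<partial>lebesgue) \<le> ennreal A * (\<integral>\<^sup>+x. ennreal ((f x)\<^sup>2) \<partial>lebesgue)"
    using frac_max_strong_type_2[where 'a='a] by blast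
  have m2: "modular ?p f l = (\<integral>\<^sup>+x. ennreal ((1 / l * f x)\<^sup>2) \<partial>lebesgue)" if "0 < l" for f :: "'a \<Rightarrow> real" and l
    unfolding modular_def using that
    by (intro nn_integral_cong) (auto simp: powr_numeral power_divide)
  have fin: "AE x in lebesgue. frac_max 0 f x < \<infinity>" 
    if f[measurable]: "f \<in> borel_measurable lebesgue" and l: "0 < l" "modular ?p f l < \<infinity>" for f l
  proof -
    have f'[measurable]: "(\<lambda>x. 1 / l * f x) \<in> borel_measurable lebesgue" by measurable
    have "(\<integral>\<^sup>+x. (frac_max 0 (\<lambda>x. 1 / l * f x) x)\<^sup>2 \<partial>lebesgue) \<le> ennreal A * modular ?p f l"
      using strong[OF f'] unfolding m2[OF l(1)] .
    also have "\<dots> < \<infinity>" using l by (simp add: ennreal_mult_less_top)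
    finally have "AE x in lebesgue. (frac_max 0 (\<lambda>x. 1 / l * f x) x)\<^sup>2 \<noteq> \<infinity>"
      by (intro nn_integral_PInf_AE) (auto intro!: borel_measurable_power frac_max_lebesgue)
    then show ?thesis
    proof (rule eventually_mono)
      fix x assume "(frac_max 0 (\<lambda>x. 1 / l * f x) x)\<^sup>2 \<noteq> \<infinity>"
      then have "frac_max 0 (\<lambda>x. 1 / l * f x) x \<noteq> \<infinity>"
        by (auto simp: power_eq_top_ennreal simp del: times_divide_eq_left)
      then have "(ennreal (1 / l) * frac_max 0 f x) \<noteq> \<infinity>"
        unfolding frac_max_scale[OF f] using l by simp
      then show "frac_max 0 f x < \<infinity>" using l
        by (metis ennreal_eq_0_iff ennreal_mult_eq_top_iff infinity_ennreal_def not_le top.not_eq_extremum zero_less_divide_1_iff)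
    qed
  qed
  \<comment> \<open>The modular for the exponent 2 is quadratic in the scale, so the constant A of
    the strong type estimate becomes sqrt A.\<close>
  have mod: "modular ?p (\<lambda>x. enn2real (frac_max 0 f x)) (sqrt A * l) \<le> modular ?p f l"
    if f[measurable]: "f \<in> borel_measurable lebesgue" and l: "0 < l" for f l
  proof -
    have f'[measurable]: "(\<lambda>x. 1 / l * f x) \<in> borel_measurable lebesgue" by measurable
    have "modular ?p (\<lambda>x. enn2real (frac_max 0 f x)) (sqrt A * l) \<le>
        (\<integral>\<^sup>+x. ennreal (1 / A) * (frac_max 0 (\<lambda>x. 1 / l * f x) x)\<^sup>2 \<partial>lebesgue)"
      unfolding modular_def
    proof (rule nn_integral_mono)
      fix x
      show "ennreal ((\<bar>enn2real (frac_max 0 f x)\<bar> / (sqrt A * l)) powr 2) \<le> ennreal (1 / A) * (frac_max 0 (\<lambda>x. 1 / l * f x) x)\<^sup>2"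
      proof (cases "frac_max 0 f x")
        case (real r)
        have "frac_max 0 (\<lambda>x. 1 / l * f x) x = ennreal (1 / l * r)"
          using real l unfolding frac_max_scale[OF f] by (simp add: ennreal_mult[symmetric])
        then have "ennreal (1 / A) * (frac_max 0 (\<lambda>x. 1 / l * f x) x)\<^sup>2 = ennreal (1 / A * (1 / l * r)\<^sup>2)"
          using real l A by (simp add: ennreal_power ennreal_mult[symmetric])
        also have "1 / A * (1 / l * r)\<^sup>2 = (r / (sqrt A * l)) powr 2"
          using real l A by (simp add: powr_numeral power_divide power_mult_distrib)
        finally show ?thesis using real by simp
      qed simp
    qed
    also have "\<dots> = ennreal (1 / A) * (\<integral>\<^sup>+x. (frac_max 0 (\<lambda>x. 1 / l * f x) x)\<^sup>2 \<partial>lebesgue)"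
      by (rule nn_integral_cmult) measurable
    also have "\<dots> \<le> ennreal (1 / A) * (ennreal A * modular ?p f l)"
      using strong[OF f'] unfolding m2[OF l(1)] by (rule mult_left_mono) simp
    also have "\<dots> = modular ?p f l"
      using A by (simp add: mult.assoc[symmetric] ennreal_mult[symmetric])
    finally show ?thesis .
  qed
  have "max_op_bounded (frac_max 0) ?p ?p"
    unfolding max_op_bounded_def
  proof (intro exI ballI conjI)
    fix f :: "'a \<Rightarrow> real" assume fL: "f \<in> Lvar ?p"
    then obtain l where l: "0 < l" "modular ?p f l < \<infinity>" and f[measurable]: "f \<in> borel_measurable lebesgue"
      unfolding Lvar_def by blast
    show "AE x in lebesgue. frac_max 0 f x < \<infinity>" by (rule fin[OF f l])
    have "modular ?p (\<lambda>x. enn2real (frac_max 0 f x)) (sqrt A * l) < \<infinity>"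
      using mod[OF f l(1)] l(2) by order
    then show "(\<lambda>x. enn2real (frac_max 0 f x)) \<in> Lvar ?p"
      unfolding Lvar_def using l A
      by (auto intro!: borel_measurable_enn2real frac_max_lebesgue exI[of _ "sqrt A * l"] mult_pos_pos)
    show "Lvar_norm ?p (\<lambda>x. enn2real (frac_max 0 f x)) \<le> ennreal (sqrt A) * Lvar_norm ?p f"
    proof (rule Lvar_norm_le_cmult)
      fix k :: real assume k: "0 < k" "modular ?p f k \<le> 1"
      then show "Lvar_norm ?p (\<lambda>x. enn2real (frac_max 0 f x)) \<le> ennreal (sqrt A * k)"
        using mod[OF f k(1)] A by (intro Lvar_norm_leI) auto
    qed (use A in simp)
  qed
  then show ?thesis unfolding exps_B_def using exps_P_const[of 2] by simp
qed

lemma exps_Bgamma_nonempty: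
  assumes "0 < \<gamma>" "\<gamma> < real DIM('a::euclidean_space)"
  shows "\<exists>p q :: 'a \<Rightarrow> real. (p, q) \<in> exps_Bgamma \<gamma>"
proof -
  let ?n = "real DIM('a)"
  \<comment> \<open>The constants for which q * (n - \<gamma>) / n is 2, the exponent for which the
    maximal theorem is available; p then follows from 1/q = 1/p - \<gamma>/n.\<close>
  define p q where "p = 2 * ?n / (?n + \<gamma>)" and "q = 2 * ?n / (?n - \<gamma>)"
  have "1 < p" unfolding p_def using assms by (simp add: divide_simps)
  then have 1: "(\<lambda>_::'a. p) \<in> exps_P" by (rule exps_P_const)
  have "p < ?n / \<gamma>" unfolding p_def using assms by (simp add: divide_simps)
  then have "ereal p < ereal (?n / \<gamma>)" by simp
  then have 2: "ess_sup (\<lambda>_::'a. p) < ereal (?n / \<gamma>)" using ess_sup_const_le[of p, where 'a='a] by order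
  have 3: "1 / q = 1 / p - \<gamma> / ?n" unfolding p_def q_def using assms by (simp add: field_simps)
  have "q * (?n - \<gamma>) / ?n = 2" unfolding q_def using assms by (simp add: divide_simps)
  then have 4: "(\<lambda>x::'a. q * (?n - \<gamma>) / ?n) \<in> exps_B" using exps_B_const_2[where 'a='a] by simp
  show ?thesis unfolding exps_Bgamma_def using 1 2 3 4 by (intro exI[of _ "\<lambda>_. p"] exI[of _ "\<lambda>_. q"]) simp
qed

text \<open>The form in which boundedness of M is used: functions in the unit ball, and one scale
  \<open>C\<close> for all of them.\<close>

lemma exps_B_modular_bound:
  fixes s :: "'a::euclidean_space \<Rightarrow> real"
  assumes "s \<in> exps_B"
  shows "\<exists>C>0. \<forall>h\<in>borel_measurable lebesgue. modular s h 1 \<le> 1 \<longrightarrow>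
    (AE x in lebesgue. frac_max 0 h x < \<infinity>) \<and> modular s (\<lambda>x. enn2real (frac_max 0 h x)) C \<le> 1"
proof -
  have P: "s \<in> exps_P" using assms unfolding exps_B_def by simp
  obtain C0 where C0: "\<And>f. f \<in> Lvar s \<Longrightarrow> (AE x in lebesgue. frac_max 0 f x < \<infinity>)"
    "\<And>f. f \<in> Lvar s \<Longrightarrow> Lvar_norm s (\<lambda>x. enn2real (frac_max 0 f x)) \<le> ennreal C0 * Lvar_norm s f"
    using assms unfolding exps_B_def max_op_bounded_def by blast
  show ?thesis
  proof (intro exI conjI ballI impI)
    \<comment> \<open>\<open>C0\<close> may be negative, in which case \<open>ennreal C0\<close> is
      0; the added 1 makes the norm inequality strict.\<close>
    show "0 < max C0 0 + 1" by simp
    fix h :: "'a \<Rightarrow> real" assume h: "h \<in> borel_measurable lebesgue" "modular s h 1 \<le> 1"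
    have "modular s h 1 < \<infinity>" using h(2) by (rule order.strict_trans1) simp
    then have hL: "h \<in> Lvar s" unfolding Lvar_def using h(1) zero_less_one by blast
    show "AE x in lebesgue. frac_max 0 h x < \<infinity>" by (rule C0(1)[OF hL])
    have "Lvar_norm s h \<le> ennreal 1" using h(2) by (intro Lvar_norm_leI) auto
    then have "ennreal C0 * Lvar_norm s h \<le> ennreal C0 * ennreal 1" by (rule mult_left_mono) simp
    also have "\<dots> < ennreal (max C0 0 + 1)" by (auto simp: ennreal_less_iff max_def ennreal_neg)
    finally have "Lvar_norm s (\<lambda>x. enn2real (frac_max 0 h x)) < ennreal (max C0 0 + 1)"
      using C0(2)[OF hL] by order
    then show "modular s (\<lambda>x. enn2real (frac_max 0 h x)) (max C0 0 + 1) \<le> 1"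
      using exps_PD(3)[OF P] by (rule modular_le_1_of_Lvar_norm_less(2))
  qed
qed

subsection \<open>The fractional maximal function on variable exponent spaces\<close>

text \<open>Hoelder's inequality with exponents \<open>1 / \<theta>\<close> and \<open>1 / (1 - \<theta>)\<close> is replaced here by
  \<open>u powr \<theta> * v powr (1 - \<theta>) \<le> u + v\<close>, applied after normalising the integral of \<open>h\<close>.\<close>

lemma powr_mult_powr_le_add:
  fixes u v :: real
  assumes "0 \<le> u" "0 \<le> v" "0 \<le> \<theta>" "\<theta> \<le> 1"
  shows "u powr \<theta> * v powr (1 - \<theta>) \<le> u + v"
proof (cases "max u v = 0")
  case False
  have "u powr \<theta> * v powr (1 - \<theta>) \<le> max u v powr \<theta> * max u v powr (1 - \<theta>)"
    using assms by (intro mult_mono powr_mono2) auto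
  also have "\<dots> = max u v" using False assms by (simp add: powr_add[symmetric])
  finally show ?thesis using assms by linarith
qed (use assms in \<open>auto simp: max_def split: if_splits\<close>)

text \<open>By \<open>ps\<close>, |f| is h^\<theta> * (|f|^p)^(1 - \<theta>). Over Q the integral of
  h is at most A = |Q| * m and that of |f|^p is at most 1. Normalising h by A bounds the integral of
  |f| by 2 * A^\<theta>, and the weight |Q|^(-\<theta>) leaves 2 * m^\<theta>.\<close>

lemma frac_avg_le_of_frac_max_le:
  fixes f :: "'a::euclidean_space \<Rightarrow> real"
  assumes [measurable]: "f \<in> borel_measurable lebesgue" "p \<in> borel_measurable lebesgue" "s \<in> borel_measurable lebesgue"
    and \<theta>: "\<theta> = 1 - \<gamma> / real DIM('a)" "0 < \<theta>" "\<theta> \<le> 1"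
    and ps: "\<And>x. p x / s x * \<theta> + p x * (1 - \<theta>) = 1"
    and mod: "modular p f 1 \<le> 1"
    and Q: "cube Q" "x \<in> Q"
    and m: "0 < m" "frac_max 0 (\<lambda>x. \<bar>f x\<bar> powr (p x / s x)) x \<le> ennreal m"
  shows "frac_avg \<gamma> f Q \<le> ennreal (2 * m powr \<theta>)"
proof -
  define h where "h x = \<bar>f x\<bar> powr (p x / s x)" for x
  note [measurable] = cube_sets[OF Q(1)]
  have [measurable]: "h \<in> borel_measurable lebesgue" unfolding h_def by measurable
  let ?v = "measure lebesgue Q"
  have v: "0 < ?v" using Q(1) by (rule measure_cube_pos)
  define A where "A = ?v * m"
  have A: "0 < A" unfolding A_def using v m by simp
  have hA: "(\<integral>\<^sup>+ y \<in> Q. ennreal (h y) \<partial>lebesgue) \<le> ennreal A"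
  proof -
    have "(\<integral>\<^sup>+ y \<in> Q. ennreal (h y) \<partial>lebesgue) = ennreal ?v * frac_avg 0 h Q"
      using v unfolding frac_avg_def
      by (simp add: powr_minus mult.assoc[symmetric] ennreal_mult[symmetric]) (simp add: h_def)
    also have "\<dots> \<le> ennreal ?v * ennreal m"
      using order_trans[OF frac_avg_le_frac_max[OF Q] m(2)] unfolding h_def by (rule mult_left_mono) simp
    also have "\<dots> = ennreal A" unfolding A_def using v m by (simp add: ennreal_mult)
    finally show ?thesis .
  qed
  have pw: "\<bar>f y\<bar> \<le> A powr \<theta> * (h y / A + \<bar>f y\<bar> powr p y)" for y
  proof -
    have "\<bar>f y\<bar> = h y powr \<theta> * (\<bar>f y\<bar> powr p y) powr (1 - \<theta>)"
      unfolding h_def powr_powr powr_add[symmetric] ps by simp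
    also have "h y powr \<theta> = A powr \<theta> * (h y / A) powr \<theta>"
      using A by (simp add: powr_mult[symmetric] h_def)
    also have "A powr \<theta> * (h y / A) powr \<theta> * (\<bar>f y\<bar> powr p y) powr (1 - \<theta>) =
        A powr \<theta> * ((h y / A) powr \<theta> * (\<bar>f y\<bar> powr p y) powr (1 - \<theta>))" by simp
    also have "\<dots> \<le> A powr \<theta> * (h y / A + \<bar>f y\<bar> powr p y)"
      using A \<theta> by (intro mult_left_mono powr_mult_powr_le_add) (auto simp: h_def)
    finally show ?thesis .
  qed
  have "(\<integral>\<^sup>+ y \<in> Q. ennreal \<bar>f y\<bar> \<partial>lebesgue) \<le>
    (\<integral>\<^sup>+ y. ennreal (A powr \<theta>) * (ennreal (1 / A) * (ennreal (h y) * indicator Q y) + ennreal (\<bar>f y\<bar> powr p y)) \<partial>lebesgue)"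
  proof (rule nn_integral_mono)
    fix y
    have "ennreal \<bar>f y\<bar> \<le> ennreal (A powr \<theta> * (h y / A + \<bar>f y\<bar> powr p y))" using pw by (rule ennreal_leI)
    also have "\<dots> = ennreal (A powr \<theta>) * (ennreal (1 / A) * ennreal (h y) + ennreal (\<bar>f y\<bar> powr p y))"
      using A by (simp add: ennreal_mult[symmetric] ennreal_plus[symmetric] h_def del: ennreal_plus)
    finally show "ennreal \<bar>f y\<bar> * indicator Q y \<le>
       ennreal (A powr \<theta>) * (ennreal (1 / A) * (ennreal (h y) * indicator Q y) + ennreal (\<bar>f y\<bar> powr p y))"
      by (cases "y \<in> Q") auto
  qed
  also have "\<dots> = ennreal (A powr \<theta>) * (ennreal (1 / A) * (\<integral>\<^sup>+ y \<in> Q. ennreal (h y) \<partial>lebesgue) + modular p f 1)"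
    unfolding modular_def by (simp add: nn_integral_cmult nn_integral_add)
  also have "\<dots> \<le> ennreal (A powr \<theta>) * (ennreal (1 / A) * ennreal A + 1)"
    using hA mod by (intro mult_left_mono add_mono) auto
  also have "\<dots> = ennreal (2 * A powr \<theta>)"
    using A by (simp add: ennreal_mult[symmetric] mult.commute ennreal_mult')
  finally have "frac_avg \<gamma> f Q \<le> ennreal (?v powr (\<gamma> / real DIM('a) - 1)) * ennreal (2 * A powr \<theta>)"
    unfolding frac_avg_def by (rule mult_left_mono) simp
  also have "\<dots> = ennreal (2 * m powr \<theta>)"
  proof -
    have "?v powr (\<gamma> / real DIM('a) - 1) * (2 * A powr \<theta>) = 2 * m powr \<theta> * (?v powr (- \<theta>) * ?v powr \<theta>)"
      unfolding A_def \<theta>(1) using v m by (simp add: powr_mult)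
    also have "?v powr (- \<theta>) * ?v powr \<theta> = 1" using v by (simp add: powr_add[symmetric])
    finally show ?thesis by (simp add: ennreal_mult[symmetric] del: ennreal_numeral)
  qed
  finally show ?thesis .
qed

lemma frac_max_pointwise_bound:
  fixes f :: "'a::euclidean_space \<Rightarrow> real"
  assumes "f \<in> borel_measurable lebesgue" "p \<in> borel_measurable lebesgue" "s \<in> borel_measurable lebesgue"
    and \<theta>: "\<theta> = 1 - \<gamma> / real DIM('a)" "0 < \<theta>" "\<theta> \<le> 1"
    and ps: "\<And>x. p x / s x * \<theta> + p x * (1 - \<theta>) = 1"
    and mod: "modular p f 1 \<le> 1"
    and r: "0 \<le> r" "frac_max 0 (\<lambda>x. \<bar>f x\<bar> powr (p x / s x)) x = ennreal r"
  shows "frac_max \<gamma> f x \<le> ennreal (2 * r powr \<theta>)"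
proof (rule frac_max_leI)
  fix Q assume Q: "cube Q" "x \<in> Q"
  \<comment> \<open>The estimate for one cube divides by |Q| * m, whereas \<open>r\<close> may be 0;
    hence the passage to the limit from m > r.\<close>
  have "((\<lambda>m. ennreal (2 * m powr \<theta>)) \<longlongrightarrow> ennreal (2 * r powr \<theta>)) (at_right r)"
    using \<theta> r by (intro tendsto_intros tendsto_powr' ) (auto simp: eventually_at_right_less eventually_at_filter)
  moreover have "\<forall>\<^sub>F m in at_right r. frac_avg \<gamma> f Q \<le> ennreal (2 * m powr \<theta>)"
    using eventually_at_right_less
  proof (rule eventually_mono)
    fix m assume "r < m"
    then show "frac_avg \<gamma> f Q \<le> ennreal (2 * m powr \<theta>)"
      using r by (intro frac_avg_le_of_frac_max_le[OF assms(1-8) Q]) (auto intro: ennreal_leI)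
  qed
  ultimately show "frac_avg \<gamma> f Q \<le> ennreal (2 * r powr \<theta>)"
    by (rule tendsto_lowerbound) simp
qed

text \<open>Measurability of \<open>q\<close> and q \<ge> 1 are not part of the definition; they are
  recovered from q * (1 - \<gamma>/n), which belongs to \<open>exps_P\<close>.\<close>

lemma exps_BgammaD:
  fixes p q :: "'a::euclidean_space \<Rightarrow> real"
  assumes "(p, q) \<in> exps_Bgamma \<gamma>" "0 < \<gamma>" "\<gamma> < real DIM('a)"
  shows "p \<in> exps_P" "(\<lambda>x. q x * (1 - \<gamma> / real DIM('a))) \<in> exps_B" "\<And>x. 1 / q x = 1 / p x - \<gamma> / real DIM('a)"
    "\<And>x. 1 \<le> q x" "q \<in> borel_measurable lebesgue"
proof -
  have *: "(\<lambda>x. q x * (1 - \<gamma> / real DIM('a))) = (\<lambda>x. q x * (real DIM('a) - \<gamma>) / real DIM('a))"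
    by (simp add: field_simps)
  have "p \<in> exps_P \<and> (\<lambda>x. q x * (1 - \<gamma> / real DIM('a))) \<in> exps_B \<and> (\<forall>x. 1 / q x = 1 / p x - \<gamma> / real DIM('a))"
    using assms(1) unfolding exps_Bgamma_def * by blast
  then show P: "p \<in> exps_P" and B: "(\<lambda>x. q x * (1 - \<gamma> / real DIM('a))) \<in> exps_B" and "\<And>x. 1 / q x = 1 / p x - \<gamma> / real DIM('a)"
    by blast+
  have BP: "(\<lambda>x. q x * (1 - \<gamma> / real DIM('a))) \<in> exps_P" using B unfolding exps_B_def by simp
  have th: "0 < 1 - \<gamma> / real DIM('a)" "1 - \<gamma> / real DIM('a) \<le> 1" using assms by (auto simp: field_simps)
  show "1 \<le> q x" for x
  proof -
    have 1: "1 \<le> q x * (1 - \<gamma> / real DIM('a))" using exps_PD(2)[OF BP] .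
    then have "0 \<le> q x" using th by (smt (verit) mult_nonpos_nonneg)
    then have "q x * (1 - \<gamma> / real DIM('a)) \<le> q x * 1" using th by (intro mult_left_mono) auto
    with 1 show ?thesis by simp
  qed
  have "(\<lambda>x. q x * (1 - \<gamma> / real DIM('a)) * (1 / (1 - \<gamma> / real DIM('a)))) \<in> borel_measurable lebesgue"
    by (rule borel_measurable_times[OF exps_PD(1)[OF BP] borel_measurable_const])
  moreover have "(\<lambda>x. q x * (1 - \<gamma> / real DIM('a)) * (1 / (1 - \<gamma> / real DIM('a)))) = q"
    using th by (intro ext) (simp only: mult.assoc times_divide_eq_right mult_1_right, simp)
  ultimately show "q \<in> borel_measurable lebesgue" by (simp only:)
qed

text \<open>The pointwise bound 2 * (M h)^\<theta> with h = |f|^(p/s) turns the exponent q on the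
  left into s = q * \<theta> on the right. Hence the scale 2 * C^\<theta> for M_\<gamma> corresponds
  to the scale C for M.\<close>

lemma frac_max_modular_bound:
  fixes p q :: "'a::euclidean_space \<Rightarrow> real"
  assumes pq: "(p, q) \<in> exps_Bgamma \<gamma>" and \<gamma>: "0 < \<gamma>" "\<gamma> < real DIM('a)"
  shows "\<exists>C>0. \<forall>f\<in>borel_measurable lebesgue. \<forall>l>0. modular p f l \<le> 1 \<longrightarrow>
    (AE x in lebesgue. frac_max \<gamma> f x < \<infinity>) \<and> modular q (\<lambda>x. enn2real (frac_max \<gamma> f x)) (C * l) \<le> 1"
proof -
  define \<theta> where "\<theta> = 1 - \<gamma> / real DIM('a)"
  have \<theta>: "0 < \<theta>" "\<theta> \<le> 1" unfolding \<theta>_def using \<gamma> by (auto simp: field_simps)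
  define s where "s x = q x * \<theta>" for x
  note D = exps_BgammaD[OF assms]
  have sB: "s \<in> exps_B" using D(2) unfolding s_def \<theta>_def .
  have sP: "s \<in> exps_P" using sB unfolding exps_B_def by simp
  note [measurable] = exps_PD(1)[OF D(1)] exps_PD(1)[OF sP] D(5)
  have ps: "p x / s x * \<theta> + p x * (1 - \<theta>) = 1" for x
  proof -
    have "p x / s x * \<theta> + p x * (1 - \<theta>) = p x * (1 / q x + \<gamma> / real DIM('a))"
      unfolding s_def using \<theta> D(4)[of x] by (simp add: \<theta>_def distrib_left)
    also have "\<dots> = 1" unfolding D(3) using exps_PD(2)[OF D(1), of x] by simp
    finally show ?thesis .
  qed
  obtain C where C: "0 < C" and CM: "\<And>h. h \<in> borel_measurable lebesgue \<Longrightarrow> modular s h 1 \<le> 1 \<Longrightarrow>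
    (AE x in lebesgue. frac_max 0 h x < \<infinity>) \<and> modular s (\<lambda>x. enn2real (frac_max 0 h x)) C \<le> 1"
    using exps_B_modular_bound[OF sB] by blast
  show ?thesis
  proof (intro exI[of _ "2 * C powr \<theta>"] conjI ballI allI impI)
    show "0 < 2 * C powr \<theta>" using C by simp
    fix f :: "'a \<Rightarrow> real" and l :: real
    assume f[measurable]: "f \<in> borel_measurable lebesgue" and l: "0 < l" and mod: "modular p f l \<le> 1"
    define g where "g x = 1 / l * f x" for x
    have g[measurable]: "g \<in> borel_measurable lebesgue" unfolding g_def by measurable
    have modg: "modular p g 1 \<le> 1" using mod l unfolding modular_def g_def by (simp add: abs_mult)
    define h where "h x = \<bar>g x\<bar> powr (p x / s x)" for x
    have h[measurable]: "h \<in> borel_measurable lebesgue" unfolding h_def by measurable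
    \<comment> \<open>Since (p/s) * s = p, passing from \<open>g\<close> to \<open>h\<close>
      preserves the modular while changing the exponent from p to s.\<close>
    have "modular s h 1 = modular p g 1"
      unfolding modular_def h_def using exps_PD(2)[OF sP]
      by (intro nn_integral_cong) (simp add: powr_powr, metis not_one_le_zero)
    with modg have h1: "modular s h 1 \<le> 1" by simp
    have fg: "frac_max \<gamma> f x = ennreal l * frac_max \<gamma> g x" for x
      unfolding g_def frac_max_scale[OF f] using l by (simp add: mult.assoc[symmetric] ennreal_mult[symmetric])
    have bd: "frac_max \<gamma> f x \<le> ennreal (l * (2 * enn2real (frac_max 0 h x) powr \<theta>))" if "frac_max 0 h x < \<infinity>" for x
    proof -
      have "frac_max \<gamma> g x \<le> ennreal (2 * enn2real (frac_max 0 h x) powr \<theta>)"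
        using that by (intro frac_max_pointwise_bound[OF g _ _ \<theta>_def \<theta> ps modg])
          (auto simp: h_def[abs_def])
      then have "ennreal l * frac_max \<gamma> g x \<le> ennreal l * ennreal (2 * enn2real (frac_max 0 h x) powr \<theta>)"
        by (rule mult_left_mono) simp
      then show ?thesis unfolding fg using l by (simp add: ennreal_mult)
    qed
    have fin: "AE x in lebesgue. frac_max 0 h x < \<infinity>" using CM[OF h h1] by blast
    then show "AE x in lebesgue. frac_max \<gamma> f x < \<infinity>"
    proof (rule eventually_mono)
      fix x assume "frac_max 0 h x < \<infinity>"
      from bd[OF this] show "frac_max \<gamma> f x < \<infinity>" by (rule order.strict_trans1) simp
    qed
    have "modular q (\<lambda>x. enn2real (frac_max \<gamma> f x)) (2 * C powr \<theta> * l) \<le> modular s (\<lambda>x. enn2real (frac_max 0 h x)) C"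
      unfolding modular_def
    proof (rule nn_integral_mono_AE, use fin in \<open>rule eventually_mono\<close>, rule ennreal_leI)
      fix x assume fx: "frac_max 0 h x < \<infinity>"
      let ?r = "enn2real (frac_max 0 h x)"
      have "enn2real (frac_max \<gamma> f x) \<le> l * (2 * ?r powr \<theta>)"
        using bd[OF fx] l by (intro enn2real_leI) auto
      then have "\<bar>enn2real (frac_max \<gamma> f x)\<bar> / (2 * C powr \<theta> * l) \<le> l * (2 * ?r powr \<theta>) / (2 * C powr \<theta> * l)"
        using C l by (intro divide_right_mono) auto
      also have "\<dots> = (?r / C) powr \<theta>" using C l by (simp add: powr_divide)
      finally have "(\<bar>enn2real (frac_max \<gamma> f x)\<bar> / (2 * C powr \<theta> * l)) powr q x \<le> ((?r / C) powr \<theta>) powr q x"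
        using C l D(4)[of x] by (intro powr_mono2) auto
      also have "\<dots> = (\<bar>?r\<bar> / C) powr s x" unfolding s_def by (simp add: powr_powr mult.commute)
      finally show "(\<bar>enn2real (frac_max \<gamma> f x)\<bar> / (2 * C powr \<theta> * l)) powr q x \<le> (\<bar>?r\<bar> / C) powr s x" .
    qed
    also have "\<dots> \<le> 1" using CM[OF h h1] by blast
    finally show "modular q (\<lambda>x. enn2real (frac_max \<gamma> f x)) (2 * C powr \<theta> * l) \<le> 1" .
  qed
qed

subsection \<open>Estimates for Hoelder continuous symbols\<close>

text \<open>Taking the positive part does not increase differences, and changes the representative
  only where it is negative, a null set by the second hypothesis.\<close>

lemma lipschitz_beta_nonneg_rep:
  assumes "lipschitz_beta \<beta> b" "AE x in lebesgue. 0 \<le> b x"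
  obtains C g where "0 < C" "\<And>x. 0 \<le> g x" "\<And>x y. \<bar>g x - g y\<bar> \<le> C * norm (x - y) powr \<beta>"
    "AE x in lebesgue. b x = g x"
proof -
  obtain g0 C0 where g0: "\<And>x y. \<bar>g0 x - g0 y\<bar> \<le> C0 * norm (x - y) powr \<beta>" "AE x in lebesgue. b x = g0 x"
    using assms(1) unfolding lipschitz_beta_def by blast
  define g where "g x = max (g0 x) 0" for x
  show ?thesis
  proof (rule that[of "max C0 1" g])
    fix x y
    have "\<bar>g x - g y\<bar> \<le> \<bar>g0 x - g0 y\<bar>" unfolding g_def by linarith
    also have "\<dots> \<le> C0 * norm (x - y) powr \<beta>" by (rule g0)
    also have "\<dots> \<le> max C0 1 * norm (x - y) powr \<beta>" by (rule mult_right_mono) auto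
    finally show "\<bar>g x - g y\<bar> \<le> max C0 1 * norm (x - y) powr \<beta>" .
  next
    show "AE x in lebesgue. b x = g x" using g0(2) assms(2) unfolding g_def by eventually_elim simp
  qed (auto simp: g_def)
qed

lemma holder_lebesgue_measurable:
  fixes g :: "'a::euclidean_space \<Rightarrow> real"
  assumes "\<And>x y. \<bar>g x - g y\<bar> \<le> C * norm (x - y) powr \<beta>" "0 < \<beta>"
  shows "g \<in> borel_measurable lebesgue"
proof -
  have "isCont g y" for y
  proof -
    have "((\<lambda>x. norm (x - y) powr \<beta>) \<longlongrightarrow> norm (y - y) powr \<beta>) (at y)"
      using assms(2) by (intro tendsto_powr' tendsto_intros) auto
    from tendsto_mult[OF tendsto_const[of C] this]
    have "((\<lambda>x. C * norm (x - y) powr \<beta>) \<longlongrightarrow> 0) (at y)" by simp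
    then have "((\<lambda>x. g x - g y) \<longlongrightarrow> 0) (at y)"
      by (rule Lim_null_comparison[rotated]) (simp_all add: assms(1))
    then show ?thesis unfolding isCont_def using LIM_zero_cancel by blast
  qed
  then have "continuous_on UNIV g" by (simp add: continuous_at_imp_continuous_on)
  then show ?thesis by (simp add: borel_measurable_continuous_onI measurable_completion)
qed

section \<open>Domination of the commutator by a maximal function of higher order\<close>

lemma frac_avg_add_const:
  fixes u v f :: "'a::euclidean_space \<Rightarrow> real"
  assumes [measurable]: "u \<in> borel_measurable lebesgue" "v \<in> borel_measurable lebesgue" "f \<in> borel_measurable lebesgue"
    and Q: "cube Q" and c: "0 \<le> c" and le: "\<And>y. y \<in> Q \<Longrightarrow> \<bar>u y\<bar> \<le> \<bar>v y\<bar> + c"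
  shows "frac_avg \<alpha> (\<lambda>y. u y * f y) Q \<le> frac_avg \<alpha> (\<lambda>y. v y * f y) Q + ennreal c * frac_avg \<alpha> f Q"
proof -
  note [measurable] = cube_sets[OF Q]
  have "(\<integral>\<^sup>+ y \<in> Q. ennreal \<bar>u y * f y\<bar> \<partial>lebesgue) \<le>
    (\<integral>\<^sup>+ y. ennreal \<bar>v y * f y\<bar> * indicator Q y + ennreal c * (ennreal \<bar>f y\<bar> * indicator Q y) \<partial>lebesgue)"
  proof (rule nn_integral_mono)
    fix y
    show "ennreal \<bar>u y * f y\<bar> * indicator Q y \<le> ennreal \<bar>v y * f y\<bar> * indicator Q y + ennreal c * (ennreal \<bar>f y\<bar> * indicator Q y)"
    proof (cases "y \<in> Q")
      case True
      have "\<bar>u y * f y\<bar> \<le> \<bar>v y * f y\<bar> + c * \<bar>f y\<bar>"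
        using mult_right_mono[OF le[OF True], of "\<bar>f y\<bar>"] by (simp add: abs_mult distrib_right)
      from ennreal_leI[OF this] show ?thesis using True c by (simp add: ennreal_mult ennreal_plus)
    qed simp
  qed
  also have "\<dots> = (\<integral>\<^sup>+ y \<in> Q. ennreal \<bar>v y * f y\<bar> \<partial>lebesgue) + ennreal c * (\<integral>\<^sup>+ y \<in> Q. ennreal \<bar>f y\<bar> \<partial>lebesgue)"
    by (simp add: nn_integral_add nn_integral_cmult)
  finally show ?thesis unfolding frac_avg_def
    by (metis (no_types, lifting) distrib_left mult.left_commute mult_left_mono zero_le)
qed

lemma frac_avg_shift_order:
  fixes Q :: "'a::euclidean_space set"
  assumes "cube Q"
  shows "ennreal (measure lebesgue Q powr (\<beta> / real DIM('a))) * frac_avg \<alpha> f Q = frac_avg (\<alpha> + \<beta>) f Q"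
  unfolding frac_avg_def using measure_cube_pos[OF assms]
  by (simp add: mult.assoc[symmetric] ennreal_mult[symmetric] powr_add[symmetric] add_divide_distrib algebra_simps)

text \<open>An error of size |Q|^(\<beta>/n) under an average of order \<alpha> is an average of
  order \<alpha> + \<beta>. It is applied with a symbol and its frozen value at \<open>x\<close> in
  both roles.\<close>

lemma frac_max_add_holder:
  fixes u v f :: "'a::euclidean_space \<Rightarrow> real"
  assumes "u \<in> borel_measurable lebesgue" "v \<in> borel_measurable lebesgue" "f \<in> borel_measurable lebesgue"
    and K: "0 \<le> K"
    and le: "\<And>Q y. cube Q \<Longrightarrow> x \<in> Q \<Longrightarrow> y \<in> Q \<Longrightarrow> \<bar>u y\<bar> \<le> \<bar>v y\<bar> + K * measure lebesgue Q powr (\<beta> / real DIM('a))"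
  shows "frac_max \<alpha> (\<lambda>y. u y * f y) x \<le> frac_max \<alpha> (\<lambda>y. v y * f y) x + ennreal K * frac_max (\<alpha> + \<beta>) f x"
proof (rule frac_max_leI)
  fix Q assume Q: "cube Q" "x \<in> Q"
  let ?c = "measure lebesgue Q powr (\<beta> / real DIM('a))"
  have "frac_avg \<alpha> (\<lambda>y. u y * f y) Q \<le> frac_avg \<alpha> (\<lambda>y. v y * f y) Q + ennreal (K * ?c) * frac_avg \<alpha> f Q"
    using K by (intro frac_avg_add_const assms(1-3) Q le) auto
  also have "ennreal (K * ?c) * frac_avg \<alpha> f Q = ennreal K * frac_avg (\<alpha> + \<beta>) f Q"
    using K unfolding frac_avg_shift_order[OF Q(1), symmetric] by (simp add: ennreal_mult mult.assoc)
  also have "frac_avg \<alpha> (\<lambda>y. v y * f y) Q + \<dots> \<le> frac_max \<alpha> (\<lambda>y. v y * f y) x + ennreal K * frac_max (\<alpha> + \<beta>) f x"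
    using Q by (intro add_mono mult_left_mono frac_avg_le_frac_max) auto
  finally show "frac_avg \<alpha> (\<lambda>y. u y * f y) Q \<le> frac_max \<alpha> (\<lambda>y. v y * f y) x + ennreal K * frac_max (\<alpha> + \<beta>) f x" .
qed

section \<open>Finiteness of maximal functions almost everywhere\<close>

lemma frac_max_0_finite_AE:
  fixes f :: "'a::euclidean_space \<Rightarrow> real"
  assumes f: "f \<in> borel_measurable lebesgue" and fin: "(\<integral>\<^sup>+x. ennreal \<bar>f x\<bar> \<partial>lebesgue) < \<infinity>"
  shows "AE x in lebesgue. frac_max 0 f x < \<infinity>"
proof -
  obtain A where A: "0 < A" and weak: "\<And>t. 0 < t \<Longrightarrow>
     emeasure lebesgue {x::'a. ennreal t < frac_max 0 f x} \<le> ennreal (A / t) * (\<integral>\<^sup>+x. ennreal \<bar>f x\<bar> \<partial>lebesgue)"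
    using frac_max_weak_type[where 'a='a] f by blast
  obtain F where F: "(\<integral>\<^sup>+x. ennreal \<bar>f x\<bar> \<partial>lebesgue) = ennreal F" "0 \<le> F"
    using fin by (cases "\<integral>\<^sup>+x. ennreal \<bar>f x\<bar> \<partial>lebesgue") auto
  define E where "E = {x. frac_max 0 f x = \<infinity>}"
  have "E = frac_max 0 f -` {\<infinity>} \<inter> space lebesgue" unfolding E_def by auto
  then have E: "E \<in> sets lebesgue" by (metis measurable_sets frac_max_lebesgue borel_singleton sets.empty_sets)
  have "emeasure lebesgue E \<le> ennreal (A * F / t)" if "0 < t" for t
  proof -
    have "emeasure lebesgue E \<le> emeasure lebesgue {x::'a. ennreal t < frac_max 0 f x}"
      unfolding E_def by (intro emeasure_mono) (auto simp: open_frac_max_greater borel_open)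
    also have "\<dots> \<le> ennreal (A / t) * ennreal F" using weak[OF that] unfolding F .
    also have "\<dots> = ennreal (A * F / t)" using A F that by (simp add: ennreal_mult[symmetric])
    finally show ?thesis .
  qed
  note bd = this
  have "((\<lambda>t. ennreal (A * F / t)) \<longlongrightarrow> ennreal 0) at_top"
    by (intro tendsto_ennrealI tendsto_divide_0[OF tendsto_const]) (simp add: filterlim_at_top_imp_at_infinity filterlim_ident)
  then have "emeasure lebesgue E \<le> ennreal 0"
    by (rule tendsto_lowerbound) (auto intro!: eventually_mono[OF eventually_gt_at_top[of 0]] bd)
  then have "E \<in> null_sets lebesgue" using E by (simp add: null_sets_def)
  then show ?thesis by (rule AE_I') (auto simp: E_def less_top[symmetric])
qed

text \<open>The estimates control M_\<gamma> f, but \<open>commutator_bounded\<close> also asks that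
  M_\<alpha> f be finite. Cubes of measure at least 1 have a smaller weight of order \<alpha> than
  of order \<gamma>; smaller cubes through \<open>x\<close> stay in a fixed ball, where M of the
  truncated function bounds them.\<close>

lemma frac_max_finite_AE_lower_order:
  fixes f :: "'a::euclidean_space \<Rightarrow> real"
  assumes f[measurable]: "f \<in> borel_measurable lebesgue"
    and loc: "\<And>R. (\<integral>\<^sup>+y \<in> cball 0 R. ennreal \<bar>f y\<bar> \<partial>lebesgue) < \<infinity>"
    and fin: "AE x in lebesgue. frac_max \<gamma> f x < \<infinity>" and \<alpha>: "0 \<le> \<alpha>" "\<alpha> \<le> \<gamma>"
  shows "AE x in lebesgue. frac_max \<alpha> f x < \<infinity>"
proof -
  \<comment> \<open>A cube of side at most 1 has diameter at most n, so if it meets the ball of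
    radius R it lies in the ball of radius R + n. Natural \<open>R\<close> keeps the exceptional
    null sets countable in number.\<close>
  define F where "F R x = f x * indicator (cball 0 (real R + real DIM('a))) x" for R :: nat and x
  have F[measurable]: "F R \<in> borel_measurable lebesgue" for R
    unfolding F_def by (intro borel_measurable_times f borel_measurable_indicator) simp
  have "AE x in lebesgue. frac_max 0 (F R) x < \<infinity>" for R
  proof (rule frac_max_0_finite_AE[OF F])
    have "(\<integral>\<^sup>+x. ennreal \<bar>F R x\<bar> \<partial>lebesgue) = (\<integral>\<^sup>+y \<in> cball 0 (real R + real DIM('a)). ennreal \<bar>f y\<bar> \<partial>lebesgue)"
      unfolding F_def by (intro nn_integral_cong) (auto simp: indicator_def)
    with loc show "(\<integral>\<^sup>+x. ennreal \<bar>F R x\<bar> \<partial>lebesgue) < \<infinity>" by simp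
  qed
  then have "AE x in lebesgue. \<forall>R. frac_max 0 (F R) x < \<infinity>" by (simp add: AE_all_countable)
  with fin show ?thesis
  proof eventually_elim
    case (elim x)
    obtain R :: nat where R: "norm x \<le> real R" using real_arch_simple by blast
    have "frac_max \<alpha> f x \<le> max (frac_max \<gamma> f x) (frac_max 0 (F R) x)"
    proof (rule frac_max_leI)
      fix Q assume Q: "cube Q" "x \<in> Q"
      obtain a l where l: "0 < l" "Q = cbox a (a + l *\<^sub>R One)" by (rule cubeE[OF Q(1)])
      let ?v = "measure lebesgue Q"
      have v: "0 < ?v" by (rule measure_cube_pos[OF Q(1)])
      show "frac_avg \<alpha> f Q \<le> max (frac_max \<gamma> f x) (frac_max 0 (F R) x)"
      proof (cases "1 \<le> ?v")
        case True
        have "?v powr (\<alpha> / real DIM('a) - 1) \<le> ?v powr (\<gamma> / real DIM('a) - 1)"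
          using True \<alpha> by (intro powr_mono) (auto simp: divide_right_mono)
        then have "frac_avg \<alpha> f Q \<le> frac_avg \<gamma> f Q"
          unfolding frac_avg_def by (intro mult_right_mono ennreal_leI) auto
        also have "\<dots> \<le> frac_max \<gamma> f x" using Q by (rule frac_avg_le_frac_max)
        finally show ?thesis by (simp add: le_max_iff_disj)
      next
        case False
        have "l \<le> 1"
        proof (rule ccontr)
          assume "\<not> l \<le> 1"
          then have "1 \<le> l ^ DIM('a)" by (intro one_le_power) auto
          then show False using False l measure_cube_cbox[of l a] by simp
        qed
        have "Q \<subseteq> cball 0 (real R + real DIM('a))"
        proof
          fix y assume "y \<in> Q"
          then have "norm (y - x) \<le> real DIM('a) * l" using Q cube_diameter unfolding l(2) by blast
          also have "\<dots> \<le> real DIM('a) * 1" using \<open>l \<le> 1\<close> by (intro mult_left_mono) auto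
          finally have "norm y \<le> real R + real DIM('a)"
            using R norm_triangle_ineq2[of y x] by linarith
          then show "y \<in> cball 0 (real R + real DIM('a))" by simp
        qed
        then have "ennreal \<bar>f y\<bar> * indicator Q y = ennreal \<bar>F R y\<bar> * indicator Q y" for y
          unfolding F_def by (cases "y \<in> Q") (auto simp: subset_iff)
        then have "frac_avg \<alpha> f Q = frac_avg \<alpha> (F R) Q" unfolding frac_avg_def by simp
        also have "?v powr (\<alpha> / real DIM('a) - 1) \<le> ?v powr (0 / real DIM('a) - 1)"
          using False v \<alpha> by (intro powr_mono') auto
        then have "frac_avg \<alpha> (F R) Q \<le> frac_avg 0 (F R) Q"
          unfolding frac_avg_def by (intro mult_right_mono ennreal_leI) auto
        also have "\<dots> \<le> frac_max 0 (F R) x" using Q by (rule frac_avg_le_frac_max)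
        finally show ?thesis by (simp add: le_max_iff_disj)
      qed
    qed
    also have "\<dots> < \<infinity>" using elim by simp
    finally show ?case .
  qed
qed

text \<open>For t \<ge> 0 and p \<ge> 1, t is at most 1 + t^p; the 1 is integrable over the ball,
  the power over the whole space.\<close>

lemma Lvar_locally_integrable:
  fixes f :: "'a::euclidean_space \<Rightarrow> real"
  assumes [measurable]: "f \<in> borel_measurable lebesgue" "p \<in> borel_measurable lebesgue"
    and p: "\<And>x. 1 \<le> p x" and l: "0 < l" "modular p f l \<le> 1"
  shows "(\<integral>\<^sup>+y \<in> cball 0 R. ennreal \<bar>f y\<bar> \<partial>lebesgue) < \<infinity>"
proof -
  have [measurable]: "cball (0::'a) R \<in> sets lebesgue" by simp
  have "(\<integral>\<^sup>+y \<in> cball 0 R. ennreal \<bar>f y\<bar> \<partial>lebesgue) \<le>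
    (\<integral>\<^sup>+y. ennreal l * (indicator (cball 0 R) y + ennreal ((\<bar>f y\<bar> / l) powr p y)) \<partial>lebesgue)"
  proof (rule nn_integral_mono)
    fix y
    have "\<bar>f y\<bar> / l \<le> 1 + (\<bar>f y\<bar> / l) powr p y"
    proof (cases "\<bar>f y\<bar> / l \<le> 1")
      case False
      then have "(\<bar>f y\<bar> / l) powr 1 \<le> (\<bar>f y\<bar> / l) powr p y" using p[of y] by (intro powr_mono) auto
      then show ?thesis using False l by simp
    qed (simp add: add_increasing2)
    then have "\<bar>f y\<bar> \<le> l * (1 + (\<bar>f y\<bar> / l) powr p y)" using l by (simp add: field_simps)
    from ennreal_leI[OF this] show "ennreal \<bar>f y\<bar> * indicator (cball 0 R) y \<le>
      ennreal l * (indicator (cball 0 R) y + ennreal ((\<bar>f y\<bar> / l) powr p y))"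
      using l by (cases "y \<in> cball 0 R") (auto simp: ennreal_mult)
  qed
  also have "\<dots> = ennreal l * (emeasure lebesgue (cball (0::'a) R) + modular p f l)"
    unfolding modular_def by (simp add: nn_integral_cmult nn_integral_add)
  also have "\<dots> < \<infinity>"
    using l(2) emeasure_lborel_cball_finite[of "0::'a" R] by (auto simp: ennreal_mult_less_top intro: order.strict_trans1)
  finally show ?thesis .
qed

lemma holder_on_cube:
  fixes g :: "'a::euclidean_space \<Rightarrow> real"
  assumes "\<And>x y. \<bar>g x - g y\<bar> \<le> C * norm (x - y) powr \<beta>" "0 \<le> C" "0 \<le> \<beta>" "cube Q" "x \<in> Q" "y \<in> Q"
  shows "\<bar>g x - g y\<bar> \<le> C * real DIM('a) powr \<beta> * measure lebesgue Q powr (\<beta> / real DIM('a))"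
proof -
  have "\<bar>g x - g y\<bar> \<le> C * norm (x - y) powr \<beta>" by fact
  also have "\<dots> \<le> C * (real DIM('a) powr \<beta> * measure lebesgue Q powr (\<beta> / real DIM('a)))"
    using assms by (intro mult_left_mono cube_diameter_powr) auto
  finally show ?thesis by (simp add: mult.assoc)
qed

text \<open>With a nonnegative Hoelder representative g, the commutator at \<open>x\<close> is
  M_\<alpha>(g(x) f)(x) - M_\<alpha>(g f)(x), where g(x) is a constant factor; freezing g costs K *
  M_{\<alpha>+\<beta>} f(x).\<close>

lemma commutator_bounded_of_lipschitz:
  fixes b :: "'a::euclidean_space \<Rightarrow> real"
  assumes \<beta>: "0 < \<beta>" and \<alpha>: "0 < \<alpha>" and \<gamma>: "\<alpha> + \<beta> < real DIM('a)"
    and b[measurable]: "b \<in> borel_measurable lebesgue"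
    and lip: "lipschitz_beta \<beta> b" "AE x in lebesgue. 0 \<le> b x"
    and pq: "(p, q) \<in> exps_Bgamma (\<alpha> + \<beta>)"
  shows "commutator_bounded b \<alpha> p q"
proof -
  have \<gamma>0: "0 < \<alpha> + \<beta>" using \<alpha> \<beta> by simp
  obtain C g where C: "0 < C" and g0: "\<And>x. 0 \<le> g x"
    and hol: "\<And>x y. \<bar>g x - g y\<bar> \<le> C * norm (x - y) powr \<beta>" and bg: "AE x in lebesgue. b x = g x"
    using lipschitz_beta_nonneg_rep[OF lip] by blast
  have g[measurable]: "g \<in> borel_measurable lebesgue"
    using hol \<beta> by (rule holder_lebesgue_measurable)
  define K where "K = C * real DIM('a) powr \<beta>"
  have K: "0 < K" unfolding K_def using C by simp
  have holQ: "\<bar>g x - g y\<bar> \<le> K * measure lebesgue Q powr (\<beta> / real DIM('a))" if "cube Q" "x \<in> Q" "y \<in> Q" for Q x y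
    unfolding K_def using hol C \<beta> that by (intro holder_on_cube) auto
  note D = exps_BgammaD[OF pq \<gamma>0 \<gamma>]
  note P = exps_PD[OF D(1)]
  obtain A where A: "0 < A" and AM: "\<And>f l. f \<in> borel_measurable lebesgue \<Longrightarrow> 0 < l \<Longrightarrow> modular p f l \<le> 1 \<Longrightarrow>
    (AE x in lebesgue. frac_max (\<alpha> + \<beta>) f x < \<infinity>) \<and> modular q (\<lambda>x. enn2real (frac_max (\<alpha> + \<beta>) f x)) (A * l) \<le> 1"
    using frac_max_modular_bound[OF pq \<gamma>0 \<gamma>] by blast
  have pw: "frac_max \<alpha> (\<lambda>y. b y * f y) x < \<infinity> \<and> \<bar>commutator_frac_max b \<alpha> f x\<bar> \<le> K * enn2real (frac_max (\<alpha> + \<beta>) f x)"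
    if f[measurable]: "f \<in> borel_measurable lebesgue" and x: "b x = g x" "frac_max (\<alpha> + \<beta>) f x < \<infinity>" "frac_max \<alpha> f x < \<infinity>" for f x
  proof -
    have eq: "frac_max \<alpha> (\<lambda>y. b y * f y) x = frac_max \<alpha> (\<lambda>y. g y * f y) x"
      using bg by (intro frac_max_cong_AE) (auto elim!: eventually_mono)
    \<comment> \<open>Here nonnegativity enters: the maximal function extracts |g x|, while the
      commutator carries b x with its sign.\<close>
    have sc: "frac_max \<alpha> (\<lambda>y. g x * f y) x = ennreal (g x) * frac_max \<alpha> f x"
      using g0 by (simp add: frac_max_scale[OF f])
    have 1: "frac_max \<alpha> (\<lambda>y. g y * f y) x \<le> frac_max \<alpha> (\<lambda>y. g x * f y) x + ennreal K * frac_max (\<alpha> + \<beta>) f x"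
    proof (rule frac_max_add_holder)
      fix Q y assume "cube Q" "x \<in> Q" "y \<in> Q"
      from holQ[OF this] show "\<bar>g y\<bar> \<le> \<bar>g x\<bar> + K * measure lebesgue Q powr (\<beta> / real DIM('a))" by linarith
    qed (use K in auto)
    have 2: "frac_max \<alpha> (\<lambda>y. g x * f y) x \<le> frac_max \<alpha> (\<lambda>y. g y * f y) x + ennreal K * frac_max (\<alpha> + \<beta>) f x"
    proof (rule frac_max_add_holder)
      fix Q y assume "cube Q" "x \<in> Q" "y \<in> Q"
      from holQ[OF this] show "\<bar>g x\<bar> \<le> \<bar>g y\<bar> + K * measure lebesgue Q powr (\<beta> / real DIM('a))" by linarith
    qed (use K in auto)
    obtain r where r: "frac_max (\<alpha> + \<beta>) f x = ennreal r" "0 \<le> r" using x(2) by (cases "frac_max (\<alpha> + \<beta>) f x") auto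
    obtain u where u: "frac_max \<alpha> f x = ennreal u" "0 \<le> u" using x(3) by (cases "frac_max \<alpha> f x") auto
    have "frac_max \<alpha> (\<lambda>y. g y * f y) x \<le> ennreal (g x * u + K * r)"
      using 1 unfolding sc r u using g0[of x] r u K by (simp add: ennreal_mult ennreal_plus)
    moreover then obtain w where w: "frac_max \<alpha> (\<lambda>y. g y * f y) x = ennreal w" "0 \<le> w"
      by (cases "frac_max \<alpha> (\<lambda>y. g y * f y) x") (auto simp: top_unique)
    ultimately have w1: "w \<le> g x * u + K * r"
      using g0[of x] r u K by (simp add: ennreal_le_iff del: ennreal_plus)
    have "ennreal (g x * u) \<le> ennreal (w + K * r)"
      using 2 unfolding sc r u w using g0[of x] r u K w by (simp add: ennreal_mult ennreal_plus)
    then have w2: "g x * u \<le> w + K * r"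
      using r K w by (simp add: ennreal_le_iff del: ennreal_plus)
    have "\<bar>g x * u - w\<bar> \<le> K * r" using w1 w2 by linarith
    then show ?thesis unfolding commutator_frac_max_def eq w r u x(1) using r u w by simp
  qed
  show ?thesis unfolding commutator_bounded_def
  proof (intro exI ballI conjI)
    fix f assume fL: "f \<in> Lvar p"
    then have f[measurable]: "f \<in> borel_measurable lebesgue" unfolding Lvar_def by simp
    obtain l where l: "0 < l" "modular p f l \<le> 1" using LvarD_modular_le_1[OF fL P(2) P(1)] .
    have fin: "AE x in lebesgue. frac_max (\<alpha> + \<beta>) f x < \<infinity>" using AM[OF f l] by blast
    have fin2: "AE x in lebesgue. frac_max \<alpha> f x < \<infinity>"
      using \<alpha> \<beta> by (intro frac_max_finite_AE_lower_order[OF f Lvar_locally_integrable[OF f P(1) P(2) l] fin]) auto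
    show "AE x in lebesgue. frac_max \<alpha> f x < \<infinity> \<and> frac_max \<alpha> (\<lambda>y. b y * f y) x < \<infinity>"
      using bg fin fin2 by eventually_elim (use pw[OF f] in blast)
    have le: "AE x in lebesgue. \<bar>commutator_frac_max b \<alpha> f x\<bar> \<le> \<bar>K * enn2real (frac_max (\<alpha> + \<beta>) f x)\<bar>"
      using bg fin fin2
    proof eventually_elim
      case (elim x)
      then show ?case using pw[OF f, of x] by linarith
    qed
    have mod: "modular q (commutator_frac_max b \<alpha> f) (K * A * k) \<le> 1" if k: "0 < k" "modular p f k \<le> 1" for k
    proof -
      have "modular q (commutator_frac_max b \<alpha> f) (K * (A * k)) \<le> modular q (\<lambda>x. K * enn2real (frac_max (\<alpha> + \<beta>) f x)) (K * (A * k))"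
        using K A k D(4) by (intro modular_mono_AE le) (auto intro: order_trans[OF zero_le_one])
      also have "\<dots> = modular q (\<lambda>x. enn2real (frac_max (\<alpha> + \<beta>) f x)) (A * k)"
        using K A k by (intro modular_cmult) auto
      also have "\<dots> \<le> 1" using AM[OF f k] by blast
      finally show ?thesis by (simp add: mult.assoc)
    qed
    have meas: "commutator_frac_max b \<alpha> f \<in> borel_measurable lebesgue"
      unfolding commutator_frac_max_def[abs_def] by measurable
    have "modular q (commutator_frac_max b \<alpha> f) (K * A * l) < \<infinity>"
      using mod[OF l] by (rule order.strict_trans1) simp
    then show "commutator_frac_max b \<alpha> f \<in> Lvar q"
      unfolding Lvar_def using meas K A l by (auto intro!: exI[of _ "K * A * l"])
    show "Lvar_norm q (commutator_frac_max b \<alpha> f) \<le> ennreal (K * A) * Lvar_norm p f"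
      using K A mod by (intro Lvar_norm_le_cmult Lvar_norm_leI) auto
  qed
qed

section \<open>Oscillation of Hoelder continuous symbols over cubes\<close>

lemma frac_avg_const:
  fixes P :: "'a::euclidean_space set"
  assumes P: "cube P" "0 \<le> a"
  shows "frac_avg \<alpha> (\<lambda>_. a) P = ennreal (measure lebesgue P powr (\<alpha> / real DIM('a)) * a)"
proof -
  have vP: "0 < measure lebesgue P" by (rule measure_cube_pos[OF P(1)])
  have "(\<integral>\<^sup>+ y \<in> P. ennreal \<bar>a\<bar> \<partial>lebesgue) = ennreal (a * measure lebesgue P)"
    using cube_sets[OF P(1)] P(2)
    by (subst nn_integral_cmult_indicator) (auto simp: emeasure_cube_eq[OF P(1)] ennreal_mult)
  then have "frac_avg \<alpha> (\<lambda>_. a) P = ennreal (measure lebesgue P powr (\<alpha> / real DIM('a) - 1) * (a * measure lebesgue P))"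
    unfolding frac_avg_def using P by (simp add: ennreal_mult)
  also have "measure lebesgue P powr (\<alpha> / real DIM('a) - 1) * (a * measure lebesgue P) = measure lebesgue P powr (\<alpha> / real DIM('a)) * a"
    using vP by (simp add: powr_diff)
  finally show ?thesis .
qed

text \<open>The deviation of \<open>b\<close> from its normalised local maximal function, which
  takes the place of the mean in the oscillation over Q.\<close>

definition osc_fun :: "real \<Rightarrow> ('a::euclidean_space \<Rightarrow> real) \<Rightarrow> 'a set \<Rightarrow> 'a \<Rightarrow> real" where
  "osc_fun \<alpha> b Q x = b x - measure lebesgue Q powr (- \<alpha> / real DIM('a)) * enn2real (frac_max_loc \<alpha> Q b x)"

lemma osc_sup_eq:
  "osc_sup \<alpha> \<beta> b s = (SUP Q \<in> {Q. cube Q}. ennreal (measure lebesgue Q powr (- \<beta> / real DIM('a))) *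
      Lvar_norm s (\<lambda>x. osc_fun \<alpha> b Q x * indicator Q x) / Lvar_norm s (indicator Q))"
  for b :: "'a::euclidean_space \<Rightarrow> real"
  unfolding osc_sup_def osc_fun_def ..

text \<open>On every subcube of Q through \<open>x\<close>, g stays within c of g x. The upper bound
  for the normalised local maximal function uses |P|^(\<alpha>/n) \<le> |Q|^(\<alpha>/n) for such
  subcubes P, the lower bound takes Q itself.\<close>

lemma osc_fun_bound_of_holder:
  fixes b g :: "'a::euclidean_space \<Rightarrow> real"
  assumes \<alpha>: "0 < \<alpha>" "\<alpha> \<le> real DIM('a)" and \<beta>: "0 < \<beta>" and g0: "\<And>x. 0 \<le> g x" and K: "0 \<le> K"
    and [measurable]: "g \<in> borel_measurable lebesgue"
    and holQ: "\<And>Q x y. cube Q \<Longrightarrow> x \<in> Q \<Longrightarrow> y \<in> Q \<Longrightarrow> \<bar>g x - g y\<bar> \<le> K * measure lebesgue Q powr (\<beta> / real DIM('a))"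
    and bg: "AE x in lebesgue. b x = g x" and Q: "cube Q" "x \<in> Q" and bx: "b x = g x"
  shows "\<bar>osc_fun \<alpha> b Q x\<bar> \<le> K * measure lebesgue Q powr (\<beta> / real DIM('a))"
proof -
  let ?n = "real DIM('a)"
  let ?v = "measure lebesgue Q"
  have v: "0 < ?v" by (rule measure_cube_pos[OF Q(1)])
  define c where "c = K * ?v powr (\<beta> / ?n)"
  have c: "0 \<le> c" unfolding c_def using K by simp
  have eq: "frac_max_loc \<alpha> Q b x = frac_max_loc \<alpha> Q g x"
    unfolding frac_max_loc_eq_frac_max[OF Q \<alpha>(2)]
    using bg by (intro frac_max_cong_AE) (auto elim!: eventually_mono)
  have up: "frac_max_loc \<alpha> Q g x \<le> ennreal (?v powr (\<alpha> / ?n) * (g x + c))"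
  proof (rule frac_max_loc_leI)
    fix P assume P: "cube P" "x \<in> P" "P \<subseteq> Q"
    have "frac_avg \<alpha> g P \<le> frac_avg \<alpha> (\<lambda>_. g x + c) P"
    proof -
      have "ennreal \<bar>g y\<bar> * indicator P y \<le> ennreal \<bar>g x + c\<bar> * indicator P y" for y
      proof (cases "y \<in> P")
        case True
        then have "\<bar>g x - g y\<bar> \<le> c" unfolding c_def using P Q by (intro holQ) auto
        then show ?thesis using True g0[of y] by (auto intro!: ennreal_leI)
      qed simp
      then show ?thesis unfolding frac_avg_def by (intro mult_left_mono nn_integral_mono) simp_all
    qed
    also have "\<dots> = ennreal (measure lebesgue P powr (\<alpha> / ?n) * (g x + c))"
      using P g0[of x] c by (intro frac_avg_const) auto
    also have "\<dots> \<le> ennreal (?v powr (\<alpha> / ?n) * (g x + c))"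
    proof (intro ennreal_leI mult_right_mono powr_mono2)
      show "measure lebesgue P \<le> ?v"
        using P(1,3) cube_sets lmeasurable_compact[OF compact_cube[OF Q(1)]] by (intro measure_mono_fmeasurable) auto
    qed (use \<alpha> g0[of x] c in auto)
    finally show "frac_avg \<alpha> g P \<le> ennreal (?v powr (\<alpha> / ?n) * (g x + c))" .
  qed
  have low: "ennreal (?v powr (\<alpha> / ?n) * (g x - c)) \<le> frac_max_loc \<alpha> Q g x"
  proof (cases "c \<le> g x")
    case True
    have "ennreal (?v powr (\<alpha> / ?n) * (g x - c)) = frac_avg \<alpha> (\<lambda>_. g x - c) Q"
      using Q True by (intro frac_avg_const[symmetric]) auto
    also have "\<dots> \<le> frac_avg \<alpha> g Q"
    proof -
      have "ennreal \<bar>g x - c\<bar> * indicator Q y \<le> ennreal \<bar>g y\<bar> * indicator Q y" for y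
      proof (cases "y \<in> Q")
        case True
        then have "\<bar>g x - g y\<bar> \<le> c" unfolding c_def using Q by (intro holQ) auto
        then show ?thesis using True \<open>c \<le> g x\<close> by (auto intro!: ennreal_leI)
      qed simp
      then show ?thesis unfolding frac_avg_def by (intro mult_left_mono nn_integral_mono) simp_all
    qed
    also have "\<dots> \<le> frac_max_loc \<alpha> Q g x" using Q by (intro frac_avg_le_frac_max_loc) auto
    finally show ?thesis .
  next
    case False
    then have "?v powr (\<alpha> / ?n) * (g x - c) \<le> 0" by (intro mult_nonneg_nonpos) auto
    then show ?thesis by (simp add: ennreal_neg)
  qed
  obtain r where r: "frac_max_loc \<alpha> Q g x = ennreal r" "0 \<le> r"
    using up by (cases "frac_max_loc \<alpha> Q g x") (auto simp: top_unique)
  have gc: "0 \<le> g x + c" using g0[of x] c by simp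
  have "r \<le> ?v powr (\<alpha> / ?n) * (g x + c)"
    using up gc unfolding r by (simp add: ennreal_le_iff)
  moreover have "?v powr (\<alpha> / ?n) * (g x - c) \<le> r"
    using low r by (simp add: ennreal_le_iff)
  moreover have "?v powr (- \<alpha> / ?n) * (?v powr (\<alpha> / ?n) * z) = z" for z
    using v by (simp add: mult.assoc[symmetric] powr_add[symmetric])
  ultimately have "?v powr (- \<alpha> / ?n) * r \<le> g x + c" "g x - c \<le> ?v powr (- \<alpha> / ?n) * r"
    by (metis mult_left_mono powr_ge_zero)+
  then show ?thesis unfolding osc_fun_def eq r bx c_def[symmetric] using r by (auto simp: abs_le_iff)
qed

lemma osc_sup_finite_of_lipschitz:
  fixes b :: "'a::euclidean_space \<Rightarrow> real"
  assumes \<beta>: "0 < \<beta>" and \<alpha>: "0 < \<alpha>" "\<alpha> \<le> real DIM('a)"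
    and b[measurable]: "b \<in> borel_measurable lebesgue"
    and lip: "lipschitz_beta \<beta> b" "AE x in lebesgue. 0 \<le> b x"
    and s: "s \<in> exps_B"
  shows "osc_sup \<alpha> \<beta> b s < \<infinity>"
proof -
  let ?n = "real DIM('a)"
  obtain C g where C: "0 < C" and g0: "\<And>x. 0 \<le> g x"
    and hol: "\<And>x y. \<bar>g x - g y\<bar> \<le> C * norm (x - y) powr \<beta>" and bg: "AE x in lebesgue. b x = g x"
    using lipschitz_beta_nonneg_rep[OF lip] by blast
  have g[measurable]: "g \<in> borel_measurable lebesgue"
    using hol \<beta> by (rule holder_lebesgue_measurable)
  define K where "K = C * ?n powr \<beta>"
  have K: "0 < K" unfolding K_def using C by simp
  have holQ: "\<bar>g x - g y\<bar> \<le> K * measure lebesgue Q powr (\<beta> / ?n)" if "cube Q" "x \<in> Q" "y \<in> Q" for Q x y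
    unfolding K_def using hol C \<beta> that by (intro holder_on_cube) auto
  have sP: "s \<in> exps_P" using s unfolding exps_B_def by simp
  have "osc_sup \<alpha> \<beta> b s \<le> ennreal K"
    unfolding osc_sup_eq
  proof (rule SUP_least)
    fix Q :: "'a set" assume "Q \<in> {Q. cube Q}"
    then have Q: "cube Q" by simp
    let ?v = "measure lebesgue Q"
    let ?N = "Lvar_norm s (\<lambda>x. osc_fun \<alpha> b Q x * indicator Q x)"
    let ?D = "Lvar_norm s (indicator Q)"
    have v: "0 < ?v" by (rule measure_cube_pos[OF Q])
    define c where "c = K * ?v powr (\<beta> / ?n)"
    have c: "0 < c" unfolding c_def using K v by simp
    have le: "AE x in lebesgue. \<bar>osc_fun \<alpha> b Q x * indicator Q x\<bar> \<le> \<bar>c * indicator Q x\<bar>"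
      using bg
    proof eventually_elim
      case (elim x)
      then show ?case
        using osc_fun_bound_of_holder[OF \<alpha> \<beta> g0 less_imp_le[OF K] g holQ bg Q _ elim] c
        by (cases "x \<in> Q") (auto simp: c_def)
    qed
    have "?N \<le> ennreal c * ?D"
    proof (rule Lvar_norm_le_cmult[OF c])
      fix l :: real assume l: "0 < l" "modular s (indicat_real Q) l \<le> 1"
      have "modular s (\<lambda>x. osc_fun \<alpha> b Q x * indicator Q x) (c * l) \<le> modular s (\<lambda>x. c * indicator Q x) (c * l)"
        using le c l exps_PD(3)[OF sP] by (intro modular_mono_AE) auto
      also have "\<dots> = modular s (indicator Q) l" using c l(1) by (rule modular_cmult)
      also note l(2)
      finally show "?N \<le> ennreal (c * l)" using c l by (intro Lvar_norm_leI) auto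
    qed
    then have "ennreal (?v powr (- \<beta> / ?n)) * ?N \<le> ennreal (?v powr (- \<beta> / ?n)) * (ennreal c * ?D)"
      by (rule mult_left_mono) simp
    also have "\<dots> = ennreal (?v powr (- \<beta> / ?n) * c) * ?D"
      using c by (simp add: ennreal_mult mult.assoc)
    also have "?v powr (- \<beta> / ?n) * c = K"
      unfolding c_def using v by (simp add: mult.left_commute powr_add[symmetric])
    finally show "ennreal (?v powr (- \<beta> / ?n)) * ?N / ?D \<le> ennreal K"
      using cube_indicator_norm_pos[OF Q exps_PD(2)[OF sP]] by (intro divide_le_posI_ennreal) (auto simp: mult.commute)
  qed
  also have "\<dots> < \<infinity>" by simp
  finally show ?thesis .
qed

subsection \<open>From norms to averages\<close>

text \<open>Let k be the r-th power of |h|/l on Q, so that its s-modular is the q-modular of h at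
  scale l. Its average m over Q is below M k on all of Q, and boundedness of M on L^s compares m
  with the norm of the indicator of Q. A convexity bound then passes from the average of k to that
  of |h|. The case r = 1 serves condition (4), r = 1/\<theta> the commutator.\<close>

lemma nn_integral_cube_le_of_norm_le:
  fixes s q :: "'a::euclidean_space \<Rightarrow> real"
  assumes s: "s \<in> exps_B" and r: "1 \<le> r" and q: "\<And>x. q x = r * s x"
  shows "\<exists>C>0. \<forall>Q h A. cube Q \<longrightarrow> h \<in> borel_measurable lebesgue \<longrightarrow> 0 < A \<longrightarrow>
    Lvar_norm q (\<lambda>x. h x * indicator Q x) \<le> ennreal A * Lvar_norm q (indicator Q) \<longrightarrow>
    (\<integral>\<^sup>+x \<in> Q. ennreal \<bar>h x\<bar> \<partial>lebesgue) \<le> ennreal (C * A * measure lebesgue Q)"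
proof -
  have sP: "s \<in> exps_P" using s unfolding exps_B_def by simp
  note sD = exps_PD[OF sP]
  have q1: "1 \<le> q x" for x
    unfolding q using mult_mono[OF r sD(2)[of x]] r by simp
  have q0: "0 \<le> q x" for x using q1[of x] by simp
  obtain C where C: "0 < C" and CM: "\<And>h. h \<in> borel_measurable lebesgue \<Longrightarrow> modular s h 1 \<le> 1 \<Longrightarrow>
    (AE x in lebesgue. frac_max 0 h x < \<infinity>) \<and> modular s (\<lambda>x. enn2real (frac_max 0 h x)) C \<le> 1"
    using exps_B_modular_bound[OF s] by blast
  show ?thesis
  proof (intro exI[of _ "4 * C powr (1 / r)"] conjI allI impI)
    show "0 < 4 * C powr (1 / r)" using C by simp
    fix Q :: "'a set" and h :: "'a \<Rightarrow> real" and A :: real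
    assume Q: "cube Q" and h[measurable]: "h \<in> borel_measurable lebesgue" and A: "0 < A"
      and N: "Lvar_norm q (\<lambda>x. h x * indicator Q x) \<le> ennreal A * Lvar_norm q (indicator Q)"
    note [measurable] = cube_sets[OF Q]
    let ?v = "measure lebesgue Q"
    have v: "0 < ?v" by (rule measure_cube_pos[OF Q])
    obtain D where D: "Lvar_norm q (indicator Q) = ennreal D" "0 < D"
      using cube_indicator_norm_pos[of Q q, OF Q q1] cube_indicator_norm_finite[of Q q, OF Q q1]
      by (cases "Lvar_norm q (indicator Q)") auto
    \<comment> \<open>The norm of h on Q is at most A * D; the factor 2 makes the inequality
      strict.\<close>
    define l where "l = 2 * A * D"
    have l: "0 < l" unfolding l_def using A D by simp
    have "ennreal A * Lvar_norm q (indicator Q) < ennreal l"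
      unfolding D l_def using A D by (simp add: ennreal_mult[symmetric] ennreal_less_iff)
    with N have "Lvar_norm q (\<lambda>x. h x * indicator Q x) < ennreal l" by order
    then have hl: "modular q (\<lambda>x. h x * indicator Q x) l \<le> 1"
      using q0 by (rule modular_le_1_of_Lvar_norm_less(2))
    define k where "k x = (\<bar>h x * indicator Q x\<bar> / l) powr r" for x
    have k[measurable]: "k \<in> borel_measurable lebesgue" unfolding k_def by measurable
    have k0: "0 \<le> k x" for x unfolding k_def by simp
    have "modular s k 1 = modular q (\<lambda>x. h x * indicator Q x) l"
      unfolding modular_def k_def using r l by (intro nn_integral_cong) (simp add: powr_powr q)
    with hl have k1: "modular s k 1 \<le> 1" by simp
    have finM: "AE x in lebesgue. frac_max 0 k x < \<infinity>" and modM: "modular s (\<lambda>x. enn2real (frac_max 0 k x)) C \<le> 1"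
      using CM[OF k k1] by blast+
    \<comment> \<open>Q is not null, so it contains a point where M k is finite; hence the average
      of k over Q is a real number.\<close>
    have "\<exists>x\<in>Q. frac_max 0 k x < \<infinity>"
    proof (rule ccontr)
      assume "\<not> ?thesis"
      with finM have "AE x in lebesgue. x \<notin> Q" by (auto elim!: eventually_mono)
      then have "emeasure lebesgue Q = 0" by (subst (asm) AE_iff_measurable[OF cube_sets[OF Q]]) auto
      then show False using v emeasure_cube_eq[OF Q] by simp
    qed
    then obtain x0 where x0: "x0 \<in> Q" "frac_max 0 k x0 < \<infinity>" by blast
    have "frac_avg 0 k Q < \<infinity>" using frac_avg_le_frac_max[OF Q x0(1), of 0 k] x0(2) by order
    then obtain m where m: "frac_avg 0 k Q = ennreal m" "0 \<le> m" by (cases "frac_avg 0 k Q") auto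
    have Ik: "(\<integral>\<^sup>+ y \<in> Q. ennreal (k y) \<partial>lebesgue) = ennreal (?v * m)"
    proof -
      have "(\<integral>\<^sup>+ y \<in> Q. ennreal (k y) \<partial>lebesgue) = ennreal ?v * frac_avg 0 k Q"
        using v k0 unfolding frac_avg_def
        by (simp add: powr_minus mult.assoc[symmetric] ennreal_mult[symmetric])
      then show ?thesis using v m by (simp add: ennreal_mult)
    qed
    \<comment> \<open>Chosen so that the average of k is at most u^r; thus |h|/l has size about u on
      Q.\<close>
    define u where "u = C powr (1 / r) / D"
    have u: "0 < u" unfolding u_def using C D by simp
    have ur: "u powr r = C / D powr r" unfolding u_def using C D r by (simp add: powr_divide powr_powr)
    have mu: "m \<le> u powr r"
    proof (cases "m = 0")
      case False
      \<comment> \<open>The scale at which (1/w)^q = (m/C)^s. It is admissible for the indicator of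
        Q, so D \<le> w, which rearranges to m \<le> C / D^r.\<close>
      define w where "w = (C / m) powr (1 / r)"
      have m0: "0 < m" using False m by simp
      have w: "0 < w" unfolding w_def using C m0 by simp
      have "modular q (indicator Q) w \<le> modular s (\<lambda>x. enn2real (frac_max 0 k x)) C"
        unfolding modular_indicator[OF w] unfolding modular_def
      proof (rule nn_integral_mono_AE, use finM in \<open>rule eventually_mono\<close>)
        fix x assume fx: "frac_max 0 k x < \<infinity>"
        show "ennreal ((1 / w) powr q x) * indicator Q x \<le> ennreal ((\<bar>enn2real (frac_max 0 k x)\<bar> / C) powr s x)"
        proof (cases "x \<in> Q")
          case True
          have "1 / w = (m / C) powr (1 / r)" unfolding w_def using C m0 by (simp add: powr_divide)
          then have "(1 / w) powr q x = (m / C) powr s x" using r unfolding q by (simp add: powr_powr)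
          moreover have "m \<le> enn2real (frac_max 0 k x)"
            using enn2real_mono[OF frac_avg_le_frac_max[OF Q True, of 0 k]] fx m by simp
          then have "(m / C) powr s x \<le> (\<bar>enn2real (frac_max 0 k x)\<bar> / C) powr s x"
            using m0 C sD(3) by (intro powr_mono2 divide_right_mono) auto
          ultimately show ?thesis using True by (simp add: ennreal_leI)
        qed simp
      qed
      with modM have "modular q (indicator Q) w \<le> 1" by order
      then have "ennreal D \<le> ennreal w" unfolding D(1)[symmetric] using w by (intro Lvar_norm_leI)
      then have "D \<le> w" using w by (simp add: ennreal_le_iff)
      then have "D powr r \<le> w powr r" using D r by (intro powr_mono2) auto
      also have "\<dots> = C / m" unfolding w_def using r C m0 by (simp add: powr_powr)
      finally show ?thesis unfolding ur using m0 D C by (simp add: field_simps)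
    qed (use u in simp)
    \<comment> \<open>Stands in for Jensen's inequality: t is at most u when small, and otherwise t
      = t^(1-r) * t^r with t^(1-r) \<le> u^(1-r), because 1 - r is not positive.\<close>
    have pw: "\<bar>h y\<bar> \<le> l * (u + u powr (1 - r) * k y)" if "y \<in> Q" for y
    proof -
      let ?t = "\<bar>h y\<bar> / l"
      have ky: "k y = ?t powr r" unfolding k_def using that l by (simp add: abs_mult)
      have "?t \<le> u + u powr (1 - r) * ?t powr r"
      proof (cases "?t \<le> u")
        case False
        then have t: "0 < ?t" using u by linarith
        have "?t = ?t powr (1 - r) * ?t powr r" using t l by (simp add: powr_add[symmetric])
        also have "\<dots> \<le> u powr (1 - r) * ?t powr r"
          using False u r by (intro mult_right_mono powr_mono2') auto
        finally show ?thesis using u by linarith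
      qed (simp add: add_increasing2)
      then show ?thesis unfolding ky using l by (simp add: field_simps)
    qed
    have "(\<integral>\<^sup>+x \<in> Q. ennreal \<bar>h x\<bar> \<partial>lebesgue) \<le>
      (\<integral>\<^sup>+x. ennreal (l * u) * indicator Q x + ennreal (l * u powr (1 - r)) * (ennreal (k x) * indicator Q x) \<partial>lebesgue)"
    proof (rule nn_integral_mono)
      fix x
      show "ennreal \<bar>h x\<bar> * indicator Q x \<le> ennreal (l * u) * indicator Q x + ennreal (l * u powr (1 - r)) * (ennreal (k x) * indicator Q x)"
      proof (cases "x \<in> Q")
        case True
        have "l * (u + u powr (1 - r) * k x) = l * u + l * u powr (1 - r) * k x" by (simp add: distrib_left)
        with ennreal_leI[OF pw[OF True]] True show ?thesis
          using l u k0[of x] by (simp add: ennreal_plus ennreal_mult)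
      qed simp
    qed
    also have "\<dots> = ennreal (l * u) * emeasure lebesgue Q + ennreal (l * u powr (1 - r)) * (\<integral>\<^sup>+ y \<in> Q. ennreal (k y) \<partial>lebesgue)"
      by (simp add: nn_integral_add nn_integral_cmult nn_integral_cmult_indicator del: emeasure_completion)
    also have "\<dots> = ennreal (l * u * ?v + l * u powr (1 - r) * (?v * m))"
      unfolding Ik emeasure_cube_eq[OF Q] using l u v m by (simp add: ennreal_mult ennreal_plus)
    also have "\<dots> \<le> ennreal (4 * C powr (1 / r) * A * ?v)"
    proof (rule ennreal_leI)
      have "u powr (1 - r) * m \<le> u powr (1 - r) * u powr r" using mu by (intro mult_left_mono) auto
      also have "\<dots> = u" using u by (simp add: powr_add[symmetric])
      finally have "l * ?v * (u powr (1 - r) * m) \<le> l * ?v * u" using l v by (intro mult_left_mono) auto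
      then have "l * u * ?v + l * u powr (1 - r) * (?v * m) \<le> 2 * (l * ?v * u)" by (simp add: mult_ac)
      also have "\<dots> = 4 * C powr (1 / r) * A * ?v" unfolding l_def u_def using D by simp
      finally show "l * u * ?v + l * u powr (1 - r) * (?v * m) \<le> 4 * C powr (1 / r) * A * ?v" .
    qed
    finally show "(\<integral>\<^sup>+x \<in> Q. ennreal \<bar>h x\<bar> \<partial>lebesgue) \<le> ennreal (4 * C powr (1 / r) * A * ?v)" .
  qed
qed

section \<open>Integral bounds for the oscillation from condition (4) and from the
  commutator\<close>

lemma osc_fun_eq_frac_max:
  fixes b :: "'a::euclidean_space \<Rightarrow> real"
  assumes "cube Q" "\<alpha> \<le> real DIM('a)"
  shows "osc_fun \<alpha> b Q x * indicator Q x =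
    (b x - measure lebesgue Q powr (- \<alpha> / real DIM('a)) * enn2real (frac_max \<alpha> (\<lambda>y. b y * indicator Q y) x)) * indicator Q x"
  unfolding osc_fun_def using frac_max_loc_eq_frac_max[OF assms(1) _ assms(2), of x b] by (cases "x \<in> Q") auto

lemma osc_fun_measurable:
  fixes b :: "'a::euclidean_space \<Rightarrow> real"
  assumes "cube Q" "\<alpha> \<le> real DIM('a)" and [measurable]: "b \<in> borel_measurable lebesgue"
  shows "(\<lambda>x. osc_fun \<alpha> b Q x * indicator Q x) \<in> borel_measurable lebesgue"
proof -
  note [measurable] = cube_sets[OF assms(1)]
  show ?thesis unfolding osc_fun_eq_frac_max[OF assms(1,2)] by measurable
qed

text \<open>The common target of conditions (2) and (4): an L^1 bound in which the variable
  exponents no longer appear.\<close>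

lemma osc_fun_integral_bound:
  fixes b :: "'a::euclidean_space \<Rightarrow> real"
  assumes \<alpha>: "\<alpha> \<le> real DIM('a)" and b: "b \<in> borel_measurable lebesgue"
    and s: "s \<in> exps_B" "1 \<le> r" "\<And>x. q x = r * s x" and K: "0 < K"
    and N: "\<And>Q. cube Q \<Longrightarrow> Lvar_norm q (\<lambda>x. osc_fun \<alpha> b Q x * indicator Q x) \<le>
      ennreal (K * measure lebesgue Q powr (\<beta> / real DIM('a))) * Lvar_norm q (indicator Q)"
  shows "\<exists>C>0. \<forall>Q. cube Q \<longrightarrow> (\<integral>\<^sup>+x \<in> Q. ennreal \<bar>osc_fun \<alpha> b Q x\<bar> \<partial>lebesgue) \<le>
    ennreal (C * measure lebesgue Q powr (\<beta> / real DIM('a)) * measure lebesgue Q)"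
proof -
  obtain C where C: "0 < C" and CM: "\<And>Q h A. cube Q \<Longrightarrow> h \<in> borel_measurable lebesgue \<Longrightarrow> 0 < A \<Longrightarrow>
    Lvar_norm q (\<lambda>x. h x * indicator Q x) \<le> ennreal A * Lvar_norm q (indicator Q) \<Longrightarrow>
    (\<integral>\<^sup>+x \<in> Q. ennreal \<bar>h x\<bar> \<partial>lebesgue) \<le> ennreal (C * A * measure lebesgue Q)"
    using nn_integral_cube_le_of_norm_le[OF s] by blast
  show ?thesis
  proof (intro exI[of _ "C * K"] conjI allI impI)
    show "0 < C * K" using C K by simp
    fix Q :: "'a set" assume Q: "cube Q"
    let ?h = "\<lambda>x. osc_fun \<alpha> b Q x * indicator Q x"
    have v: "0 < measure lebesgue Q" by (rule measure_cube_pos[OF Q])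
    have "(\<lambda>x. ?h x * indicator Q x) = ?h" by (auto simp: indicator_def)
    then have "(\<integral>\<^sup>+x \<in> Q. ennreal \<bar>?h x\<bar> \<partial>lebesgue) \<le> ennreal (C * (K * measure lebesgue Q powr (\<beta> / real DIM('a))) * measure lebesgue Q)"
      using N[OF Q] K v by (intro CM Q osc_fun_measurable \<alpha> b) auto
    moreover have "(\<integral>\<^sup>+x \<in> Q. ennreal \<bar>?h x\<bar> \<partial>lebesgue) = (\<integral>\<^sup>+x \<in> Q. ennreal \<bar>osc_fun \<alpha> b Q x\<bar> \<partial>lebesgue)"
      by (intro nn_integral_cong) (auto simp: indicator_def)
    ultimately show "(\<integral>\<^sup>+x \<in> Q. ennreal \<bar>osc_fun \<alpha> b Q x\<bar> \<partial>lebesgue) \<le>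
      ennreal (C * K * measure lebesgue Q powr (\<beta> / real DIM('a)) * measure lebesgue Q)"
      by (simp add: mult.assoc)
  qed
qed

lemma osc_fun_integral_bound_of_osc_sup:
  fixes b :: "'a::euclidean_space \<Rightarrow> real"
  assumes \<alpha>: "\<alpha> \<le> real DIM('a)" and b: "b \<in> borel_measurable lebesgue"
    and s: "s \<in> exps_B" and fin: "osc_sup \<alpha> \<beta> b s < \<infinity>"
  shows "\<exists>C>0. \<forall>Q. cube Q \<longrightarrow> (\<integral>\<^sup>+x \<in> Q. ennreal \<bar>osc_fun \<alpha> b Q x\<bar> \<partial>lebesgue) \<le>
    ennreal (C * measure lebesgue Q powr (\<beta> / real DIM('a)) * measure lebesgue Q)"
proof -
  let ?n = "real DIM('a)"
  have sP: "s \<in> exps_P" using s unfolding exps_B_def by simp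
  obtain K0 where K0: "osc_sup \<alpha> \<beta> b s = ennreal K0" "0 \<le> K0" using fin by (cases "osc_sup \<alpha> \<beta> b s") auto
  define K where "K = K0 + 1"
  have K: "0 < K" "K0 \<le> K" unfolding K_def using K0 by auto
  show ?thesis
  proof (rule osc_fun_integral_bound[OF \<alpha> b s order_refl _ K(1)])
    show "s x = 1 * s x" for x by simp
    fix Q :: "'a set" assume Q: "cube Q"
    let ?v = "measure lebesgue Q"
    let ?N = "Lvar_norm s (\<lambda>x. osc_fun \<alpha> b Q x * indicator Q x)"
    have v: "0 < ?v" by (rule measure_cube_pos[OF Q])
    obtain D where D: "Lvar_norm s (indicator Q) = ennreal D" "0 < D"
      using cube_indicator_norm_pos[of Q s, OF Q exps_PD(2)[OF sP]] cube_indicator_norm_finite[of Q s, OF Q exps_PD(2)[OF sP]]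
      by (cases "Lvar_norm s (indicator Q)") auto
    have "ennreal (?v powr (- \<beta> / ?n)) * ?N / ennreal D \<le> osc_sup \<alpha> \<beta> b s"
      unfolding osc_sup_eq D(1)[symmetric] using Q by (intro SUP_upper) simp
    also have "\<dots> \<le> ennreal K" unfolding K0 using K by (intro ennreal_leI)
    finally have "ennreal D * (ennreal (?v powr (- \<beta> / ?n)) * ?N / ennreal D) \<le> ennreal D * ennreal K"
      by (rule mult_left_mono) simp
    then have "ennreal (?v powr (- \<beta> / ?n)) * ?N \<le> ennreal D * ennreal K"
      using D by (simp add: ennreal_times_divide ennreal_mult_divide_eq mult.commute[of "ennreal D"])
    then have "ennreal (?v powr (\<beta> / ?n)) * (ennreal (?v powr (- \<beta> / ?n)) * ?N) \<le> ennreal (?v powr (\<beta> / ?n)) * (ennreal D * ennreal K)"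
      by (rule mult_left_mono) simp
    then show "?N \<le> ennreal (K * ?v powr (\<beta> / ?n)) * Lvar_norm s (indicator Q)"
      unfolding D using v D K by (simp add: mult.assoc[symmetric] ennreal_mult[symmetric] powr_add[symmetric]) (simp add: mult_ac)
  qed
qed

text \<open>Hoelder's inequality with the exponents q and n/\<gamma>; the indicator of Q has norm
  |Q|^(\<gamma>/n) for the latter. Pointwise, (1/t)^p factors into powers of (1/l)^q and 1/|Q| whose
  exponents p/q and 1 - p/q add up to 1. Their sum has integral at most 2 over Q, which the extra
  factor 2 in the scale compensates as p \<ge> 1.\<close>

lemma indicator_norm_le:
  fixes p q :: "'a::euclidean_space \<Rightarrow> real"
  assumes pq: "(p, q) \<in> exps_Bgamma \<gamma>" and \<gamma>: "0 < \<gamma>" "\<gamma> < real DIM('a)" and Q: "cube Q"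
  shows "Lvar_norm p (indicator Q) \<le> ennreal (2 * measure lebesgue Q powr (\<gamma> / real DIM('a))) * Lvar_norm q (indicator Q)"
proof (rule Lvar_norm_le_cmult)
  let ?n = "real DIM('a)"
  let ?v = "measure lebesgue Q"
  note D = exps_BgammaD[OF pq \<gamma>]
  note P = exps_PD[OF D(1)]
  note [measurable] = P(1) D(5) cube_sets[OF Q]
  have v: "0 < ?v" by (rule measure_cube_pos[OF Q])
  then show "0 < 2 * ?v powr (\<gamma> / ?n)" by simp
  fix l :: real assume l: "0 < l" "modular q (indicat_real Q) l \<le> 1"
  define t where "t = ?v powr (\<gamma> / ?n) * l"
  have t: "0 < t" unfolding t_def using v l by simp
  have pw: "(1 / (2 * t)) powr p x \<le> 1 / 2 * ((1 / l) powr q x + 1 / ?v)" for x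
  proof -
    have q: "0 < q x" using D(4)[of x] by simp
    have p: "0 < p x" using P(2)[of x] by simp
    have e: "p x / q x + p x * (\<gamma> / ?n) = 1"
    proof -
      have "p x / q x + p x * (\<gamma> / ?n) = p x * (1 / q x + \<gamma> / ?n)" by (simp add: distrib_left)
      also have "\<dots> = 1" unfolding D(3) using p by simp
      finally show ?thesis .
    qed
    have "(1 / (2 * t)) powr p x = (1 / 2) powr p x * (1 / t) powr p x"
      using t by (simp add: powr_mult[symmetric])
    also have "\<dots> \<le> (1 / 2) powr 1 * (1 / t) powr p x"
      using P(2)[of x] by (intro mult_right_mono powr_mono') auto
    also have "(1 / t) powr p x = ((1 / l) powr q x) powr (p x / q x) * (1 / ?v) powr (p x * (\<gamma> / ?n))"
    proof -
      have "(1 / t) powr p x = (1 / l) powr p x * (1 / ?v powr (\<gamma> / ?n)) powr p x"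
        unfolding t_def using v l by (simp add: powr_mult[symmetric] mult.commute)
      also have "(1 / ?v powr (\<gamma> / ?n)) powr p x = (1 / ?v) powr (p x * (\<gamma> / ?n))"
        using v by (simp add: powr_divide powr_powr mult.commute)
      also have "(1 / l) powr p x = ((1 / l) powr q x) powr (p x / q x)"
        using q by (simp add: powr_powr)
      finally show ?thesis .
    qed
    also have "p x * (\<gamma> / ?n) = 1 - p x / q x" using e by simp
    also have "((1 / l) powr q x) powr (p x / q x) * (1 / ?v) powr (1 - p x / q x) \<le> (1 / l) powr q x + 1 / ?v"
    proof (rule powr_mult_powr_le_add)
      have "0 \<le> p x * (\<gamma> / ?n)" using p \<gamma> by simp
      then show "p x / q x \<le> 1" using e by simp
    qed (use v p q in auto)
    finally show ?thesis by (simp del: times_divide_eq_left)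
  qed
  have "modular p (indicator Q) (2 * t) \<le>
    (\<integral>\<^sup>+x. ennreal (1 / 2) * (ennreal ((1 / l) powr q x) * indicator Q x + ennreal (1 / ?v) * indicator Q x) \<partial>lebesgue)"
  proof (subst modular_indicator, use t in simp, rule nn_integral_mono)
    fix x
    have "ennreal (1 / 2 * ((1 / l) powr q x + 1 / ?v)) = ennreal (1 / 2) * (ennreal ((1 / l) powr q x) + ennreal (1 / ?v))"
      using v by (simp add: ennreal_mult ennreal_plus del: times_divide_eq_left)
    then have "ennreal ((1 / (2 * t)) powr p x) \<le> ennreal (1 / 2) * (ennreal ((1 / l) powr q x) + ennreal (1 / ?v))"
      using ennreal_leI[OF pw[of x]] by (rule ord_le_eq_trans[rotated])
    then show "ennreal ((1 / (2 * t)) powr p x) * indicator Q x \<le>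
      ennreal (1 / 2) * (ennreal ((1 / l) powr q x) * indicator Q x + ennreal (1 / ?v) * indicator Q x)"
      by (cases "x \<in> Q") auto
  qed
  also have "\<dots> = ennreal (1 / 2) * (modular q (indicator Q) l + ennreal (1 / ?v) * emeasure lebesgue Q)"
    unfolding modular_indicator[OF l(1)]
    by (simp add: nn_integral_add nn_integral_cmult nn_integral_cmult_indicator del: emeasure_completion)
  also have "\<dots> \<le> ennreal (1 / 2) * (1 + 1)"
    using l(2) v by (intro mult_left_mono add_mono) (auto simp: emeasure_cube_eq[OF Q] ennreal_mult[symmetric])
  also have "ennreal (1 / 2) * (1 + 1) = ennreal (1 / 2) * ennreal 2" by simp
  also have "\<dots> = 1" by (subst ennreal_mult[symmetric]) auto
  finally have "modular p (indicator Q) (2 * ?v powr (\<gamma> / ?n) * l) \<le> 1" unfolding t_def by (simp add: mult.assoc)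
  then show "Lvar_norm p (indicator Q) \<le> ennreal (2 * ?v powr (\<gamma> / ?n) * l)"
    using v l by (intro Lvar_norm_leI) auto
qed

text \<open>Inside Q both maximal functions localise to Q; for the constant 1 the supremum over
  subcubes is attained at Q because \<alpha> \<ge> 0.\<close>

lemma commutator_frac_max_indicator:
  fixes b :: "'a::euclidean_space \<Rightarrow> real"
  assumes Q: "cube Q" "x \<in> Q" and \<alpha>: "0 \<le> \<alpha>" "\<alpha> \<le> real DIM('a)"
  shows "commutator_frac_max b \<alpha> (indicator Q) x = measure lebesgue Q powr (\<alpha> / real DIM('a)) * osc_fun \<alpha> b Q x"
proof -
  let ?n = "real DIM('a)"
  let ?v = "measure lebesgue Q"
  have v: "0 < ?v" by (rule measure_cube_pos[OF Q(1)])
  have "frac_max \<alpha> (indicator Q) x = frac_max_loc \<alpha> Q (\<lambda>_. 1) x"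
    using frac_max_loc_eq_frac_max[OF Q \<alpha>(2), of "\<lambda>_. 1"] by simp
  also have "\<dots> = ennreal (?v powr (\<alpha> / ?n))"
  proof (rule antisym)
    show "frac_max_loc \<alpha> Q (\<lambda>_. 1) x \<le> ennreal (?v powr (\<alpha> / ?n))"
    proof (rule frac_max_loc_leI)
      fix P assume P: "cube P" "x \<in> P" "P \<subseteq> Q"
      have "measure lebesgue P \<le> ?v"
        using P(1,3) cube_sets lmeasurable_compact[OF compact_cube[OF Q(1)]] by (intro measure_mono_fmeasurable) auto
      then show "frac_avg \<alpha> (\<lambda>_. 1) P \<le> ennreal (?v powr (\<alpha> / ?n))"
        using P \<alpha> by (subst frac_avg_const) (auto intro!: ennreal_leI powr_mono2)
    qed
    show "ennreal (?v powr (\<alpha> / ?n)) \<le> frac_max_loc \<alpha> Q (\<lambda>_. 1) x"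
      using frac_avg_le_frac_max_loc[OF Q order_refl, of \<alpha> "\<lambda>_. 1"] frac_avg_const[OF Q(1), of 1 \<alpha>] by simp
  qed
  finally have 1: "frac_max \<alpha> (indicator Q) x = ennreal (?v powr (\<alpha> / ?n))" .
  have 2: "frac_max \<alpha> (\<lambda>y. b y * indicator Q y) x = frac_max_loc \<alpha> Q b x"
    using frac_max_loc_eq_frac_max[OF Q \<alpha>(2)] by simp
  have "?v powr (\<alpha> / ?n) * (?v powr (- \<alpha> / ?n) * z) = z" for z
    using v by (simp add: mult.assoc[symmetric] powr_add[symmetric])
  then show ?thesis unfolding commutator_frac_max_def 1 2 osc_fun_def by (simp add: right_diff_distrib mult.commute)
qed

text \<open>Testing on the indicator of Q, the powers of |Q| combine as -\<alpha> + (\<alpha> +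
  \<beta>) = \<beta>: the first comes from undoing the normalisation, the second from comparing the
  norms of the indicator in L^p and L^q.\<close>

lemma osc_fun_integral_bound_of_commutator:
  fixes b :: "'a::euclidean_space \<Rightarrow> real"
  assumes \<beta>: "0 < \<beta>" and \<alpha>: "0 < \<alpha>" and \<gamma>: "\<alpha> + \<beta> < real DIM('a)" and b: "b \<in> borel_measurable lebesgue"
    and pq: "(p, q) \<in> exps_Bgamma (\<alpha> + \<beta>)" and comm: "commutator_bounded b \<alpha> p q"
  shows "\<exists>C>0. \<forall>Q. cube Q \<longrightarrow> (\<integral>\<^sup>+x \<in> Q. ennreal \<bar>osc_fun \<alpha> b Q x\<bar> \<partial>lebesgue) \<le>
    ennreal (C * measure lebesgue Q powr (\<beta> / real DIM('a)) * measure lebesgue Q)"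
proof -
  let ?n = "real DIM('a)"
  have \<gamma>0: "0 < \<alpha> + \<beta>" and \<alpha>n: "\<alpha> \<le> ?n" using \<alpha> \<beta> \<gamma> by auto
  note D = exps_BgammaD[OF pq \<gamma>0 \<gamma>]
  obtain C0 where C0: "\<And>f. f \<in> Lvar p \<Longrightarrow> Lvar_norm q (commutator_frac_max b \<alpha> f) \<le> ennreal C0 * Lvar_norm p f"
    using comm unfolding commutator_bounded_def by blast
  define \<theta> where "\<theta> = 1 - (\<alpha> + \<beta>) / ?n"
  have \<theta>: "0 < \<theta>" "\<theta> \<le> 1" unfolding \<theta>_def using \<gamma> \<gamma>0 by (auto simp: field_simps)
  \<comment> \<open>The 2 is the constant of \<open>indicator_norm_le\<close>; the maximum guards
    against a bound \<open>C0\<close> that is not positive.\<close>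
  define K where "K = 2 * max C0 1"
  have K: "0 < K" unfolding K_def by simp
  show ?thesis
  proof (rule osc_fun_integral_bound[OF \<alpha>n b D(2), of "1 / \<theta>"])
    show "1 \<le> 1 / \<theta>" using \<theta> by simp
    show "q x = 1 / \<theta> * (q x * (1 - (\<alpha> + \<beta>) / ?n))" for x
      unfolding \<theta>_def[symmetric] using \<theta> by simp
    show "0 < K" by fact
    fix Q :: "'a set" assume Q: "cube Q"
    let ?v = "measure lebesgue Q"
    have v: "0 < ?v" by (rule measure_cube_pos[OF Q])
    define c where "c = ?v powr (- \<alpha> / ?n)"
    have c: "0 < c" unfolding c_def using v by simp
    let ?T = "commutator_frac_max b \<alpha> (indicator Q)"
    have "Lvar_norm q (\<lambda>x. osc_fun \<alpha> b Q x * indicator Q x) \<le> ennreal c * Lvar_norm q ?T"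
    proof (rule Lvar_norm_le_cmult[OF c])
      fix l :: real assume l: "0 < l" "modular q ?T l \<le> 1"
      have "\<bar>osc_fun \<alpha> b Q x * indicator Q x\<bar> \<le> \<bar>c * ?T x\<bar>" for x
      proof (cases "x \<in> Q")
        case True
        have "c * ?T x = (c * ?v powr (\<alpha> / ?n)) * osc_fun \<alpha> b Q x"
          using commutator_frac_max_indicator[OF Q True less_imp_le[OF \<alpha>] \<alpha>n, of b] by (simp add: mult.assoc)
        also have "c * ?v powr (\<alpha> / ?n) = 1" unfolding c_def using v by (simp add: powr_add[symmetric])
        finally show ?thesis using True by simp
      qed simp
      then have "modular q (\<lambda>x. osc_fun \<alpha> b Q x * indicator Q x) (c * l) \<le> modular q (\<lambda>x. c * ?T x) (c * l)"
        using c l D(4) by (intro modular_mono_AE) (auto intro: order_trans[OF zero_le_one])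
      also have "\<dots> = modular q ?T l" using c l(1) by (rule modular_cmult)
      also note l(2)
      finally show "Lvar_norm q (\<lambda>x. osc_fun \<alpha> b Q x * indicator Q x) \<le> ennreal (c * l)"
        using c l by (intro Lvar_norm_leI) auto
    qed
    also have "\<dots> \<le> ennreal c * (ennreal (max C0 1) * (ennreal (2 * ?v powr ((\<alpha> + \<beta>) / ?n)) * Lvar_norm q (indicator Q)))"
    proof (rule mult_left_mono)
      have "Lvar_norm q ?T \<le> ennreal C0 * Lvar_norm p (indicator Q)"
        by (rule C0[OF cube_indicator_Lvar[OF Q exps_PD(2)[OF D(1)]]])
      also have "\<dots> \<le> ennreal (max C0 1) * (ennreal (2 * ?v powr ((\<alpha> + \<beta>) / ?n)) * Lvar_norm q (indicator Q))"
        using indicator_norm_le[OF pq \<gamma>0 \<gamma> Q] by (intro mult_mono ennreal_leI) auto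
      finally show "Lvar_norm q ?T \<le> ennreal (max C0 1) * (ennreal (2 * ?v powr ((\<alpha> + \<beta>) / ?n)) * Lvar_norm q (indicator Q))" .
    qed simp
    also have "\<dots> = ennreal (c * max C0 1 * (2 * ?v powr ((\<alpha> + \<beta>) / ?n))) * Lvar_norm q (indicator Q)"
      using c by (simp add: mult.assoc[symmetric] ennreal_mult[symmetric])
    also have "c * max C0 1 * (2 * ?v powr ((\<alpha> + \<beta>) / ?n)) = K * ?v powr (\<beta> / ?n)"
    proof -
      have "c * ?v powr ((\<alpha> + \<beta>) / ?n) = ?v powr (\<beta> / ?n)"
        unfolding c_def using v by (simp add: powr_add[symmetric] add_divide_distrib)
      then show ?thesis unfolding K_def by (simp add: mult.assoc mult.left_commute)
    qed
    finally show "Lvar_norm q (\<lambda>x. osc_fun \<alpha> b Q x * indicator Q x) \<le>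
      ennreal (K * ?v powr (\<beta> / ?n)) * Lvar_norm q (indicator Q)" .
  qed
qed

subsection \<open>Campanato's characterisation of Hoelder continuity\<close>

text \<open>Cutting a cube into small dyadic subcubes gains an arbitrarily small factor \<open>(2 * d) powr \<epsilon>\<close>.\<close>

lemma nn_integral_cube_zero_of_higher_order:
  fixes h :: "'a::euclidean_space \<Rightarrow> ennreal"
  assumes [measurable]: "h \<in> borel_measurable lebesgue" and \<epsilon>: "0 < \<epsilon>" and C: "0 \<le> C"
    and bd: "\<And>Q. cube Q \<Longrightarrow> (\<integral>\<^sup>+x \<in> Q. h x \<partial>lebesgue) \<le> ennreal (C * measure lebesgue Q powr (\<epsilon> / real DIM('a)) * measure lebesgue Q)"
    and Q: "cube Q"
  shows "(\<integral>\<^sup>+x \<in> Q. h x \<partial>lebesgue) = 0"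
proof -
  obtain a l where l: "0 < l" "Q = cbox a (a + l *\<^sub>R One)" by (rule cubeE[OF Q])
  let ?v = "measure lebesgue Q"
  have small: "(\<integral>\<^sup>+x \<in> Q. h x \<partial>lebesgue) \<le> ennreal (C * ?v * (2 * d) powr \<epsilon>)" if d: "0 < d" for d
  proof -
    have ne: "box a (a + l *\<^sub>R One) \<noteq> {}" using l by (auto simp: box_ne_empty inner_simps)
    \<comment> \<open>For the constant gauge of radius d the covering lemma yields countably many
      nonoverlapping dyadic subcubes, each inside a ball of radius d.\<close>
    obtain \<D> where \<D>: "countable \<D>" "\<Union>\<D> \<subseteq> cbox a (a + l *\<^sub>R One)"
      "\<And>K. K \<in> \<D> \<Longrightarrow> interior K \<noteq> {} \<and> (\<exists>c d. K = cbox c d)"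
      "pairwise (\<lambda>A B. interior A \<inter> interior B = {}) \<D>"
      "\<And>K. K \<in> \<D> \<Longrightarrow> \<exists>x \<in> cbox a (a + l *\<^sub>R One) \<inter> K. K \<subseteq> ball x d"
      "\<And>u v. cbox u v \<in> \<D> \<Longrightarrow> \<exists>n. \<forall>i \<in> Basis. v \<bullet> i - u \<bullet> i = ((a + l *\<^sub>R One) \<bullet> i - a \<bullet> i) / 2^n"
      "cbox a (a + l *\<^sub>R One) \<subseteq> \<Union>\<D>"
      using covering_lemma[OF order_refl ne gauge_ball[OF d]] by blast
    have cubeD: "\<exists>c k. 0 < k \<and> k \<le> 2 * d \<and> K = cbox c (c + k *\<^sub>R One)" if K: "K \<in> \<D>" for K
    proof -
      obtain c e where ce: "K = cbox c e" using \<D>(3)[OF K] by blast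
      obtain n :: nat where n: "\<And>i. i \<in> Basis \<Longrightarrow> e \<bullet> i - c \<bullet> i = ((a + l *\<^sub>R One) \<bullet> i - a \<bullet> i) / 2^n"
        using \<D>(6)[of c e] K ce by blast
      define k where "k = l / 2 ^ n"
      have k: "0 < k" unfolding k_def using l by simp
      have "e \<bullet> i = (c + k *\<^sub>R One) \<bullet> i" if "i \<in> Basis" for i
        using n[OF that] that unfolding k_def by (simp add: inner_simps)
      then have e: "e = c + k *\<^sub>R One" by (rule euclidean_eqI)
      obtain x where x: "K \<subseteq> ball x d" using \<D>(5)[OF K] by blast
      have "c \<in> K" "e \<in> K" unfolding ce e mem_cube_cbox using k by (auto simp: inner_simps)
      with x have "dist x c < d" "dist x e < d" by (auto simp: subset_iff)
      then have "dist c e < 2 * d" by metric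
      then have "norm (k *\<^sub>R (One::'a)) \<le> 2 * d" unfolding e by (simp add: dist_norm)
      obtain i :: 'a where i: "i \<in> Basis" using nonempty_Basis by blast
      have "k = \<bar>(k *\<^sub>R (One::'a)) \<bullet> i\<bar>" using k i by simp
      also have "\<dots> \<le> norm (k *\<^sub>R (One::'a))" using i by (rule Basis_le_norm)
      also have "\<dots> \<le> 2 * d" by fact
      finally show ?thesis using k ce e by blast
    qed
    then have cD: "cube K" if "K \<in> \<D>" for K using that cubeI by blast
    define N where "N = density lebesgue h"
    have N: "emeasure N S = (\<integral>\<^sup>+x \<in> S. h x \<partial>lebesgue)" if "S \<in> sets lebesgue" for S
      unfolding N_def by (rule emeasure_density) (use that in measurable)
    have "(\<integral>\<^sup>+x \<in> Q. h x \<partial>lebesgue) = emeasure N Q" using cube_sets[OF Q] by (simp add: N)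
    also have "\<dots> \<le> emeasure N (\<Union>K\<in>\<D>. K)"
      using \<D>(1,7) cD cube_sets unfolding l(2) by (intro emeasure_mono) (auto simp: N_def intro!: sets.countable_UN'')
    also have "\<dots> \<le> (\<integral>\<^sup>+K. emeasure N K \<partial>count_space \<D>)"
      using \<D>(1) cD cube_sets by (intro emeasure_UN_countable_le) (auto simp: N_def)
    \<comment> \<open>Neighbouring subcubes share faces. Interiors are disjoint and have the same
      measure, so volumes are added over interiors.\<close>
    also have "\<dots> \<le> (\<integral>\<^sup>+K. ennreal (C * (2 * d) powr \<epsilon>) * emeasure lebesgue (interior K) \<partial>count_space \<D>)"
    proof (rule nn_integral_mono)
      fix K assume "K \<in> space (count_space \<D>)"
      then have K: "K \<in> \<D>" by simp
      obtain c k where k: "0 < k" "k \<le> 2 * d" "K = cbox c (c + k *\<^sub>R One)" using cubeD[OF K] by blast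
      have iK: "emeasure lebesgue (interior K) = ennreal (measure lebesgue K)"
        unfolding emeasure_cube_eq[OF cD[OF K], symmetric] unfolding k(3)
        by (simp add: interior_cbox emeasure_lborel_box_eq emeasure_lborel_cbox_eq)
      have "emeasure N K \<le> ennreal (C * measure lebesgue K powr (\<epsilon> / real DIM('a)) * measure lebesgue K)"
        using bd[OF cD[OF K]] cube_sets[OF cD[OF K]] by (simp add: N)
      also have "measure lebesgue K powr (\<epsilon> / real DIM('a)) = k powr \<epsilon>"
        unfolding k(3) using k(1) by (rule cube_side_powr)
      also have "ennreal (C * k powr \<epsilon> * measure lebesgue K) \<le> ennreal (C * (2 * d) powr \<epsilon> * measure lebesgue K)"
        using k C \<epsilon> by (intro ennreal_leI mult_right_mono mult_left_mono powr_mono2) auto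
      also have "\<dots> = ennreal (C * (2 * d) powr \<epsilon>) * emeasure lebesgue (interior K)"
        unfolding iK using C by (simp add: ennreal_mult)
      finally show "emeasure N K \<le> ennreal (C * (2 * d) powr \<epsilon>) * emeasure lebesgue (interior K)" .
    qed
    also have "\<dots> = ennreal (C * (2 * d) powr \<epsilon>) * (\<integral>\<^sup>+K. emeasure lebesgue (interior K) \<partial>count_space \<D>)"
      by (rule nn_integral_cmult) simp
    also have "(\<integral>\<^sup>+K. emeasure lebesgue (interior K) \<partial>count_space \<D>) = emeasure lebesgue (\<Union>K\<in>\<D>. interior K)"
      using \<D>(1,4) by (intro emeasure_UN_countable[symmetric]) (auto simp: disjoint_family_on_def pairwise_def)
    also have "ennreal (C * (2 * d) powr \<epsilon>) * \<dots> \<le> ennreal (C * (2 * d) powr \<epsilon>) * emeasure lebesgue Q"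
    proof (rule mult_left_mono)
      show "emeasure lebesgue (\<Union>K\<in>\<D>. interior K) \<le> emeasure lebesgue Q"
        using \<D>(2) cube_sets[OF Q] interior_subset unfolding l(2) by (intro emeasure_mono) blast+
    qed simp
    finally show ?thesis unfolding emeasure_cube_eq[OF Q] using C
      by (simp add: ennreal_mult[symmetric] mult_ac)
  qed
  have "((\<lambda>d. ennreal (C * ?v * (2 * d) powr \<epsilon>)) \<longlongrightarrow> ennreal (C * ?v * (2 * 0) powr \<epsilon>)) (at_right 0)"
    using \<epsilon> eventually_mono[OF eventually_at_right_less[of "0::real"] less_imp_le]
    by (intro tendsto_ennrealI tendsto_intros tendsto_powr') auto
  then have "(\<integral>\<^sup>+x \<in> Q. h x \<partial>lebesgue) \<le> ennreal (C * ?v * (2 * 0) powr \<epsilon>)"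
    by (rule tendsto_lowerbound) (auto intro!: eventually_mono[OF eventually_at_right_less] small)
  then show ?thesis by simp
qed

text \<open>Averages that vanish uniformly as cubes shrink force the function to vanish. It is
  applied to |b - g| for the representative g and to |b| - b.\<close>

lemma AE_zero_of_higher_order:
  fixes h :: "'a::euclidean_space \<Rightarrow> ennreal"
  assumes h[measurable]: "h \<in> borel_measurable lebesgue" and \<epsilon>: "0 < \<epsilon>" and C: "0 \<le> C"
    and bd: "\<And>Q. cube Q \<Longrightarrow> (\<integral>\<^sup>+x \<in> Q. h x \<partial>lebesgue) \<le> ennreal (C * measure lebesgue Q powr (\<epsilon> / real DIM('a)) * measure lebesgue Q)"
  shows "AE x in lebesgue. h x = 0"
proof -
  define Q where "Q k = cbox (- (real (Suc k)) *\<^sub>R (One::'a)) (- (real (Suc k)) *\<^sub>R One + (2 * real (Suc k)) *\<^sub>R One)" for k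
  have Q: "cube (Q k)" for k unfolding Q_def by (rule cubeI) simp
  have "AE x in lebesgue. h x * indicator (Q k) x = 0" for k
  proof -
    note [measurable] = cube_sets[OF Q[of k]]
    have "(\<integral>\<^sup>+x \<in> Q k. h x \<partial>lebesgue) = 0" by (rule nn_integral_cube_zero_of_higher_order[OF h \<epsilon> C bd Q])
    then show ?thesis by (subst (asm) nn_integral_0_iff_AE) auto
  qed
  then have "AE x in lebesgue. \<forall>k. h x * indicator (Q k) x = 0" unfolding AE_all_countable by blast
  then show ?thesis
  proof (rule eventually_mono)
    fix x assume *: "\<forall>k. h x * indicator (Q k) x = 0"
    obtain k :: nat where k: "norm x \<le> real k" using real_arch_simple by blast
    have "x \<in> Q k" unfolding Q_def mem_cube_cbox
    proof
      fix i :: 'a assume i: "i \<in> Basis"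
      have "- real k \<le> x \<bullet> i" "x \<bullet> i \<le> real k" using Basis_le_norm[OF i, of x] k by linarith+
      then show "(- (real (Suc k)) *\<^sub>R One) \<bullet> i \<le> x \<bullet> i \<and> x \<bullet> i \<le> (- (real (Suc k)) *\<^sub>R One) \<bullet> i + 2 * real (Suc k)"
        using i by (simp add: inner_simps)
    qed
    with *[rule_format, of k] show "h x = 0" by simp
  qed
qed

section \<open>Cube averages and the Hoelder continuous representative\<close>

definition cube_avg :: "('a::euclidean_space \<Rightarrow> real) \<Rightarrow> 'a set \<Rightarrow> real" where
  "cube_avg b Q = (LINT x:Q|lebesgue. b x) / measure lebesgue Q"

text \<open>The oscillation over the large cube is measured against the volume of the small one;
  this loses only a constant when the two are comparable.\<close>

lemma abs_cube_avg_diff_le: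
  fixes b :: "'a::euclidean_space \<Rightarrow> real"
  assumes b: "set_integrable lebesgue Q b" and Q: "cube Q" and P: "cube P" "P \<subseteq> Q" and A: "0 \<le> A"
    and bd: "(\<integral>\<^sup>+x \<in> Q. ennreal \<bar>b x - c\<bar> \<partial>lebesgue) \<le> ennreal (A * measure lebesgue P)"
  shows "\<bar>cube_avg b P - c\<bar> \<le> A"
proof -
  let ?v = "measure lebesgue P"
  have v: "0 < ?v" by (rule measure_cube_pos[OF P(1)])
  have ci: "set_integrable lebesgue P (\<lambda>_. c)"
    using cube_sets[OF P(1)] emeasure_cube_eq[OF P(1)] by (simp add: set_integrable_def)
  have bi: "set_integrable lebesgue P b" by (rule set_integrable_subset[OF b cube_sets[OF P(1)] P(2)])
  have "(LINT x:P|lebesgue. c) = c * ?v"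
    using cube_sets[OF P(1)] emeasure_cube_eq[OF P(1)] by (simp add: set_integral_const)
  then have "(LINT x:P|lebesgue. b x - c) = (LINT x:P|lebesgue. b x) - c * ?v"
    using set_integral_diff(2)[OF bi ci] by simp
  then have eq: "cube_avg b P - c = (LINT x:P|lebesgue. b x - c) / ?v"
    unfolding cube_avg_def using v by (simp add: field_simps)
  have di: "set_integrable lebesgue P (\<lambda>x. b x - c)" by (rule set_integral_diff(1)[OF bi ci])
  have "ennreal \<bar>LINT x:P|lebesgue. b x - c\<bar> \<le> (\<integral>\<^sup>+x. ennreal (norm (indicator P x *\<^sub>R (b x - c))) \<partial>lebesgue)"
    using integral_norm_bound_ennreal[OF di[unfolded set_integrable_def]] unfolding set_lebesgue_integral_def by simp
  also have "\<dots> \<le> (\<integral>\<^sup>+x \<in> Q. ennreal \<bar>b x - c\<bar> \<partial>lebesgue)"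
    using P(2) by (intro nn_integral_mono) (auto simp: indicator_def)
  also note bd
  finally have "\<bar>LINT x:P|lebesgue. b x - c\<bar> \<le> A * ?v" using A v by (simp add: ennreal_le_iff)
  then show ?thesis unfolding eq using v by (simp add: field_simps)
qed

text \<open>Averages over concentric cubes form a geometrically convergent sequence as the side is
  halved. Their limit g inherits the modulus of continuity from comparing cubes with nearby centres,
  and |b - g| has averages of order \<beta>, hence vanishes.\<close>

lemma lipschitz_beta_of_mean_oscillation:
  fixes b :: "'a::euclidean_space \<Rightarrow> real"
  assumes \<beta>: "0 < \<beta>" and li: "locally_integrable b" and C: "0 < C"
    and bd: "\<And>Q. cube Q \<Longrightarrow> (\<integral>\<^sup>+x \<in> Q. ennreal \<bar>b x - cube_avg b Q\<bar> \<partial>lebesgue) \<le>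
      ennreal (C * measure lebesgue Q powr (\<beta> / real DIM('a)) * measure lebesgue Q)"
  shows "lipschitz_beta \<beta> b"
proof -
  let ?n = "DIM('a)"
  have b[measurable]: "b \<in> borel_measurable lebesgue" and sint: "\<And>Q. cube Q \<Longrightarrow> set_integrable lebesgue Q b"
    using li compact_cube unfolding locally_integrable_def by blast+
  \<comment> \<open>The closed ball of radius r about x in the maximum norm; its side is 2 *
    r.\<close>
  define B where "B x r = cbox (x - r *\<^sub>R One) ((x - r *\<^sub>R One) + (2 * r) *\<^sub>R One)" for x :: 'a and r :: real
  have cB: "cube (B x r)" if "0 < r" for x r unfolding B_def using that by (intro cubeI) simp
  have memB: "y \<in> B x r \<longleftrightarrow> (\<forall>i\<in>Basis. \<bar>y \<bullet> i - x \<bullet> i\<bar> \<le> r)" for x y r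
    unfolding B_def mem_cube_cbox by (intro ball_cong refl) (auto simp: inner_simps)
  have vB: "measure lebesgue (B x r) = (2 * r) ^ ?n" if "0 < r" for x r
    unfolding B_def using that by (intro measure_cube_cbox) simp
  have pB: "measure lebesgue (B x r) powr (\<beta> / real ?n) = (2 * r) powr \<beta>" if "0 < r" for x r
    unfolding B_def using that by (intro cube_side_powr) simp
  define a where "a x r = cube_avg b (B x r)" for x r
  \<comment> \<open>The factor 2^n compares the volumes when r \<le> 2 * r', and 2^\<beta> comes
    from the side 2 * r.\<close>
  define c1 where "c1 = C * 2 ^ ?n * 2 powr \<beta>"
  have c1: "0 < c1" unfolding c1_def using C by simp
  have step: "\<bar>a y r' - a x r\<bar> \<le> c1 * r powr \<beta>" if r: "0 < r" "r \<le> 2 * r'" and sub: "B y r' \<subseteq> B x r" for x y r r'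
  proof -
    have r': "0 < r'" using r by simp
    show ?thesis unfolding a_def
    proof (rule abs_cube_avg_diff_le[OF sint[OF cB[OF r(1)]] cB[OF r(1)] cB[OF r'] sub])
      have "(\<integral>\<^sup>+z \<in> B x r. ennreal \<bar>b z - cube_avg b (B x r)\<bar> \<partial>lebesgue) \<le> ennreal (C * (2 * r) powr \<beta> * (2 * r) ^ ?n)"
        using bd[OF cB[OF r(1)], of x] unfolding pB[OF r(1)] unfolding vB[OF r(1)] .
      also have "\<dots> \<le> ennreal (c1 * r powr \<beta> * (2 * r') ^ ?n)"
      proof (rule ennreal_leI)
        have "(2 * r) ^ ?n \<le> (2 * (2 * r')) ^ ?n" using r by (intro power_mono) auto
        also have "\<dots> = 2 ^ ?n * (2 * r') ^ ?n" by (rule power_mult_distrib)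
        finally have "C * (2 * r) powr \<beta> * (2 * r) ^ ?n \<le> C * (2 * r) powr \<beta> * (2 ^ ?n * (2 * r') ^ ?n)"
          using C by (intro mult_left_mono) auto
        then show "C * (2 * r) powr \<beta> * (2 * r) ^ ?n \<le> c1 * r powr \<beta> * (2 * r') ^ ?n"
          unfolding c1_def using r by (simp add: powr_mult mult_ac)
      qed
      finally show "(\<integral>\<^sup>+z \<in> B x r. ennreal \<bar>b z - cube_avg b (B x r)\<bar> \<partial>lebesgue) \<le>
        ennreal (c1 * r powr \<beta> * measure lebesgue (B y r'))" unfolding vB[OF r'] .
    qed (use c1 in simp)
  qed
  have subB: "B x r' \<subseteq> B x r" if "r' \<le> r" for x r r' using that by (fastforce simp: memB)
  define q where "q = 2 powr (- \<beta>)"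
  have q: "0 < q" "q < 1" unfolding q_def using \<beta> by (auto simp: powr_minus_divide)
  \<comment> \<open>The sum of the geometric series with first term c1 and ratio 2^(-\<beta>); c1 +
    D * q = D is what closes the induction.\<close>
  define D where "D = c1 / (1 - q)"
  have D: "0 < D" "c1 + D * q = D" unfolding D_def using c1 q by (auto simp: field_simps)
  \<comment> \<open>Induction on the number j of halvings that bring the larger radius down to
    r'.\<close>
  have chain: "0 < r' \<Longrightarrow> r' \<le> r \<Longrightarrow> r \<le> 2 ^ j * r' \<Longrightarrow> \<bar>a x r' - a x r\<bar> \<le> D * r powr \<beta>" for x r r' and j :: nat
  proof (induction j arbitrary: r)
    case 0
    then have "r = r'" by simp
    then show ?case using D by simp
  next
    case (Suc j)
    show ?case
    proof (cases "r \<le> 2 * r'")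
      case True
      have "c1 \<le> D" using D c1 q mult_nonneg_nonneg[of D q] by linarith
      then have "c1 * r powr \<beta> \<le> D * r powr \<beta>" by (intro mult_right_mono) auto
      moreover have "\<bar>a x r' - a x r\<bar> \<le> c1 * r powr \<beta>" using Suc.prems True by (intro step subB) auto
      ultimately show ?thesis by linarith
    next
      case False
      have "\<bar>a x (r / 2) - a x r\<bar> \<le> c1 * r powr \<beta>" using Suc.prems by (intro step subB) auto
      moreover have "\<bar>a x r' - a x (r / 2)\<bar> \<le> D * (r / 2) powr \<beta>"
        using Suc.prems False by (intro Suc.IH) auto
      moreover have "D * (r / 2) powr \<beta> = D * q * r powr \<beta>"
        unfolding q_def using Suc.prems by (simp add: powr_divide powr_minus_divide)
      moreover have "c1 * r powr \<beta> + D * q * r powr \<beta> = D * r powr \<beta>" using D(2) by (metis distrib_right)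
      ultimately show ?thesis by linarith
    qed
  qed
  have all: "\<bar>a x r' - a x r\<bar> \<le> D * r powr \<beta>" if "0 < r'" "r' \<le> r" for x r r'
  proof -
    obtain j :: nat where "r / r' < 2 ^ j" using real_arch_pow[of 2 "r / r'"] by auto
    then have "r \<le> 2 ^ j * r'" using that by (simp add: field_simps)
    then show ?thesis using chain that by blast
  qed
  text \<open>The supremum plays the role of the limit of the averages as \<open>r\<close> tends to 0.\<close>
  define g where "g x = (SUP r\<in>{0<..}. a x r - D * r powr \<beta>)" for x
  \<comment> \<open>The intervals of radius D * r^\<beta> about a x r meet pairwise, so the supremum
    of their left endpoints lies in all of them.\<close>
  have comp: "a x r' - D * r' powr \<beta> \<le> a x r + D * r powr \<beta>" if "0 < r" "0 < r'" for x r r'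
  proof (cases "r' \<le> r")
    case True
    have "0 \<le> D * r' powr \<beta>" using D by simp
    then show ?thesis using all[OF that(2) True, of x] by linarith
  next
    case False
    have "0 \<le> D * r powr \<beta>" using D by simp
    then show ?thesis using all[OF that(1), of r' x] False by linarith
  qed
  have ga: "\<bar>g x - a x r\<bar> \<le> D * r powr \<beta>" if r: "0 < r" for x r
  proof -
    have "g x \<le> a x r + D * r powr \<beta>"
      unfolding g_def using comp[OF r] by (intro cSUP_least) auto
    moreover have "a x r - D * r powr \<beta> \<le> g x"
      unfolding g_def using comp[OF r, of _ x] r by (intro cSUP_upper bdd_aboveI2[of _ _ "a x r + D * r powr \<beta>"]) auto
    ultimately show ?thesis by linarith
  qed
  \<comment> \<open>Two passages from g to averages at radius r = |x - y| give 2 * D. Comparing both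
    averages with the cube of radius 2 * r about x, which contains the one about y, gives the
    rest.\<close>
  define L where "L = 2 * D + (c1 + D) * 2 powr \<beta>"
  have L: "0 < L" unfolding L_def using D c1 by (simp add: add_pos_pos)
  have hol: "\<bar>g x - g y\<bar> \<le> L * norm (x - y) powr \<beta>" for x y
  proof (cases "x = y")
    case False
    define r where "r = norm (x - y)"
    have r: "0 < r" unfolding r_def using False by simp
    have "B y r \<subseteq> B x (2 * r)"
    proof
      fix z assume z: "z \<in> B y r"
      show "z \<in> B x (2 * r)" unfolding memB
      proof
        fix i :: 'a assume i: "i \<in> Basis"
        have "\<bar>z \<bullet> i - y \<bullet> i\<bar> \<le> r" using z i unfolding memB by blast
        moreover have "\<bar>x \<bullet> i - y \<bullet> i\<bar> \<le> r" using Basis_le_norm[OF i, of "x - y"] unfolding r_def by (simp add: inner_diff_left)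
        ultimately show "\<bar>z \<bullet> i - x \<bullet> i\<bar> \<le> 2 * r" by linarith
      qed
    qed
    then have 1: "\<bar>a y r - a x (2 * r)\<bar> \<le> c1 * (2 * r) powr \<beta>" using r by (intro step) auto
    have 2: "\<bar>a x r - a x (2 * r)\<bar> \<le> D * (2 * r) powr \<beta>" using r by (intro all) auto
    have "\<bar>g x - g y\<bar> \<le> 2 * (D * r powr \<beta>) + (c1 + D) * (2 * r) powr \<beta>"
      using 1 2 ga[OF r, of x] ga[OF r, of y] unfolding distrib_right by linarith
    also have "\<dots> = L * r powr \<beta>" unfolding L_def using r by (simp add: powr_mult algebra_simps)
    finally show ?thesis unfolding r_def .
  qed (use L in simp)
  have g[measurable]: "g \<in> borel_measurable lebesgue" using hol \<beta> by (rule holder_lebesgue_measurable)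
  define M where "M = C + (L * real ?n powr \<beta> + D)"
  have "AE x in lebesgue. ennreal \<bar>b x - g x\<bar> = 0"
  proof (rule AE_zero_of_higher_order[OF _ \<beta>])
    show "0 \<le> M" unfolding M_def using C L D by simp
    fix Q :: "'a set" assume Q: "cube Q"
    note [measurable] = cube_sets[OF Q]
    obtain u l where l: "0 < l" "Q = cbox u (u + l *\<^sub>R One)" by (rule cubeE[OF Q])
    define z where "z = u + (l / 2) *\<^sub>R One"
    let ?v = "measure lebesgue Q"
    let ?w = "?v powr (\<beta> / real ?n)"
    have QB: "Q = B z (l / 2)" unfolding l(2) B_def z_def by simp
    have lw: "(l / 2) powr \<beta> \<le> ?w"
      unfolding l(2) cube_side_powr[OF l(1)] using l \<beta> by (intro powr_mono2) auto
    have zQ: "z \<in> Q" unfolding QB memB using l by simp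
    have near: "\<bar>cube_avg b Q - g x\<bar> \<le> (L * real ?n powr \<beta> + D) * ?w" if "x \<in> Q" for x
    proof -
      have "\<bar>g x - g z\<bar> \<le> L * real ?n powr \<beta> * ?w"
        using hol L \<beta> Q that zQ by (intro holder_on_cube) auto
      moreover have "\<bar>g z - cube_avg b Q\<bar> \<le> D * (l / 2) powr \<beta>"
        using ga[of "l / 2" z] l unfolding a_def QB[symmetric] by simp
      moreover have "D * (l / 2) powr \<beta> \<le> D * ?w" using lw D by (intro mult_left_mono) auto
      ultimately show ?thesis unfolding distrib_right by linarith
    qed
    have c0: "0 \<le> (L * real ?n powr \<beta> + D) * ?w" using L D by simp
    have "(\<integral>\<^sup>+x \<in> Q. ennreal \<bar>b x - g x\<bar> \<partial>lebesgue) \<le>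
      (\<integral>\<^sup>+x. ennreal \<bar>b x - cube_avg b Q\<bar> * indicator Q x + ennreal ((L * real ?n powr \<beta> + D) * ?w) * indicator Q x \<partial>lebesgue)"
    proof (rule nn_integral_mono)
      fix x
      show "ennreal \<bar>b x - g x\<bar> * indicator Q x \<le>
        ennreal \<bar>b x - cube_avg b Q\<bar> * indicator Q x + ennreal ((L * real ?n powr \<beta> + D) * ?w) * indicator Q x"
      proof (cases "x \<in> Q")
        case True
        have "\<bar>b x - g x\<bar> \<le> \<bar>b x - cube_avg b Q\<bar> + (L * real ?n powr \<beta> + D) * ?w" using near[OF True] by linarith
        from ennreal_leI[OF this] True c0 show ?thesis by (simp add: ennreal_plus)
      qed simp
    qed
    also have "\<dots> = (\<integral>\<^sup>+x \<in> Q. ennreal \<bar>b x - cube_avg b Q\<bar> \<partial>lebesgue) + ennreal ((L * real ?n powr \<beta> + D) * ?w) * emeasure lebesgue Q"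
      by (simp add: nn_integral_add nn_integral_cmult_indicator del: emeasure_completion)
    also have "\<dots> \<le> ennreal (C * ?w * ?v) + ennreal ((L * real ?n powr \<beta> + D) * ?w) * ennreal ?v"
      unfolding emeasure_cube_eq[OF Q] using bd[OF Q] by (rule add_right_mono)
    also have "\<dots> = ennreal (C * ?w * ?v) + ennreal ((L * real ?n powr \<beta> + D) * ?w * ?v)"
      using c0 by (subst ennreal_mult) auto
    also have "\<dots> = ennreal (C * ?w * ?v + (L * real ?n powr \<beta> + D) * ?w * ?v)"
      using C L D by (intro ennreal_plus[symmetric] mult_nonneg_nonneg) auto
    also have "C * ?w * ?v + (L * real ?n powr \<beta> + D) * ?w * ?v = M * ?w * ?v"
      unfolding M_def by (simp add: algebra_simps)
    finally show "(\<integral>\<^sup>+x \<in> Q. ennreal \<bar>b x - g x\<bar> \<partial>lebesgue) \<le> ennreal (M * ?w * ?v)" .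
  qed measurable
  then have "AE x in lebesgue. b x = g x" by (rule eventually_mono) simp
  then show ?thesis unfolding lipschitz_beta_def using hol by blast
qed

subsection \<open>The equivalence\<close>

lemma set_nn_integral_eq_LINT:
  assumes "set_integrable M A f" "\<And>x. 0 \<le> f x"
  shows "(\<integral>\<^sup>+x \<in> A. ennreal (f x) \<partial>M) = ennreal (LINT x:A|M. f x)"
proof -
  have "(\<integral>\<^sup>+x \<in> A. ennreal (f x) \<partial>M) = (\<integral>\<^sup>+x. ennreal (indicator A x *\<^sub>R f x) \<partial>M)"
    by (intro nn_integral_cong) (auto simp: indicator_def)
  also have "\<dots> = ennreal (LINT x:A|M. f x)"
    using assms unfolding set_integrable_def set_lebesgue_integral_def
    by (intro nn_integral_eq_integral) auto
  finally show ?thesis .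
qed

text \<open>Where the local maximal function is infinite, \<open>osc_fun\<close> collapses to b
  because of \<open>enn2real\<close>, and the lower bound by the mean would be lost. For subcubes of
  Q the order \<alpha> costs at most the factor |Q|^(\<alpha>/n), so finiteness follows from order
  0.\<close>

lemma frac_max_loc_finite_AE:
  fixes b :: "'a::euclidean_space \<Rightarrow> real"
  assumes li: "locally_integrable b" and Q: "cube Q" and \<alpha>: "0 \<le> \<alpha>" "\<alpha> \<le> real DIM('a)"
  shows "AE x in lebesgue. x \<in> Q \<longrightarrow> frac_max_loc \<alpha> Q b x < \<infinity>"
proof -
  let ?v = "measure lebesgue Q"
  have b[measurable]: "b \<in> borel_measurable lebesgue" and int: "set_integrable lebesgue Q b"
    using li compact_cube[OF Q] unfolding locally_integrable_def by blast+
  note [measurable] = cube_sets[OF Q]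
  have "(\<integral>\<^sup>+x. ennreal \<bar>b x * indicator Q x\<bar> \<partial>lebesgue) < \<infinity>"
    using int unfolding set_integrable_def integrable_iff_bounded by (simp add: mult.commute)
  then have "AE x in lebesgue. frac_max 0 (\<lambda>y. b y * indicator Q y) x < \<infinity>"
    by (intro frac_max_0_finite_AE) auto
  then show ?thesis
  proof (rule eventually_mono, intro impI)
    fix x assume fin: "frac_max 0 (\<lambda>y. b y * indicator Q y) x < \<infinity>" and x: "x \<in> Q"
    have "frac_max_loc \<alpha> Q b x \<le> ennreal (?v powr (\<alpha> / real DIM('a))) * frac_max_loc 0 Q b x"
    proof (rule frac_max_loc_leI)
      fix P assume P: "cube P" "x \<in> P" "P \<subseteq> Q"
      have "measure lebesgue P \<le> ?v"
        using P(1,3) cube_sets lmeasurable_compact[OF compact_cube[OF Q]] by (intro measure_mono_fmeasurable) auto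
      then have "measure lebesgue P powr (\<alpha> / real DIM('a)) \<le> ?v powr (\<alpha> / real DIM('a))"
        using \<alpha> by (intro powr_mono2) auto
      then have "ennreal (measure lebesgue P powr (\<alpha> / real DIM('a))) * frac_avg 0 b P \<le>
          ennreal (?v powr (\<alpha> / real DIM('a))) * frac_max_loc 0 Q b x"
        using P by (intro mult_mono ennreal_leI frac_avg_le_frac_max_loc) auto
      then show "frac_avg \<alpha> b P \<le> ennreal (?v powr (\<alpha> / real DIM('a))) * frac_max_loc 0 Q b x"
        unfolding frac_avg_shift_order[OF P(1)] by simp
    qed
    also have "\<dots> < \<infinity>"
      using fin unfolding frac_max_loc_eq_frac_max[OF Q x of_nat_0_le_iff] by (simp add: ennreal_mult_less_top)
    finally show "frac_max_loc \<alpha> Q b x < \<infinity>" .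
  qed
qed

text \<open>Q itself competes in the supremum at each of its points, and its normalised average is
  the mean of |b|.\<close>

lemma abs_avg_minus_le_osc_fun:
  fixes b :: "'a::euclidean_space \<Rightarrow> real"
  assumes b: "b \<in> borel_measurable lebesgue" "set_integrable lebesgue Q b" and Q: "cube Q" "x \<in> Q"
    and fin: "frac_max_loc \<alpha> Q b x < \<infinity>"
  shows "cube_avg (\<lambda>x. \<bar>b x\<bar>) Q - b x \<le> \<bar>osc_fun \<alpha> b Q x\<bar>"
proof -
  let ?n = "real DIM('a)"
  let ?v = "measure lebesgue Q"
  have v: "0 < ?v" by (rule measure_cube_pos[OF Q(1)])
  have "set_integrable lebesgue Q (\<lambda>x. \<bar>b x\<bar>)" using b(2) by (rule set_integrable_abs)
  then have "(\<integral>\<^sup>+ y \<in> Q. ennreal \<bar>b y\<bar> \<partial>lebesgue) = ennreal (LINT y:Q|lebesgue. \<bar>b y\<bar>)"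
    by (intro set_nn_integral_eq_LINT) auto
  also have "(LINT y:Q|lebesgue. \<bar>b y\<bar>) = ?v * cube_avg (\<lambda>x. \<bar>b x\<bar>) Q"
    unfolding cube_avg_def using v by simp
  finally have I: "(\<integral>\<^sup>+ y \<in> Q. ennreal \<bar>b y\<bar> \<partial>lebesgue) = ennreal (?v * cube_avg (\<lambda>x. \<bar>b x\<bar>) Q)" .
  have a0: "0 \<le> cube_avg (\<lambda>x. \<bar>b x\<bar>) Q"
    unfolding cube_avg_def set_lebesgue_integral_def by (intro divide_nonneg_nonneg integral_nonneg_AE) (auto simp: indicator_def)
  have "frac_avg \<alpha> b Q = ennreal (?v powr (\<alpha> / ?n) * cube_avg (\<lambda>x. \<bar>b x\<bar>) Q)"
    unfolding frac_avg_def I using v a0 by (simp add: ennreal_mult[symmetric] powr_diff)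
  then have "ennreal (?v powr (\<alpha> / ?n) * cube_avg (\<lambda>x. \<bar>b x\<bar>) Q) \<le> frac_max_loc \<alpha> Q b x"
    using frac_avg_le_frac_max_loc[OF Q order_refl, of \<alpha> b] by simp
  from enn2real_mono[OF this] fin a0
  have "?v powr (\<alpha> / ?n) * cube_avg (\<lambda>x. \<bar>b x\<bar>) Q \<le> enn2real (frac_max_loc \<alpha> Q b x)" by simp
  then have "?v powr (- \<alpha> / ?n) * (?v powr (\<alpha> / ?n) * cube_avg (\<lambda>x. \<bar>b x\<bar>) Q) \<le> ?v powr (- \<alpha> / ?n) * enn2real (frac_max_loc \<alpha> Q b x)"
    by (rule mult_left_mono) simp
  then have "cube_avg (\<lambda>x. \<bar>b x\<bar>) Q \<le> ?v powr (- \<alpha> / ?n) * enn2real (frac_max_loc \<alpha> Q b x)"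
    using v by (simp add: mult.assoc[symmetric] powr_add[symmetric])
  then show ?thesis unfolding osc_fun_def by linarith
qed

text \<open>As \<open>cube_avg b Q \<le> cube_avg \<bar>b\<bar> Q\<close>, \<open>osc_fun\<close> controls the part of the oscillation where \<open>b\<close> lies
  below its mean, which is half of the mean oscillation.\<close>

lemma mean_oscillation_of_osc_fun:
  fixes b :: "'a::euclidean_space \<Rightarrow> real"
  assumes li: "locally_integrable b" and \<alpha>: "0 \<le> \<alpha>" "\<alpha> \<le> real DIM('a)" and Q: "cube Q" and A: "0 \<le> A"
    and bd: "(\<integral>\<^sup>+x \<in> Q. ennreal \<bar>osc_fun \<alpha> b Q x\<bar> \<partial>lebesgue) \<le> ennreal A"
  shows "(\<integral>\<^sup>+x \<in> Q. ennreal \<bar>b x - cube_avg b Q\<bar> \<partial>lebesgue) \<le> ennreal (2 * A)"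
    and "(\<integral>\<^sup>+x \<in> Q. ennreal (\<bar>b x\<bar> - b x) \<partial>lebesgue) \<le> ennreal A"
proof -
  let ?v = "measure lebesgue Q"
  have v: "0 < ?v" by (rule measure_cube_pos[OF Q])
  have b[measurable]: "b \<in> borel_measurable lebesgue" and int: "set_integrable lebesgue Q b"
    using li compact_cube[OF Q] unfolding locally_integrable_def by blast+
  note [measurable] = cube_sets[OF Q]
  have absint: "set_integrable lebesgue Q (\<lambda>x. \<bar>b x\<bar>)" using int by (rule set_integrable_abs)
  have cint: "set_integrable lebesgue Q (\<lambda>_. c)" "(LINT x:Q|lebesgue. c) = c * ?v" for c :: real
    using cube_sets[OF Q] emeasure_cube_eq[OF Q] by (simp_all add: set_integrable_def set_integral_const)
  define m M where "m = cube_avg b Q" and "M = cube_avg (\<lambda>x. \<bar>b x\<bar>) Q"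
  have Im: "(LINT x:Q|lebesgue. b x) = m * ?v" and IM: "(LINT x:Q|lebesgue. \<bar>b x\<bar>) = M * ?v"
    unfolding m_def M_def cube_avg_def using v by simp_all
  have "(LINT x:Q|lebesgue. b x) \<le> (LINT x:Q|lebesgue. \<bar>b x\<bar>)" using int absint by (rule set_integral_mono) simp
  then have mM: "m \<le> M" unfolding Im IM using v by simp
  have pint: "set_integrable lebesgue Q (\<lambda>x. max 0 (M - b x))"
  proof -
    have "set_integrable lebesgue Q (\<lambda>x. M - b x)" using cint int by (intro set_integral_diff)
    from set_integral_add(1)[OF this set_integrable_abs[OF this]]
    have "set_integrable lebesgue Q (\<lambda>x. (1 / 2) * ((M - b x) + \<bar>M - b x\<bar>))" by (intro set_integrable_mult_right)
    moreover have "(\<lambda>x. (1 / 2) * ((M - b x) + \<bar>M - b x\<bar>)) = (\<lambda>x. max 0 (M - b x))" by (auto simp: max_def)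
    ultimately show ?thesis by (simp only:)
  qed
  have "(\<integral>\<^sup>+x \<in> Q. ennreal (max 0 (M - b x)) \<partial>lebesgue) \<le> (\<integral>\<^sup>+x \<in> Q. ennreal \<bar>osc_fun \<alpha> b Q x\<bar> \<partial>lebesgue)"
  proof (rule nn_integral_mono_AE, use frac_max_loc_finite_AE[OF li Q \<alpha>] in \<open>rule eventually_mono\<close>)
    fix x assume "x \<in> Q \<longrightarrow> frac_max_loc \<alpha> Q b x < \<infinity>"
    then show "ennreal (max 0 (M - b x)) * indicator Q x \<le> ennreal \<bar>osc_fun \<alpha> b Q x\<bar> * indicator Q x"
      using abs_avg_minus_le_osc_fun[OF b int Q, of x \<alpha>] unfolding M_def
      by (cases "x \<in> Q") (auto intro!: ennreal_leI)
  qed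
  also note bd
  also have "(\<integral>\<^sup>+x \<in> Q. ennreal (max 0 (M - b x)) \<partial>lebesgue) = ennreal (LINT x:Q|lebesgue. max 0 (M - b x))"
    using pint by (intro set_nn_integral_eq_LINT) auto
  finally have P: "(LINT x:Q|lebesgue. max 0 (M - b x)) \<le> A" using A by (simp add: ennreal_le_iff)
  \<comment> \<open>The left side is the integral of |b| - b over Q, so the bound that follows also
    gives the second claim.\<close>
  have "(LINT x:Q|lebesgue. M - b x) \<le> (LINT x:Q|lebesgue. max 0 (M - b x))"
    using set_integral_diff(1)[OF cint(1) int] pint by (rule set_integral_mono) simp
  then have MA: "(M - m) * ?v \<le> A"
    using P set_integral_diff(2)[OF cint(1) int, of M] cint(2)[of M] Im by (simp add: left_diff_distrib)
  have oint: "set_integrable lebesgue Q (\<lambda>x. \<bar>b x - m\<bar>)"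
    using int cint by (intro set_integrable_abs set_integral_diff)
  have dint: "set_integrable lebesgue Q (\<lambda>x. 2 * max 0 (M - b x) + (b x - m))"
    using pint int cint by (intro set_integral_add set_integrable_mult_right set_integral_diff) auto
  have "(LINT x:Q|lebesgue. \<bar>b x - m\<bar>) \<le> (LINT x:Q|lebesgue. 2 * max 0 (M - b x) + (b x - m))"
    using oint dint
  proof (rule set_integral_mono)
    \<comment> \<open>As m \<le> M, the deficit of b below m is at most its deficit below M; the
      term b - m integrates to 0 over Q.\<close>
    show "\<bar>b x - m\<bar> \<le> 2 * max 0 (M - b x) + (b x - m)" for x
      using mM by (cases "M \<le> b x"; cases "m \<le> b x") (simp_all add: max_def)
  qed
  also have "\<dots> = 2 * (LINT x:Q|lebesgue. max 0 (M - b x)) + ((LINT x:Q|lebesgue. b x) - (LINT x:Q|lebesgue. m))"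
    using pint int cint by (subst set_integral_add(2)) (auto simp: set_integral_diff)
  also have "\<dots> \<le> 2 * A" using P Im cint(2)[of m] by simp
  finally have "(LINT x:Q|lebesgue. \<bar>b x - m\<bar>) \<le> 2 * A" .
  moreover have "(\<integral>\<^sup>+x \<in> Q. ennreal \<bar>b x - m\<bar> \<partial>lebesgue) = ennreal (LINT x:Q|lebesgue. \<bar>b x - m\<bar>)"
    using oint by (intro set_nn_integral_eq_LINT) auto
  ultimately show "(\<integral>\<^sup>+x \<in> Q. ennreal \<bar>b x - cube_avg b Q\<bar> \<partial>lebesgue) \<le> ennreal (2 * A)"
    unfolding m_def[symmetric] by (simp add: ennreal_leI)
  have nint: "set_integrable lebesgue Q (\<lambda>x. \<bar>b x\<bar> - b x)" using absint int by (intro set_integral_diff)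
  have "(\<integral>\<^sup>+x \<in> Q. ennreal (\<bar>b x\<bar> - b x) \<partial>lebesgue) = ennreal (LINT x:Q|lebesgue. \<bar>b x\<bar> - b x)"
    using nint by (intro set_nn_integral_eq_LINT) auto
  also have "(LINT x:Q|lebesgue. \<bar>b x\<bar> - b x) = (M - m) * ?v"
    using set_integral_diff(2)[OF absint int] unfolding Im IM by (simp add: left_diff_distrib)
  finally show "(\<integral>\<^sup>+x \<in> Q. ennreal (\<bar>b x\<bar> - b x) \<partial>lebesgue) \<le> ennreal A"
    using MA by (simp add: ennreal_leI)
qed

lemma lipschitz_nonneg_of_osc_fun_bound:
  fixes b :: "'a::euclidean_space \<Rightarrow> real"
  assumes \<beta>: "0 < \<beta>" and li: "locally_integrable b" and \<alpha>: "0 \<le> \<alpha>" "\<alpha> \<le> real DIM('a)"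
    and bd: "\<exists>C>0. \<forall>Q. cube Q \<longrightarrow> (\<integral>\<^sup>+x \<in> Q. ennreal \<bar>osc_fun \<alpha> b Q x\<bar> \<partial>lebesgue) \<le>
      ennreal (C * measure lebesgue Q powr (\<beta> / real DIM('a)) * measure lebesgue Q)"
  shows "lipschitz_beta \<beta> b \<and> (AE x in lebesgue. 0 \<le> b x)"
proof
  obtain C where C: "0 < C" and CQ: "\<And>Q. cube Q \<Longrightarrow> (\<integral>\<^sup>+x \<in> Q. ennreal \<bar>osc_fun \<alpha> b Q x\<bar> \<partial>lebesgue) \<le>
      ennreal (C * measure lebesgue Q powr (\<beta> / real DIM('a)) * measure lebesgue Q)"
    using bd by blast
  have [measurable]: "b \<in> borel_measurable lebesgue" using li unfolding locally_integrable_def by blast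
  have nn: "0 \<le> C * measure lebesgue Q powr (\<beta> / real DIM('a)) * measure lebesgue Q" for Q :: "'a set"
    using C by simp
  show "lipschitz_beta \<beta> b"
  proof (rule lipschitz_beta_of_mean_oscillation[OF \<beta> li, of "2 * C"])
    show "0 < 2 * C" using C by simp
    fix Q :: "'a set" assume Q: "cube Q"
    show "(\<integral>\<^sup>+x \<in> Q. ennreal \<bar>b x - cube_avg b Q\<bar> \<partial>lebesgue) \<le>
      ennreal (2 * C * measure lebesgue Q powr (\<beta> / real DIM('a)) * measure lebesgue Q)"
      using mean_oscillation_of_osc_fun(1)[OF li \<alpha> Q nn CQ[OF Q]] by (simp add: mult.assoc)
  qed
  have "AE x in lebesgue. ennreal (\<bar>b x\<bar> - b x) = 0"
    using \<beta> C mean_oscillation_of_osc_fun(2)[OF li \<alpha> _ nn CQ] by (intro AE_zero_of_higher_order[of _ \<beta> C]) auto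
  then show "AE x in lebesgue. 0 \<le> b x" by (rule eventually_mono) (auto simp: ennreal_eq_0_iff)
qed

theorem theorem1p1:
  fixes b :: "'a::euclidean_space \<Rightarrow> real" and \<alpha> \<beta> :: real
  assumes "0 < \<beta>" and "\<beta> < 1" and "0 < \<alpha>" and "\<alpha> < real DIM('a)"
    and "0 < \<alpha> + \<beta>" and "\<alpha> + \<beta> < real DIM('a)"
    and "locally_integrable b"
  defines "S1 \<equiv> lipschitz_beta \<beta> b \<and> (AE x in lebesgue. 0 \<le> b x)"
    and "S2 \<equiv> (\<exists>p q. (p, q) \<in> exps_Bgamma (\<alpha> + \<beta>) \<and> commutator_bounded b \<alpha> p q)"
    and "S3 \<equiv> (\<forall>p q. (p, q) \<in> exps_Bgamma (\<alpha> + \<beta>) \<longrightarrow> commutator_bounded b \<alpha> p q)"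
    and "S4 \<equiv> (\<exists>s \<in> exps_B. osc_sup \<alpha> \<beta> b s < \<infinity>)"
    and "S5 \<equiv> (\<forall>s \<in> exps_B. osc_sup \<alpha> \<beta> b s < \<infinity>)"
  shows "(S1 \<longleftrightarrow> S2) \<and> (S1 \<longleftrightarrow> S3) \<and> (S1 \<longleftrightarrow> S4) \<and> (S1 \<longleftrightarrow> S5)"
proof -
  note \<beta> = \<open>0 < \<beta>\<close> and \<alpha> = \<open>0 < \<alpha>\<close> and \<gamma> = \<open>\<alpha> + \<beta> < real DIM('a)\<close> and li = \<open>locally_integrable b\<close>
  have \<alpha>': "0 \<le> \<alpha>" "\<alpha> \<le> real DIM('a)" using \<open>0 < \<alpha>\<close> \<open>\<alpha> < real DIM('a)\<close> by auto
  have b: "b \<in> borel_measurable lebesgue" using li unfolding locally_integrable_def by blast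
  have "S1 \<Longrightarrow> S3" unfolding S1_def S3_def
    using commutator_bounded_of_lipschitz[OF \<beta> \<alpha> \<gamma> b] by blast
  \<comment> \<open>A universal statement yields an existential one only if an admissible pair
    exists; the implication from S5 to S4 rests in the same way on the exponent 2.\<close>
  moreover have "S3 \<Longrightarrow> S2" unfolding S2_def S3_def
    using exps_Bgamma_nonempty[OF \<open>0 < \<alpha> + \<beta>\<close> \<gamma>] by blast
  moreover have "S2 \<Longrightarrow> S1" unfolding S1_def S2_def
    using lipschitz_nonneg_of_osc_fun_bound[OF \<beta> li \<alpha>'] osc_fun_integral_bound_of_commutator[OF \<beta> \<alpha> \<gamma> b] by blast
  moreover have "S1 \<Longrightarrow> S5" unfolding S1_def S5_def
    using osc_sup_finite_of_lipschitz[OF \<beta> \<alpha> \<alpha>'(2) b] by blast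
  moreover have "S5 \<Longrightarrow> S4" unfolding S4_def S5_def using exps_B_const_2 by blast
  moreover have "S4 \<Longrightarrow> S1" unfolding S1_def S4_def
    using lipschitz_nonneg_of_osc_fun_bound[OF \<beta> li \<alpha>'] osc_fun_integral_bound_of_osc_sup[OF \<alpha>'(2) b] by blast
  ultimately show ?thesis by blast
qed

end
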